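(* Let $G=(V,E)$ be a finite, simple, connected graph. The following are equivalent: (i) $G$ is effective Bonnet Myers sharp, i.e. $K:=\min_{x\sim y}\kappa(x,y)>0$ and $\operatorname{diam}_{\operatorname{eff}}(G)=\frac{\max_{v}\operatorname{Deg}(v)}{K}$; (ii) $G$ is reflective and has constant Ollivier curvature (i.e. $\kappa(x,y)$ is the same for all edges $x\sim y$); (iii) $G$ is one of the following: a cocktail party graph, a Johnson graph, a halved cube, the Schläfli graph, the Gosset graph, or a cartesian product of graphs from this list which all have the same (constant) Ollivier curvature.
   Context: $d$ is the combinatorial distance, $\operatorname{Deg}(v)$ the degree, $\operatorname{diam}_{\operatorname{eff}}(G)=\frac{1}{|V|^2}\sum_{x,y\in V}d(x,y)$. Laplacian: $\Delta f(x)=\sum_{y\sim x}(f(y)-f(x))$. Ollivier curvature of an edge $x\sim y$: $\kappa(x,y)=\inf\{\Delta f(x)-\Delta f(y): f(y)-f(x)=1,\ \max_{u\sim v}|f(u)-f(v)|=1\}$. For adjacent $x\sim y$ let $V_x^y=\{v: d(v,x)<d(v,y)\}$ and $V^{xy}=\{v:d(v,x)=d(v,y)\}$. A map $\phi:V\to V$ is a reflection from $x$ to $y$ if: $\phi$ is a graph automorphism; $\phi\circ\phi=\mathrm{id}$; $\phi(x)=y$; the set of edges between $V_x^y$ and $V_y^x$ is exactly $\{\{x',\phi(x')\}: x'\in V_x^y\}$; and $\phi(z)=z$ for all $z\in V^{xy}$. $G$ is reflective if for every edge $x\sim y$ there exists a reflection from $x$ to $y$. Cocktail party graph $CP(k)$: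 $K_{2k}$ minus a perfect matching. Johnson graph $J(n,k)$: $k$-subsets of an $n$-set, adjacent iff they share $k-1$ elements. Halved cube: vertices are binary strings of length $n$ of even weight, adjacent iff they differ in exactly two coordinates. Schläfli graph: the unique strongly regular graph with parameters $(27,16,10,8)$. Gosset graph: the 56-vertex, 27-regular distance regular graph (1-skeleton of the $3_{21}$ polytope). Cartesian product $G_1\times G_2$: vertex set $V_1\times V_2$, $(a,b)\sim(a',b')$ iff ($a=a'$, $b\sim b'$) or ($a\sim a'$, $b=b'$). *)

theory Defs
  imports Main "HOL.Real"
begin

definition simple_graph :: "'a set \<Rightarrow> ('a \<Rightarrow> 'a \<Rightarrow> bool) \<Rightarrow> bool" where
  "simple_graph V E \<longleftrightarrow> finite V \<and> (\<forall>x y. E x y \<longrightarrow> x \<in> V \<and> y \<in> V)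
     \<and> (\<forall>x y. E x y \<longrightarrow> E y x) \<and> (\<forall>x. \<not> E x x)"

fun walk :: "'a set \<Rightarrow> ('a \<Rightarrow> 'a \<Rightarrow> bool) \<Rightarrow> nat \<Rightarrow> 'a \<Rightarrow> 'a \<Rightarrow> bool" where
  "walk V E 0 x y = (x = y \<and> x \<in> V)"
| "walk V E (Suc n) x y = (x \<in> V \<and> (\<exists>z\<in>V. E x z \<and> walk V E n z y))"

definition connected_graph :: "'a set \<Rightarrow> ('a \<Rightarrow> 'a \<Rightarrow> bool) \<Rightarrow> bool" where
  "connected_graph V E \<longleftrightarrow> (\<forall>x\<in>V. \<forall>y\<in>V. \<exists>n. walk V E n x y)"

definition gdist :: "'a set \<Rightarrow> ('a \<Rightarrow> 'a \<Rightarrow> bool) \<Rightarrow> 'a \<Rightarrow> 'a \<Rightarrow> nat" where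
  "gdist V E x y = (LEAST n. walk V E n x y)"

definition deg :: "'a set \<Rightarrow> ('a \<Rightarrow> 'a \<Rightarrow> bool) \<Rightarrow> 'a \<Rightarrow> nat" where
  "deg V E v = card {u \<in> V. E v u}"

definition max_deg :: "'a set \<Rightarrow> ('a \<Rightarrow> 'a \<Rightarrow> bool) \<Rightarrow> nat" where
  "max_deg V E = Max (deg V E ` V)"

definition eff_diam :: "'a set \<Rightarrow> ('a \<Rightarrow> 'a \<Rightarrow> bool) \<Rightarrow> real" where
  "eff_diam V E = (\<Sum>x\<in>V. \<Sum>y\<in>V. real (gdist V E x y)) / (real (card V))^2"

definition laplacian :: "'a set \<Rightarrow> ('a \<Rightarrow> 'a \<Rightarrow> bool) \<Rightarrow> ('a \<Rightarrow> real) \<Rightarrow> 'a \<Rightarrow> real" where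
  "laplacian V E f x = (\<Sum>y\<in>{y \<in> V. E x y}. f y - f x)"

text \<open>Ollivier curvature of an edge x ~ y (Lin-Lu-Yau / Muench-Wojciechowski formulation).\<close>
definition ollivier :: "'a set \<Rightarrow> ('a \<Rightarrow> 'a \<Rightarrow> bool) \<Rightarrow> 'a \<Rightarrow> 'a \<Rightarrow> real" where
  "ollivier V E x y = Inf {laplacian V E f x - laplacian V E f y | f.
      f y - f x = 1 \<and> Max {\<bar>f u - f v\<bar> | u v. u \<in> V \<and> v \<in> V \<and> E u v} = 1}"

definition min_curv :: "'a set \<Rightarrow> ('a \<Rightarrow> 'a \<Rightarrow> bool) \<Rightarrow> real" where
  "min_curv V E = Min {ollivier V E x y | x y. x \<in> V \<and> y \<in> V \<and> E x y}"

definition bonnet_myers_sharp :: "'a set \<Rightarrow> ('a \<Rightarrow> 'a \<Rightarrow> bool) \<Rightarrow> bool" where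
  "bonnet_myers_sharp V E \<longleftrightarrow> min_curv V E > 0 \<and>
     eff_diam V E = real (max_deg V E) / min_curv V E"

definition constant_curvature :: "'a set \<Rightarrow> ('a \<Rightarrow> 'a \<Rightarrow> bool) \<Rightarrow> real \<Rightarrow> bool" where
  "constant_curvature V E c \<longleftrightarrow> (\<forall>x\<in>V. \<forall>y\<in>V. E x y \<longrightarrow> ollivier V E x y = c)"

definition automorphism :: "'a set \<Rightarrow> ('a \<Rightarrow> 'a \<Rightarrow> bool) \<Rightarrow> ('a \<Rightarrow> 'a) \<Rightarrow> bool" where
  "automorphism V E \<phi> \<longleftrightarrow> bij_betw \<phi> V V \<and> (\<forall>u\<in>V. \<forall>v\<in>V. E u v \<longleftrightarrow> E (\<phi> u) (\<phi> v))"

definition closer_to :: "'a set \<Rightarrow> ('a \<Rightarrow> 'a \<Rightarrow> bool) \<Rightarrow> 'a \<Rightarrow> 'a \<Rightarrow> 'a set" where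
  "closer_to V E x y = {v \<in> V. gdist V E v x < gdist V E v y}"

definition equidist :: "'a set \<Rightarrow> ('a \<Rightarrow> 'a \<Rightarrow> bool) \<Rightarrow> 'a \<Rightarrow> 'a \<Rightarrow> 'a set" where
  "equidist V E x y = {v \<in> V. gdist V E v x = gdist V E v y}"

definition is_reflection :: "'a set \<Rightarrow> ('a \<Rightarrow> 'a \<Rightarrow> bool) \<Rightarrow> 'a \<Rightarrow> 'a \<Rightarrow> ('a \<Rightarrow> 'a) \<Rightarrow> bool" where
  "is_reflection V E x y \<phi> \<longleftrightarrow>
     automorphism V E \<phi> \<and> (\<forall>v\<in>V. \<phi> (\<phi> v) = v) \<and> \<phi> x = y \<and>
     {{u, w} | u w. u \<in> closer_to V E x y \<and> w \<in> closer_to V E y x \<and> E u w}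
       = {{x', \<phi> x'} | x'. x' \<in> closer_to V E x y} \<and>
     (\<forall>z\<in>equidist V E x y. \<phi> z = z)"

definition reflective :: "'a set \<Rightarrow> ('a \<Rightarrow> 'a \<Rightarrow> bool) \<Rightarrow> bool" where
  "reflective V E \<longleftrightarrow> (\<forall>x\<in>V. \<forall>y\<in>V. E x y \<longrightarrow> (\<exists>\<phi>. is_reflection V E x y \<phi>))"

definition graph_iso :: "'a set \<Rightarrow> ('a \<Rightarrow> 'a \<Rightarrow> bool) \<Rightarrow> 'b set \<Rightarrow> ('b \<Rightarrow> 'b \<Rightarrow> bool) \<Rightarrow> bool" where
  "graph_iso V E W F \<longleftrightarrow> (\<exists>h. bij_betw h V W \<and> (\<forall>u\<in>V. \<forall>v\<in>V. E u v \<longleftrightarrow> F (h u) (h v)))"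

definition cocktail_V :: "nat \<Rightarrow> nat set set" where
  "cocktail_V k = {{i} | i. i < 2 * k}"
definition cocktail_E :: "nat set \<Rightarrow> nat set \<Rightarrow> bool" where
  "cocktail_E A B \<longleftrightarrow> (\<exists>i j. A = {i} \<and> B = {j} \<and> i \<noteq> j \<and> i div 2 \<noteq> j div 2)"

definition johnson_V :: "nat \<Rightarrow> nat \<Rightarrow> nat set set" where
  "johnson_V n k = {A. A \<subseteq> {..<n} \<and> card A = k}"
definition johnson_E :: "nat \<Rightarrow> nat \<Rightarrow> nat set \<Rightarrow> nat set \<Rightarrow> bool" where
  "johnson_E n k A B \<longleftrightarrow> A \<in> johnson_V n k \<and> B \<in> johnson_V n k \<and> A \<noteq> B \<and> card (A \<inter> B) + 1 = k"

text \<open>Halved n-cube: even-weight binary strings of length n, encoded by their supports.\<close>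
definition halved_V :: "nat \<Rightarrow> nat set set" where
  "halved_V n = {A. A \<subseteq> {..<n} \<and> even (card A)}"
definition halved_E :: "nat \<Rightarrow> nat set \<Rightarrow> nat set \<Rightarrow> bool" where
  "halved_E n A B \<longleftrightarrow> A \<in> halved_V n \<and> B \<in> halved_V n \<and> card ((A - B) \<union> (B - A)) = 2"

text \<open>Schlaefli graph: the (unique) strongly regular graph with parameters (27,16,10,8).\<close>
definition srg :: "'a set \<Rightarrow> ('a \<Rightarrow> 'a \<Rightarrow> bool) \<Rightarrow> nat \<Rightarrow> nat \<Rightarrow> nat \<Rightarrow> nat \<Rightarrow> bool" where
  "srg V E n k l m \<longleftrightarrow> simple_graph V E \<and> card V = n \<and> (\<forall>v\<in>V. deg V E v = k) \<and>
     (\<forall>x\<in>V. \<forall>y\<in>V. E x y \<longrightarrow> card {z \<in> V. E x z \<and> E y z} = l) \<and>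
     (\<forall>x\<in>V. \<forall>y\<in>V. x \<noteq> y \<and> \<not> E x y \<longrightarrow> card {z \<in> V. E x z \<and> E y z} = m)"

definition is_schlafli :: "'a set \<Rightarrow> ('a \<Rightarrow> 'a \<Rightarrow> bool) \<Rightarrow> bool" where
  "is_schlafli V E \<longleftrightarrow> srg V E 27 16 10 8"

text \<open>Gosset graph: vertices are (s, P) with s a sign and P a 2-subset of {0..7}
  (corresponding to the vectors s*(3,3,-1,...,-1) in R^8, 3s at the positions in P);
  encoded as P, or P with 8 added for the negative sign. Adjacency = inner product 8:
  same sign and |P inter Q| = 1, or opposite signs and P, Q disjoint.\<close>
definition gosset_V :: "nat set set" where
  "gosset_V = {A. A \<subseteq> {..<9} \<and> card (A \<inter> {..<8}) = 2}"
definition gosset_E :: "nat set \<Rightarrow> nat set \<Rightarrow> bool" where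
  "gosset_E A B \<longleftrightarrow> A \<in> gosset_V \<and> B \<in> gosset_V \<and>
     ((((8::nat) \<in> A) = (8 \<in> B) \<and> card (A \<inter> B \<inter> {..<8}) = 1) \<or>
      (((8::nat) \<in> A) \<noteq> (8 \<in> B) \<and> A \<inter> B \<inter> {..<8} = {}))"

definition in_family :: "nat set set \<Rightarrow> (nat set \<Rightarrow> nat set \<Rightarrow> bool) \<Rightarrow> bool" where
  "in_family W F \<longleftrightarrow> simple_graph W F \<and>
     ((\<exists>k. graph_iso W F (cocktail_V k) cocktail_E) \<or>
      (\<exists>n k. graph_iso W F (johnson_V n k) (johnson_E n k)) \<or>
      (\<exists>n. graph_iso W F (halved_V n) (halved_E n)) \<or>
      is_schlafli W F \<or>
      graph_iso W F gosset_V gosset_E)"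

definition prod_V :: "('b set \<times> ('b \<Rightarrow> 'b \<Rightarrow> bool)) list \<Rightarrow> 'b list set" where
  "prod_V gs = {xs. length xs = length gs \<and> (\<forall>i<length gs. xs ! i \<in> fst (gs ! i))}"
definition prod_E :: "('b set \<times> ('b \<Rightarrow> 'b \<Rightarrow> bool)) list \<Rightarrow> 'b list \<Rightarrow> 'b list \<Rightarrow> bool" where
  "prod_E gs xs ys \<longleftrightarrow> xs \<in> prod_V gs \<and> ys \<in> prod_V gs \<and>
     (\<exists>i<length gs. snd (gs ! i) (xs ! i) (ys ! i) \<and> (\<forall>j<length gs. j \<noteq> i \<longrightarrow> xs ! j = ys ! j))"

end

theory Submission
  imports Defs
begin

text \<open>
Put \<open>\<langle>w\<rangle> = d(w,y) - d(w,x) \<in> {-1,0,1}\<close> for an edge \<open>x ~ y\<close>. The graph is reflective iff every edge has a map \<open>\<phi>\<close> with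
\<open>d(z, \<phi> w) = d(z,w) + \<langle>w\<rangle>\<langle>z\<rangle>\<close>, which is the orthogonal reflection in the root \<open>y - x\<close> for points whose squared
distances are \<open>2d\<close>. In such a graph the curvature of \<open>x ~ y\<close> is two plus the number of triangles on \<open>xy\<close>.

If all curvatures are at least \<open>K\<close>, then \<open>\<Delta> d(z,\<cdot>)(y) \<le> deg z - K d(z,y)\<close> along a geodesic from \<open>z\<close>; summing over \<open>y\<close>
bounds the effective diameter, and sharpness means equality for all \<open>z, y\<close>. In that case Hall's theorem yields a perfect
matching of the two sides of each edge, the distance functions are tight for it, and the mirrors are obtained by
propagating the matchings along geodesics. Conversely the mirrors give the equality.

For the classification, encode a vertex by its inner products with the roots at a base vertex \<open>b\<close>. The mirrors through
\<open>b\<close> act on these codes by a formula that involves only the graph on the neighbours of \<open>b\<close>, so this neighbourhood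
determines the whole graph. Its components are again graphs with mirrors, of diameter at most two, hence by induction
products of two cliques, cocktail party graphs, Johnson graphs \<open>J(n,2)\<close>, the halved 5-cube or the Schlaefli graph. These
are precisely the neighbourhoods in \<open>J(n,k)\<close>, in cocktail party graphs, in halved cubes, in the Schlaefli graph and in
the Gosset graph, so the graph is the product of the corresponding listed graphs.
\<close>

text \<open>The definition of a reflection controls only the edges that cross between the two sides,
  whereas everything later needs distances. The formula for \<open>mirror\<close> repairs this: it
  determines each image uniquely, makes the map an involutive automorphism, and passes to isomorphic
  copies, neighbourhoods and products. The obstacle, from reflectivity and from sharpness alike, is
  to show that opposite edges of a square displace all distances equally. One reflection or matching
  settles only part of the vertices; a second one, taken at the opposite edge of the square, settles
  the rest. Curvature enters the classification only at its end: all graphs with mirrors are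
  classified, and constant curvature then selects the products whose factors agree. The induction
  closes because a component of a neighbourhood has diameter at most two: larger Johnson graphs,
  larger halved cubes and the Gosset graph contain vertices at distance three and so never recur as
  components, while every listed graph of diameter at most two is the neighbourhood of another
  listed graph.\<close>

definition gd :: "'a set \<Rightarrow> ('a \<Rightarrow> 'a \<Rightarrow> bool) \<Rightarrow> 'a \<Rightarrow> 'a \<Rightarrow> int" where
  "gd V E x y = int (gdist V E x y)"

subsection \<open>Distances and mirrors\<close>

lemma walk_append: "walk V E m x y \<Longrightarrow> walk V E n y z \<Longrightarrow> walk V E (m + n) x z"
  by (induction m arbitrary: x) auto

lemma walk_rev:
  assumes "simple_graph V E" "walk V E n x y" shows "walk V E n y x"
  using assms(2)
proof (induction n arbitrary: x)
  case (Suc n)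
  then obtain z where z: "z \<in> V" "E x z" "walk V E n z y" and x: "x \<in> V" by auto
  have "walk V E 1 z x" using z x assms(1) by (auto simp: simple_graph_def)
  from walk_append[OF Suc.IH[OF z(3)] this] show ?case by simp
qed auto

text \<open>Descending with \<open>step\<close> produces a walk of length
  \<open>\<delta> x y\<close>, and \<open>lip\<close> forbids a shorter one. A closed formula thus
  yields connectedness and the metric of a concrete graph at once.\<close>

lemma gdist_eqI:
  fixes \<delta> :: "'a \<Rightarrow> 'a \<Rightarrow> nat"
  assumes sg: "simple_graph V E"
    and refl: "\<And>x. x \<in> V \<Longrightarrow> \<delta> x x = 0"
    and lip: "\<And>x y z. x \<in> V \<Longrightarrow> E y z \<Longrightarrow> \<delta> x z \<le> \<delta> x y + 1"
    and step: "\<And>x y. x \<in> V \<Longrightarrow> y \<in> V \<Longrightarrow> x \<noteq> y \<Longrightarrow> \<exists>u\<in>V. E u y \<and> \<delta> x y = \<delta> x u + 1"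
  shows "connected_graph V E" and "x \<in> V \<Longrightarrow> y \<in> V \<Longrightarrow> gdist V E x y = \<delta> x y"
proof -
  have up: "walk V E (\<delta> x y) x y" if xy: "x \<in> V" "y \<in> V" for x y
    using that(2)
  proof (induction "\<delta> x y" arbitrary: y)
    case 0
    then have "x = y" using step[of x y] that(1) by fastforce
    then show ?case using 0 that by (metis walk.simps(1))
  next
    case (Suc n)
    have "x \<noteq> y" using Suc.hyps(2) refl that(1) by fastforce
    then obtain u where u: "u \<in> V" "E u y" "\<delta> x y = \<delta> x u + 1" using step[OF xy(1) Suc.prems \<open>x \<noteq> y\<close>] by blast
    have "walk V E 1 u y" using u Suc.prems by auto
    with Suc.hyps(1)[of u] u Suc.hyps(2) walk_append[of V E "\<delta> x u" x u 1 y] show ?case by simp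
  qed
  have lo: "\<delta> x y \<le> n" if "x \<in> V" "walk V E n y x" for x y n
    using that(2)
  proof (induction n arbitrary: y)
    case (Suc n)
    then obtain z where z: "E y z" "walk V E n z x" by auto
    have "E z y" using z sg by (auto simp: simple_graph_def)
    with lip[OF that(1) this] Suc.IH[OF z(2)] show ?case by linarith
  qed (use refl that in auto)
  show "connected_graph V E" using up unfolding connected_graph_def by blast
  show "gdist V E x y = \<delta> x y" if "x \<in> V" "y \<in> V"
    unfolding gdist_def using up[OF that] lo[OF that(1)] walk_rev[OF sg]
    by (intro Least_equality) auto
qed

locale cgraph =
  fixes V :: "'a set" and E :: "'a \<Rightarrow> 'a \<Rightarrow> bool"
  assumes simple: "simple_graph V E" and conn: "connected_graph V E"
begin

abbreviation d :: "'a \<Rightarrow> 'a \<Rightarrow> int" where "d \<equiv> gd V E"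

lemma finV: "finite V" and E_in: "E x y \<Longrightarrow> x \<in> V \<and> y \<in> V"
  and E_sym: "E x y \<Longrightarrow> E y x" and E_irrefl: "\<not> E x x"
  using simple unfolding simple_graph_def by blast+

lemma E_commute: "E x y \<longleftrightarrow> E y x" using E_sym by blast

lemma gdist_walk: "x \<in> V \<Longrightarrow> y \<in> V \<Longrightarrow> walk V E (gdist V E x y) x y"
  unfolding gdist_def using conn unfolding connected_graph_def by (meson LeastI_ex)

lemma gdist_le: "walk V E n x y \<Longrightarrow> gdist V E x y \<le> n"
  unfolding gdist_def by (rule Least_le)

lemma d_nonneg [simp]: "0 \<le> d x y" by (simp add: gd_def)

lemma d_sym: "x \<in> V \<Longrightarrow> y \<in> V \<Longrightarrow> d x y = d y x"
  unfolding gd_def using gdist_le walk_rev[OF simple] gdist_walk by (metis order_antisym)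

lemma d_self [simp]: "x \<in> V \<Longrightarrow> d x x = 0"
  unfolding gd_def using gdist_le[of 0 x x] by simp

lemma d_eq0 [simp]: "x \<in> V \<Longrightarrow> y \<in> V \<Longrightarrow> d x y = 0 \<longleftrightarrow> x = y"
  using gdist_walk[of x y] d_self[of x] by (auto simp: gd_def)

lemma d_triangle: "x \<in> V \<Longrightarrow> y \<in> V \<Longrightarrow> z \<in> V \<Longrightarrow> d x z \<le> d x y + d y z"
  unfolding gd_def using gdist_le walk_append gdist_walk by (metis of_nat_add of_nat_mono)

lemma d_eq1: "x \<in> V \<Longrightarrow> y \<in> V \<Longrightarrow> d x y = 1 \<longleftrightarrow> E x y"
proof
  assume "x \<in> V" "y \<in> V" "d x y = 1"
  then show "E x y" using gdist_walk[of x y] by (auto simp: gd_def)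
next
  assume *: "x \<in> V" "y \<in> V" "E x y"
  then have "walk V E 1 x y" by auto
  then have "d x y \<le> 1" unfolding gd_def using gdist_le by fastforce
  moreover have "d x y \<noteq> 0" using * E_irrefl by auto
  ultimately show "d x y = 1" using d_nonneg[of x y] by linarith
qed

lemma d_edge: "E x y \<Longrightarrow> d x y = 1" using d_eq1 E_in by blast

lemma d_lip: "x \<in> V \<Longrightarrow> E y z \<Longrightarrow> d x z \<le> d x y + 1 \<and> d x y \<le> d x z + 1"
  using d_triangle[of x y z] d_triangle[of x z y] d_edge[of y z] d_edge[of z y] E_sym E_in by metis

lemma d_step:
  assumes "x \<in> V" "y \<in> V" "x \<noteq> y" obtains u where "u \<in> V" "E x u" "d u y = d x y - 1"
proof -
  have "gdist V E x y \<noteq> 0" using d_eq0[of x y] assms by (auto simp: gd_def)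
  then obtain n where n: "gdist V E x y = Suc n" using not0_implies_Suc by blast
  then obtain u where u: "u \<in> V" "E x u" "walk V E n u y" using gdist_walk[OF assms(1,2)] by auto
  have "d u y \<le> d x y - 1" using gdist_le[OF u(3)] n by (simp add: gd_def)
  moreover have "d x y \<le> d u y + 1" using d_triangle[of x u y] d_edge[OF u(2)] u assms by simp
  ultimately show ?thesis using that u by simp
qed

lemma d_step2:
  assumes "x \<in> V" "y \<in> V" "x \<noteq> y" obtains u where "u \<in> V" "E u y" "d x u = d x y - 1"
  using d_step[of y x] assms by (metis E_commute d_sym)

lemma d_induct [consumes 2, case_names base step]:
  assumes "x \<in> V" "y \<in> V" "P x"
    and "\<And>u y. u \<in> V \<Longrightarrow> y \<in> V \<Longrightarrow> E u y \<Longrightarrow> d x y = d x u + 1 \<Longrightarrow> P u \<Longrightarrow> P y"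
  shows "P y"
  using assms(2)
proof (induction "nat (d x y)" arbitrary: y)
  case 0
  then have "d x y = 0" using d_nonneg[of x y] by linarith
  then show ?case using assms(1,3) 0 by simp
next
  case (Suc n)
  have "x \<noteq> y" using Suc assms(1) by auto
  then obtain u where u: "u \<in> V" "E u y" "d x u = d x y - 1" using d_step2 assms(1) Suc.prems by metis
  have "P u" using Suc.hyps u by auto
  then show ?case using assms(4)[of u y] u Suc.prems by simp
qed

end

text \<open>Bijectivity, involutivity and the exchange of \<open>x\<close> and \<open>y\<close> are
  consequences of the distance formula (\<open>mir_bij\<close>, \<open>mir_mir\<close>,
  \<open>mir_swap\<close>), so they are not demanded here.\<close>

definition mirror :: "'a set \<Rightarrow> ('a \<Rightarrow> 'a \<Rightarrow> bool) \<Rightarrow> 'a \<Rightarrow> 'a \<Rightarrow> ('a \<Rightarrow> 'a) \<Rightarrow> bool" where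
  "mirror V E x y \<phi> \<longleftrightarrow> (\<forall>w\<in>V. \<phi> w \<in> V \<and> (\<forall>z\<in>V.
     gd V E z (\<phi> w) = gd V E z w + (gd V E w y - gd V E w x) * (gd V E z y - gd V E z x)))"

locale rgraph = cgraph +
  assumes mirrors: "E x y \<Longrightarrow> \<exists>\<phi>. mirror V E x y \<phi>"

section \<open>Mirrors from closing squares\<close>

context cgraph begin

lemma exists_mirror:
  assumes E: "E x y"
    and pos: "\<And>w. w \<in> V \<Longrightarrow> d w y = d w x + 1 \<Longrightarrow> \<exists>w'\<in>V. \<forall>z\<in>V. d z w' = d z w + (d z y - d z x)"
    and neg: "\<And>w. w \<in> V \<Longrightarrow> d w x = d w y + 1 \<Longrightarrow> \<exists>w'\<in>V. \<forall>z\<in>V. d z w' = d z w + (d z x - d z y)"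
  shows "\<exists>\<phi>. mirror V E x y \<phi>"
proof -
  have "\<exists>w'\<in>V. \<forall>z\<in>V. d z w' = d z w + (d w y - d w x) * (d z y - d z x)" if w: "w \<in> V" for w
  proof -
    consider "d w y = d w x + 1" | "d w y = d w x" | "d w x = d w y + 1"
      using d_lip[OF w E] by linarith
    then show ?thesis
    proof cases
      case 1 then show ?thesis using pos[OF w 1] by auto
    next
      case 2 then show ?thesis using w by auto
    next
      case 3 then show ?thesis using neg[OF w 3] by auto
    qed
  qed
  then show ?thesis unfolding mirror_def by metis
qed

text \<open>If \<open>u u'\<close> is the edge opposite to \<open>x y\<close> in a square, then
  \<open>d z u' - d z u = d z y - d z x\<close> for all \<open>z\<close>. The displacement can
  therefore be carried along a geodesic from \<open>x\<close> to any \<open>w\<close> on the side of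
  \<open>x\<close>, one square at a time.\<close>

lemma square_imp_mirror:
  assumes sq: "\<And>x y u. E x y \<Longrightarrow> E x u \<Longrightarrow> d u y = d u x + 1 \<Longrightarrow> \<exists>u'\<in>V. \<forall>z\<in>V. d z u' = d z u + (d z y - d z x)"
    and E: "E x y"
  shows "\<exists>\<phi>. mirror V E x y \<phi>"
proof -
  have half: "\<exists>w'\<in>V. \<forall>z\<in>V. d z w' = d z w + (d z y - d z x)"
    if E: "E x y" and w: "w \<in> V" and "d w y = d w x + 1" for x y w
  proof -
    have xy: "x \<in> V" "y \<in> V" using E E_in by auto
    from xy(1) w have "d w y = d w x + 1 \<longrightarrow> ?thesis"
    proof (induction rule: d_induct)
      case base
      show ?case by (intro impI bexI[of _ y]) (use xy in auto)
    next
      case (step u w)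
      show ?case
      proof
        assume *: "d w y = d w x + 1"
        have s: "d w x = d x w" "d u x = d x u" "d y w = d w y" "d y u = d u y" using step.hyps xy d_sym by blast+
        \<comment> \<open>A geodesic from \<open>x\<close> to a vertex on the side of
          \<open>x\<close> stays on that side: otherwise \<open>y\<close> would be too close to
          \<open>w\<close>.\<close>
        have "d u y = d u x + 1"
          using d_lip[OF xy(2) step.hyps(3)] d_lip[OF step.hyps(1) E] s step.hyps(4) * by linarith
        with step.IH obtain u' where u': "u' \<in> V" "\<And>z. z \<in> V \<Longrightarrow> d z u' = d z u + (d z y - d z x)" by auto
        have "d u u' = 1" using u'(2)[of u] step.hyps \<open>d u y = _\<close> by simp
        then have "E u u'" using d_eq1 step.hyps u' by blast
        \<comment> \<open>The next square stands on the edge \<open>u u'\<close> and on the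
          neighbour \<open>w\<close> of \<open>u\<close>.\<close>
        moreover have "d w u' = d w u + 1" using u'(2)[of w] step.hyps * by simp
        ultimately obtain w' where "w' \<in> V" "\<forall>z\<in>V. d z w' = d z w + (d z u' - d z u)"
          using sq step.hyps(3) by blast
        then show "\<exists>w'\<in>V. \<forall>z\<in>V. d z w' = d z w + (d z y - d z x)" using u'(2) by (intro bexI[of _ w']) auto
      qed
    qed
    then show ?thesis using that by simp
  qed
  show ?thesis using exists_mirror[OF E half[OF E] half[OF E_sym[OF E]]] by blast
qed

end

section \<open>Mirrors are reflections\<close>

context rgraph begin

definition mir :: "'a \<Rightarrow> 'a \<Rightarrow> 'a \<Rightarrow> 'a" where "mir x y = (SOME \<phi>. mirror V E x y \<phi>)"

lemma mirror_mir: "E x y \<Longrightarrow> mirror V E x y (mir x y)"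
  unfolding mir_def using mirrors by (rule someI_ex)

context fixes x y assumes E: "E x y" begin

lemma mir_in: "w \<in> V \<Longrightarrow> mir x y w \<in> V"
  using mirror_mir[OF E] by (simp add: mirror_def)

lemma mir_d: "z \<in> V \<Longrightarrow> w \<in> V \<Longrightarrow> d z (mir x y w) = d z w + (d w y - d w x) * (d z y - d z x)"
  using mirror_mir[OF E] by (simp add: mirror_def)

lemma mir_d': "z \<in> V \<Longrightarrow> w \<in> V \<Longrightarrow> d (mir x y w) z = d w z + (d w y - d w x) * (d z y - d z x)"
  using mir_d[of z w] mir_in[of w] d_sym[of z w] d_sym[of z "mir x y w"] by simp

lemma mir_swap: "mir x y x = y" "mir x y y = x"
proof -
  have *: "x \<in> V" "y \<in> V" "d x y = 1" "d y x = 1" using E E_in d_edge E_sym by auto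
  then show "mir x y x = y" "mir x y y = x"
    using mir_d[of y x] mir_d[of x y] d_eq0[of y "mir x y x"] d_eq0[of x "mir x y y"] mir_in[of x] mir_in[of y]
    by auto
qed

text \<open>The formula at \<open>z = x\<close> and \<open>z = y\<close> shows that the displacement
  of \<open>mir x y w\<close> is minus that of \<open>w\<close>; the correction terms then
  cancel.\<close>

lemma mir_iso: assumes "z \<in> V" "w \<in> V" shows "d (mir x y z) (mir x y w) = d z w"
proof -
  have *: "x \<in> V" "y \<in> V" "d x y = 1" "d y x = 1" using E E_in d_edge E_sym by auto
  then show ?thesis
    using assms by (simp add: mir_d mir_d' mir_in algebra_simps)
qed

lemma mir_mir: assumes "w \<in> V" shows "mir x y (mir x y w) = w"
proof -
  have *: "x \<in> V" "y \<in> V" "d x y = 1" "d y x = 1" using E E_in d_edge E_sym by auto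
  then have "d w (mir x y (mir x y w)) = 0"
    using assms by (simp add: mir_d mir_d' mir_in algebra_simps)
  then show ?thesis using assms mir_in d_eq0 by metis
qed

lemma mir_E: "z \<in> V \<Longrightarrow> w \<in> V \<Longrightarrow> E (mir x y z) (mir x y w) \<longleftrightarrow> E z w"
  using mir_iso[of z w] d_eq1[of z w] d_eq1[of "mir x y z" "mir x y w"] mir_in[of z] mir_in[of w] by simp

lemma mir_bij: "bij_betw (mir x y) V V"
  by (rule bij_betw_byWitness[of _ "mir x y"]) (auto simp: mir_mir mir_in)

lemma d_cases: 
  assumes "w \<in> V"
  obtains "d w y = d w x + 1" | "d w y = d w x" | "d w x = d w y + 1"
  using d_lip[OF assms E] by linarith

lemma mir_fix: "w \<in> V \<Longrightarrow> d w y = d w x \<Longrightarrow> mir x y w = w"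
  using mir_d[of w w] d_eq0[of w "mir x y w"] mir_in[of w] by simp

lemma mir_adj: assumes "w \<in> V" "d w y \<noteq> d w x" shows "E w (mir x y w)"
proof -
  have "(d w y - d w x) * (d w y - d w x) = 1"
    using assms(2) by (cases rule: d_cases[OF assms(1)]) auto
  then show ?thesis using mir_d[of w w] d_eq1[of w "mir x y w"] mir_in[of w] assms(1) by simp
qed

text \<open>By the formula \<open>mir x y u\<close> has distance \<open>1 - 1 = 0\<close> from
  \<open>w\<close>, so every edge across the wall is a matching edge.\<close>

lemma mir_unique:
  assumes "u \<in> V" "w \<in> V" "E u w" "d u y = d u x + 1" "d w x = d w y + 1" shows "w = mir x y u"
proof -
  have "d w (mir x y u) = 0" using mir_d[of w u] assms d_edge[of w u] E_sym[OF assms(3)] by simp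
  then show ?thesis using assms mir_in d_eq0 by metis
qed

lemma is_reflection_mir: "is_reflection V E x y (mir x y)"
proof -
  have gi: "gdist V E u v < gdist V E u w \<longleftrightarrow> d u v < d u w" "gdist V E u v = gdist V E u w \<longleftrightarrow> d u v = d u w" for u v w
    by (simp_all add: gd_def)
  have xy: "x \<in> V" "y \<in> V" "d x y = 1" "d y x = 1" using E E_in d_edge E_sym by auto
  have "{{u, w} | u w. u \<in> closer_to V E x y \<and> w \<in> closer_to V E y x \<and> E u w}
       = {{x', mir x y x'} | x'. x' \<in> closer_to V E x y}" (is "?A = ?B")
  proof
    show "?A \<subseteq> ?B"
    proof
      fix e assume "e \<in> ?A"
      then obtain u w where uw: "e = {u,w}" "u \<in> V" "w \<in> V" "d u x < d u y" "d w y < d w x" "E u w"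
        unfolding closer_to_def gi by auto
      then have "d u y = d u x + 1" "d w x = d w y + 1" using d_lip[OF _ E, of u] d_lip[OF _ E, of w] by linarith+
      with uw mir_unique have "w = mir x y u" by blast
      then show "e \<in> ?B" using uw unfolding closer_to_def gi by auto
    qed
    show "?B \<subseteq> ?A"
    proof
      fix e assume "e \<in> ?B"
      then obtain u where u: "e = {u, mir x y u}" "u \<in> V" "d u x < d u y"
        unfolding closer_to_def gi by auto
      have "d (mir x y u) y < d (mir x y u) x" using u xy by (simp add: mir_d')
      moreover have "E u (mir x y u)" using u by (intro mir_adj) auto
      ultimately show "e \<in> ?A" using u mir_in unfolding closer_to_def gi by blast
    qed
  qed
  then show ?thesis unfolding is_reflection_def automorphism_def equidist_def gi
    using mir_bij mir_E mir_mir mir_swap mir_fix by simp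
qed

end

lemma reflective: "reflective V E"
  unfolding reflective_def using is_reflection_mir by blast

end

section \<open>Reflections are mirrors\<close>

context cgraph begin

lemma closer_iff: "v \<in> closer_to V E x y \<longleftrightarrow> v \<in> V \<and> d v x < d v y"
  and equidist_iff: "v \<in> equidist V E x y \<longleftrightarrow> v \<in> V \<and> d v x = d v y"
  by (auto simp: closer_to_def equidist_def gd_def)

context
  fixes x y \<phi> assumes E: "E x y" and R: "is_reflection V E x y \<phi>"
begin

lemma refl_in: "v \<in> V \<Longrightarrow> \<phi> v \<in> V"
  using R unfolding is_reflection_def automorphism_def bij_betw_def by auto

lemma refl_refl: "v \<in> V \<Longrightarrow> \<phi> (\<phi> v) = v"
  and refl_E: "u \<in> V \<Longrightarrow> v \<in> V \<Longrightarrow> E (\<phi> u) (\<phi> v) \<longleftrightarrow> E u v"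
  and refl_x: "\<phi> x = y"
  and refl_fix: "z \<in> V \<Longrightarrow> d z x = d z y \<Longrightarrow> \<phi> z = z"
  using R unfolding is_reflection_def automorphism_def by (auto simp: equidist_iff)

lemma refl_y: "\<phi> y = x" using refl_refl[of x] refl_x E_in[OF E] by simp

lemma refl_le: assumes "u \<in> V" "v \<in> V" shows "d (\<phi> u) (\<phi> v) \<le> d u v"
  using assms
proof (induction rule: d_induct)
  case base then show ?case using assms refl_in by simp
next
  case (step w v)
  then show ?case using d_lip[of "\<phi> u" "\<phi> w" "\<phi> v"] refl_in refl_E assms by fastforce
qed

lemma refl_d: assumes "u \<in> V" "v \<in> V" shows "d (\<phi> u) (\<phi> v) = d u v"
  using refl_le[OF assms] refl_le[OF refl_in[OF assms(1)] refl_in[OF assms(2)]] refl_refl assms by simp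

lemma refl_closer: "v \<in> V \<Longrightarrow> d v x < d v y \<Longrightarrow> E v (\<phi> v)"
  and refl_match: "u \<in> V \<Longrightarrow> w \<in> V \<Longrightarrow> d u x < d u y \<Longrightarrow> d w y < d w x \<Longrightarrow> E u w \<Longrightarrow> w = \<phi> u"
proof -
  let ?A = "{{u, w} | u w. u \<in> closer_to V E x y \<and> w \<in> closer_to V E y x \<and> E u w}"
  have AB: "?A = {{x', \<phi> x'} | x'. x' \<in> closer_to V E x y}" (is "_ = ?B")
    using R unfolding is_reflection_def by blast
  show "E v (\<phi> v)" if "v \<in> V" "d v x < d v y"
  proof -
    have "v \<in> closer_to V E x y" using that by (simp add: closer_iff)
    then have "{v, \<phi> v} \<in> ?B" by auto
    then have "{v, \<phi> v} \<in> ?A" by (simp only: AB)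
    then obtain u w where "{v, \<phi> v} = {u, w}" "E u w" by blast
    then show ?thesis using E_sym by (metis doubleton_eq_iff)
  qed
  show "w = \<phi> u" if "u \<in> V" "w \<in> V" "d u x < d u y" "d w y < d w x" "E u w"
  proof -
    have "u \<in> closer_to V E x y" "w \<in> closer_to V E y x" using that by (simp_all add: closer_iff)
    then have "{u, w} \<in> ?A" using that by auto
    then have "{u, w} \<in> ?B" by (simp only: AB)
    then obtain x' where x': "{u, w} = {x', \<phi> x'}" "d x' x < d x' y" by (auto simp: closer_iff)
    \<comment> \<open>The pair is unordered; the side of \<open>x'\<close> decides which of its
      elements is \<open>u\<close>.\<close>
    with that have "x' \<noteq> w" by auto
    with x'(1) show ?thesis by (metis doubleton_eq_iff)
  qed
qed

lemma refl_side: "v \<in> V \<Longrightarrow> d (\<phi> v) x = d v y \<and> d (\<phi> v) y = d v x"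
  using refl_d[of v y] refl_d[of v x] refl_x refl_y E_in[OF E] by simp

text \<open>Folding along the reflection is 1-Lipschitz, so no path profits from crossing the wall.\<close>
lemma refl_fold:
  assumes z: "z \<in> V" and b: "b \<in> V" and "d z x < d z y"
  shows "d z (if d b y < d b x then \<phi> b else b) \<le> d z b"
  using z b
proof (induction rule: d_induct)
  case base then show ?case using assms by simp
next
  case (step a b)
  let ?f = "\<lambda>b. if d b y < d b x then \<phi> b else b"
  \<comment> \<open>An edge inside one closed side is kept or reflected, and an edge across the wall
    joins a vertex to its own image, hence collapses.\<close>
  have "E (?f a) (?f b) \<or> ?f a = ?f b"
  proof -
    consider "d a x < d a y" | "d a x = d a y" | "d a y < d a x" by linarith
    moreover consider "d b x < d b y" | "d b x = d b y" | "d b y < d b x" by linarith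
    ultimately show ?thesis
      using step.hyps refl_E[of a b] refl_fix[of a] refl_fix[of b] refl_match[of a b] refl_match[of b a]
        refl_refl E_sym[OF step.hyps(3)]
      by (smt (verit))
  qed
  moreover have "?f a \<in> V" "?f b \<in> V" using step.hyps refl_in by auto
  ultimately have "d z (?f b) \<le> d z (?f a) + 1" using d_lip[OF z, of "?f a" "?f b"] by fastforce
  then show ?case using step.IH step.hyps(4) by linarith
qed

end

text \<open>Folding gives the inequality \<open>d a u \<le> d a (\<phi> u)\<close> for
  \<open>a\<close> on the side of \<open>x\<close>; a second reflection \<open>\<psi>\<close>, in
  the edge from \<open>u\<close> to \<open>\<phi> u\<close>, excludes equality. The wall itself is
  fixed by \<open>\<phi>\<close>, and the other side follows by applying
  \<open>\<phi>\<close>.\<close>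

lemma reflective_square:
  assumes r: "reflective V E" and E: "E x y" and R: "is_reflection V E x y \<phi>" and xu: "E x u" and u: "d u y = d u x + 1"
    and z: "z \<in> V"
  shows "d z (\<phi> u) = d z u + (d z y - d z x)"
proof -
  note in1 = refl_in[OF E R]
  have V: "x \<in> V" "y \<in> V" "u \<in> V" "\<phi> u \<in> V" using E xu E_in in1 by auto
  have dux: "d u x = 1" "d x u = 1" using xu d_edge E_sym by auto
  have Eu: "E u (\<phi> u)" using refl_closer[OF E R, of u] V u by simp
  obtain \<psi> where P: "is_reflection V E u (\<phi> u) \<psi>" using r Eu V unfolding reflective_def by blast
  have s: "d x (\<phi> u) = 2" "d y (\<phi> u) = 1" "d y u = 2"
    using refl_side[OF E R, of u] u dux V d_sym by auto
  \<comment> \<open>The edge \<open>x y\<close> crosses the wall of the edge from \<open>u\<close>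
    to \<open>\<phi> u\<close>, so it is one of the matching edges of \<open>\<psi>\<close>.\<close>
  have "y = \<psi> x"
    using refl_match[OF Eu P, of x y] V E s dux d_sym by simp
  \<comment> \<open>If \<open>a\<close> were equidistant from \<open>u\<close> and
    \<open>\<phi> u\<close>, then \<open>\<psi>\<close> would fix \<open>a\<close> while taking
    \<open>x\<close> to \<open>y\<close>, putting \<open>a\<close> on the wall of
    \<open>x y\<close>.\<close>
  have main: "d a (\<phi> u) = d a u + 1" if a: "a \<in> V" "d a x < d a y" for a
  proof -
    have "d a (\<phi> u) \<noteq> d a u"
    proof
      assume "d a (\<phi> u) = d a u"
      then have "\<psi> a = a" using refl_fix[OF Eu P, of a] a by simp
      then have "d a y = d a x" using refl_d[OF Eu P, of a x] \<open>y = \<psi> x\<close> a V by simp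
      then show False using a by simp
    qed
    moreover have "d a u \<le> d a (\<phi> u)"
      using refl_fold[OF E R a(1) V(4) a(2)] refl_side[OF E R V(3)] refl_refl[OF E R V(3)] u by simp
    ultimately show ?thesis using d_lip[OF a(1) Eu] by linarith
  qed
  consider "d z x < d z y" | "d z x = d z y" | "d z y < d z x" by linarith
  then show ?thesis
  proof cases
    case 1
    then show ?thesis using main[OF z 1] d_lip[OF z E] by linarith
  next
    case 2
    then show ?thesis using refl_fix[OF E R z 2] refl_d[OF E R z V(3)] by simp
  next
    case 3
    then have "d (\<phi> z) x < d (\<phi> z) y" using refl_side[OF E R z] by simp
    then have "d (\<phi> z) (\<phi> u) = d (\<phi> z) u + 1" using main in1[OF z] by blast
    then have "d z u = d z (\<phi> u) + 1"
      using refl_d[OF E R z V(3)] refl_d[OF E R z V(4)] refl_refl[OF E R V(3)] by simp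
    then show ?thesis using 3 d_lip[OF z E] by linarith
  qed
qed

lemma reflective_imp_rgraph: assumes "reflective V E" shows "rgraph V E"
proof
  fix x y assume "E x y"
  then show "\<exists>\<phi>. mirror V E x y \<phi>"
  proof (rule square_imp_mirror[rotated])
    fix x y u assume *: "E x y" "E x u" "d u y = d u x + 1"
    then obtain \<phi> where R: "is_reflection V E x y \<phi>" using assms E_in unfolding reflective_def by blast
    then show "\<exists>u'\<in>V. \<forall>z\<in>V. d z u' = d z u + (d z y - d z x)"
      using reflective_square[OF assms *(1) R *(2,3)] refl_in[OF *(1) R] E_in[OF *(2)] by blast
  qed
qed

end

subsection \<open>Curvature and sharpness\<close>

text \<open>Halmos-Vaughan induction: if every nonempty proper subset has a spare neighbour, one
  element is matched arbitrarily; otherwise a tight subset and its complement are matched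
  separately.\<close>

lemma hall:
  assumes "finite A" "\<And>a. a \<in> A \<Longrightarrow> finite (N a)"
    and "\<And>S. S \<subseteq> A \<Longrightarrow> card S \<le> card (\<Union>a\<in>S. N a)"
  shows "\<exists>f. inj_on f A \<and> (\<forall>a\<in>A. f a \<in> N a)"
  using assms
proof (induction "card A" arbitrary: A N rule: less_induct)
  case less
  show ?case
  proof (cases "A = {}")
    case False
    then obtain a where a: "a \<in> A" by blast
    show ?thesis
    proof (cases "\<forall>S. S \<subset> A \<and> S \<noteq> {} \<longrightarrow> card S < card (\<Union>a\<in>S. N a)")
      case True
      have "card {a} \<le> card (\<Union>a\<in>{a}. N a)" using less.prems(3)[of "{a}"] a by blast
      then have "N a \<noteq> {}" by auto
      then obtain b where b: "b \<in> N a" by blast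
      have "\<exists>f. inj_on f (A - {a}) \<and> (\<forall>x\<in>A - {a}. f x \<in> N x - {b})"
      proof (rule less.hyps)
        show "card (A - {a}) < card A" using a less.prems(1) by (rule card_Diff1_less[rotated])
        show "card S \<le> card (\<Union>x\<in>S. N x - {b})" if S: "S \<subseteq> A - {a}" for S
        proof (cases "S = {}")
          case False
          have "S \<subset> A" using S a by blast
          then have "card S < card (\<Union>x\<in>S. N x)" using True False by blast
          moreover have "(\<Union>x\<in>S. N x - {b}) = (\<Union>x\<in>S. N x) - {b}" by blast
          moreover have "card (\<Union>x\<in>S. N x) - 1 \<le> card ((\<Union>x\<in>S. N x) - {b})" by (simp add: card_Diff_singleton_if)
          ultimately show ?thesis by simp
        qed simp
      qed (use less.prems in auto)
      then obtain f where f: "inj_on f (A - {a})" "\<forall>x\<in>A - {a}. f x \<in> N x - {b}" by blast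
      have "inj_on (f(a := b)) A" using f unfolding inj_on_def by auto
      then show ?thesis using f b by (intro exI[of _ "f(a := b)"]) auto
    next
      case False
      then obtain S where S: "S \<subset> A" "S \<noteq> {}" "card (\<Union>a\<in>S. N a) \<le> card S" by (auto simp: not_less)
      let ?M = "\<Union>a\<in>S. N a"
      have "finite S" using S less.prems(1) finite_subset by blast
      moreover have "finite ?M" using S less.prems(2) calculation by (intro finite_UN_I) auto
      ultimately have fin: "finite S" "finite ?M" by blast+
      have "\<exists>f. inj_on f S \<and> (\<forall>x\<in>S. f x \<in> N x)"
        using S(1) less.prems fin psubset_card_mono[OF less.prems(1) S(1)] by (intro less.hyps) auto
      then obtain f where f: "inj_on f S" "\<forall>x\<in>S. f x \<in> N x" by blast
      have "\<exists>g. inj_on g (A - S) \<and> (\<forall>x\<in>A - S. g x \<in> N x - ?M)"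
      proof (rule less.hyps)
        show "card (A - S) < card A" using S less.prems(1) by (intro psubset_card_mono) auto
        show "card T \<le> card (\<Union>x\<in>T. N x - ?M)" if T: "T \<subseteq> A - S" for T
        proof -
          have "finite T" using T less.prems(1) by (meson finite_Diff finite_subset)
          moreover from this have "finite (\<Union>x\<in>T. N x - ?M)" using T less.prems(2) by (intro finite_UN_I) auto
          ultimately have fT: "finite T" "finite (\<Union>x\<in>T. N x - ?M)" by blast+
          have "card T + card S = card (T \<union> S)" using T fT fin by (intro card_Un_disjoint[symmetric]) auto
          also have "\<dots> \<le> card (\<Union>a\<in>T \<union> S. N a)" using T S by (intro less.prems(3)) auto
          also have "(\<Union>a\<in>T \<union> S. N a) = (\<Union>x\<in>T. N x - ?M) \<union> ?M" by auto
          also have "card \<dots> = card (\<Union>x\<in>T. N x - ?M) + card ?M" using fT fin by (intro card_Un_disjoint) auto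
          finally show ?thesis using S(3) by linarith
        qed
      qed (use less.prems in auto)
      then obtain g where g: "inj_on g (A - S)" "\<forall>x\<in>A - S. g x \<in> N x - ?M" by blast
      let ?h = "\<lambda>x. if x \<in> S then f x else g x"
      have "inj_on ?h A"
      proof (rule inj_onI)
        fix x y assume *: "x \<in> A" "y \<in> A" "?h x = ?h y"
        show "x = y"
        proof (cases "x \<in> S"; cases "y \<in> S")
          assume "x \<in> S" "y \<notin> S" then show ?thesis using * f(2) g(2) by (metis DiffE DiffI UN_I)
        next
          assume "x \<notin> S" "y \<in> S" then show ?thesis using * f(2) g(2) by (metis DiffE DiffI UN_I)
        qed (use * f(1) g(1) in \<open>auto dest: inj_onD\<close>)
      qed
      then show ?thesis using f g by (intro exI[of _ ?h]) auto
    qed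
  qed simp
qed

section \<open>Laplacians, Lipschitz functions and the curvature as an infimum\<close>

context cgraph begin

abbreviation nb :: "'a \<Rightarrow> 'a set" where "nb x \<equiv> {u \<in> V. E x u}"
abbreviation tri :: "'a \<Rightarrow> 'a \<Rightarrow> nat" where "tri x y \<equiv> card {z \<in> V. E x z \<and> E y z}"
abbreviation lap :: "('a \<Rightarrow> real) \<Rightarrow> 'a \<Rightarrow> real" where "lap \<equiv> laplacian V E"
abbreviation dr :: "'a \<Rightarrow> 'a \<Rightarrow> real" where "dr x y \<equiv> real_of_int (d x y)"

definition lip1 :: "('a \<Rightarrow> real) \<Rightarrow> bool" where
  "lip1 f \<longleftrightarrow> (\<forall>u v. E u v \<longrightarrow> \<bar>f u - f v\<bar> \<le> 1)"

lemma lip1_dr: "x \<in> V \<Longrightarrow> lip1 (dr x)"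
  unfolding lip1_def using d_lip[of x] by (smt (verit) of_int_1 of_int_add of_int_le_iff)

text \<open>The edge \<open>x y\<close> already attains the value 1, so only the upper bound is left
  as a condition on \<open>f\<close>.\<close>

lemma Max_lip1:
  assumes E: "E x y" and f: "f y - f x = (1::real)"
  shows "Max {\<bar>f u - f v\<bar> | u v. u \<in> V \<and> v \<in> V \<and> E u v} = 1 \<longleftrightarrow> lip1 f" (is "Max ?S = 1 \<longleftrightarrow> _")
proof -
  have "?S \<subseteq> (\<lambda>(u, v). \<bar>f u - f v\<bar>) ` (V \<times> V)" by auto
  then have fin: "finite ?S" using finV by (meson finite_SigmaI finite_imageI finite_subset)
  have one: "1 \<in> ?S" using E E_in[OF E] E_sym[OF E] f by force
  have "Max ?S = 1 \<longleftrightarrow> (\<forall>s\<in>?S. s \<le> 1)"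
    using Max_eq_iff[OF fin, of 1] one by auto
  also have "\<dots> \<longleftrightarrow> lip1 f" unfolding lip1_def using E_in by blast
  finally show ?thesis .
qed

lemma ollivier_alt:
  assumes "E x y" shows "ollivier V E x y = Inf {lap f x - lap f y | f. f y - f x = 1 \<and> lip1 f}"
proof -
  have "{lap f x - lap f y | f. f y - f x = 1 \<and> Max {\<bar>f u - f v\<bar> | u v. u \<in> V \<and> v \<in> V \<and> E u v} = 1}
      = {lap f x - lap f y | f. f y - f x = 1 \<and> lip1 f}"
    using Max_lip1[OF assms] by blast
  then show ?thesis unfolding ollivier_def by simp
qed

lemma lap_bound: assumes "lip1 f" shows "\<bar>lap f x\<bar> \<le> real (card V)"
proof -
  have "\<bar>lap f x\<bar> \<le> (\<Sum>y\<in>nb x. \<bar>f y - f x\<bar>)" unfolding laplacian_def by (rule sum_abs)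
  also have "\<dots> \<le> (\<Sum>y\<in>nb x. 1)" using assms E_sym unfolding lip1_def by (intro sum_mono) blast
  also have "\<dots> \<le> real (card V)" using finV by (simp add: card_mono)
  finally show ?thesis .
qed

lemma ollivier_le:
  assumes "E x y" "f y - f x = 1" "lip1 f" shows "ollivier V E x y \<le> lap f x - lap f y"
  unfolding ollivier_alt[OF assms(1)]
proof (rule cInf_lower)
  show "bdd_below {lap f x - lap f y | f. f y - f x = 1 \<and> lip1 f}"
    unfolding bdd_below_def
  proof (intro exI[of _ "- 2 * real (card V)"] ballI)
    fix r assume "r \<in> {lap f x - lap f y | f. f y - f x = 1 \<and> lip1 f}"
    then obtain f where "r = lap f x - lap f y" "lip1 f" by blast
    then show "- 2 * real (card V) \<le> r" using lap_bound[of f x] lap_bound[of f y] by linarith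
  qed
qed (use assms in blast)

lemma ollivier_ge:
  assumes "E x y" "\<And>f. f y - f x = 1 \<Longrightarrow> lip1 f \<Longrightarrow> K \<le> lap f x - lap f y" shows "K \<le> ollivier V E x y"
  unfolding ollivier_alt[OF assms(1)]
proof (rule cInf_greatest)
  have "dr x y - dr x x = 1" "lip1 (dr x)" using assms(1) d_edge E_in lip1_dr by auto
  then have "lap (dr x) x - lap (dr x) y \<in> {lap f x - lap f y | f. f y - f x = 1 \<and> lip1 f}"
    by (intro CollectI exI[of _ "dr x"] conjI refl)
  then show "{lap f x - lap f y | f. f y - f x = 1 \<and> lip1 f} \<noteq> {}" by (metis empty_iff)
qed (use assms in blast)

text \<open>Each edge occurs twice, with opposite signs.\<close>

lemma sum_lap: "(\<Sum>x\<in>V. lap f x) = 0"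
proof -
  have "(\<Sum>x\<in>V. lap f x) = (\<Sum>x\<in>V. \<Sum>y\<in>V. if E x y then f y - f x else 0)" (is "_ = ?s")
    unfolding laplacian_def using finV by (intro sum.cong refl sum.inter_filter)
  moreover have "?s = (\<Sum>y\<in>V. \<Sum>x\<in>V. if E x y then f y - f x else 0)" by (rule sum.swap)
  moreover have "\<dots> = - ?s" unfolding sum_negf[symmetric] using E_commute by (intro sum.cong refl) auto
  ultimately show ?thesis by linarith
qed

lemma lap_dr_self: assumes "z \<in> V" shows "lap (dr z) z = real (deg V E z)"
proof -
  have "lap (dr z) z = (\<Sum>y\<in>nb z. 1)" unfolding laplacian_def using d_edge assms by (intro sum.cong) auto
  then show ?thesis by (simp add: deg_def)
qed

lemma lap_radial:
  assumes z: "z \<in> V" and y: "y \<in> V"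
    and step: "\<And>x y. E x y \<Longrightarrow> d z y = d z x + 1 \<Longrightarrow> lap (dr z) y \<le> lap (dr z) x - K"
  shows "lap (dr z) y \<le> real (deg V E z) - K * dr z y"
  using z y
proof (induction rule: d_induct)
  case base then show ?case using lap_dr_self z by simp
next
  case (step u y)
  then show ?case using assms(3)[of u y] by (simp add: algebra_simps)
qed

lemma lap_radial_eq:
  assumes z: "z \<in> V" and y: "y \<in> V"
    and step: "\<And>x y. E x y \<Longrightarrow> d z y = d z x + 1 \<Longrightarrow> lap (dr z) y = lap (dr z) x - K"
  shows "lap (dr z) y = real (deg V E z) - K * dr z y"
  using z y
proof (induction rule: d_induct)
  case base then show ?case using lap_dr_self z by simp
next
  case (step u y)
  then show ?case using assms(3)[of u y] by (simp add: algebra_simps)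
qed

lemma eff_diam_dr: "eff_diam V E = (\<Sum>x\<in>V. \<Sum>y\<in>V. dr x y) / (real (card V))^2"
  unfolding eff_diam_def gd_def by simp

end

section \<open>Curvature in a graph with mirrors\<close>

context rgraph begin

lemma mir_nb: assumes "E x y" shows "bij_betw (mir x y) (nb x) (nb y)"
proof (rule bij_betw_byWitness[of _ "mir x y"])
  note m = mir_in[OF assms] mir_E[OF assms] mir_mir[OF assms] mir_swap[OF assms] E_in[OF assms]
  show "mir x y ` nb x \<subseteq> nb y" using m(1) m(2)[of x] m(4,6) by auto
  show "mir x y ` nb y \<subseteq> nb x" using m(1) m(2)[of y] m(5,6) by auto
qed (auto simp: mir_mir[OF assms])

lemma deg_eq: "x \<in> V \<Longrightarrow> y \<in> V \<Longrightarrow> deg V E x = deg V E y"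
proof (induction rule: d_induct)
  case (step u y)
  then show ?case using bij_betw_same_card[OF mir_nb[of u y]] by (simp add: deg_def)
qed simp

text \<open>The mirror couples the neighbours of \<open>x\<close> with those of \<open>y\<close>,
  sending \<open>y\<close> to \<open>x\<close>; this turns two Laplacians into one sum of
  displacements along the coupling.\<close>

lemma lap_diff:
  assumes "E x y" shows "lap f x - lap f y = (\<Sum>u\<in>nb x. f u - f (mir x y u) + (f y - f x))"
proof -
  have "lap f y = (\<Sum>u\<in>nb x. f (mir x y u) - f y)"
    unfolding laplacian_def by (rule sum.reindex_bij_betw[OF mir_nb[OF assms], symmetric])
  then show ?thesis unfolding laplacian_def by (simp add: sum_subtractf[symmetric] algebra_simps)
qed

text \<open>These are the least possible summands of \<open>lap_diff\<close>: 2 for the exchanged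
  pair, 1 for a common neighbour, which is fixed, and 0 for any other neighbour, which moves along
  an edge.\<close>

lemma tri_sum:
  assumes "E x y" shows "(\<Sum>u\<in>nb x. if u = y then 2 else if E y u then 1 else 0) = 2 + real (tri x y)"
proof -
  have "(\<Sum>u\<in>nb x. if u = y then 2 else if E y u then 1 else (0::real))
      = (\<Sum>u\<in>nb x. (if u = y then 2 else 0) + (if E y u then 1 else 0))"
    using E_irrefl by (intro sum.cong) auto
  also have "\<dots> = 2 + (\<Sum>u\<in>nb x. if E y u then 1 else 0)"
    using finV assms E_in[OF assms] by (simp add: sum.distrib)
  also have "(\<Sum>u\<in>nb x. if E y u then 1 else (0::real)) = (\<Sum>u\<in>{u\<in>nb x. E y u}. 1)"
    using finV by (intro sum.inter_filter[symmetric]) auto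
  also have "{u\<in>nb x. E y u} = {z \<in> V. E x z \<and> E y z}" by auto
  finally show ?thesis by simp
qed

lemma lap_diff_dr:
  assumes E: "E x y" and z: "z \<in> V" and "d z y = d z x + 1"
  shows "lap (dr z) x - lap (dr z) y = 2 + real (tri x y)"
  unfolding lap_diff[OF E] tri_sum[OF E, symmetric]
proof (intro sum.cong refl)
  fix u assume u: "u \<in> nb x"
  have xy: "x \<in> V" "y \<in> V" "d x y = 1" "d y x = 1" "u \<in> V" "d u x = 1" using E u E_in d_edge E_sym by auto
  have "d u y = (if u = y then 0 else if E y u then 1 else 2)"
    using d_lip[OF xy(5) E] xy d_eq1[of u y] E_commute[of u y] d_eq0[of u y] d_nonneg[of u y] by (smt (verit))
  then show "dr z u - dr z (mir x y u) + (dr z y - dr z x) = (if u = y then 2 else if E y u then 1 else 0)"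
    using assms(3) xy z by (simp add: mir_d[OF E])
qed

text \<open>The distance from \<open>x\<close> attains all the summands of \<open>tri_sum\<close>
  simultaneously, and no admissible \<open>f\<close> goes below any of them because the mirror moves
  a vertex at most along one edge.\<close>

lemma ollivier_eq: assumes E: "E x y" shows "ollivier V E x y = 2 + real (tri x y)"
proof (rule antisym)
  have xy: "x \<in> V" "y \<in> V" "d x y = 1" using E E_in d_edge by auto
  show "ollivier V E x y \<le> 2 + real (tri x y)"
    using ollivier_le[OF E, of "dr x"] lap_diff_dr[OF E xy(1)] lip1_dr xy by simp
  show "2 + real (tri x y) \<le> ollivier V E x y"
  proof (rule ollivier_ge[OF E])
    fix f :: "'a \<Rightarrow> real" assume f: "f y - f x = 1" "lip1 f"
    show "2 + real (tri x y) \<le> lap f x - lap f y"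
      unfolding lap_diff[OF E] tri_sum[OF E, symmetric]
    proof (intro sum_mono)
      fix u assume u: "u \<in> nb x"
      have uV: "u \<in> V" "d u x = 1" using u d_edge E_sym by auto
      show "(if u = y then 2 else if E y u then 1 else 0) \<le> f u - f (mir x y u) + (f y - f x)"
      proof (cases "d u y = d u x")
        case True
        then have "E y u" "u \<noteq> y" using uV d_eq1[of u y] xy E_commute by auto
        then show ?thesis using mir_fix[OF E uV(1) True] f by simp
      next
        case False
        then have "E u (mir x y u)" using mir_adj[OF E uV(1)] by blast
        then have "\<bar>f u - f (mir x y u)\<bar> \<le> 1" using f unfolding lip1_def by blast
        moreover have "\<not> E y u" using False uV d_edge[of u y] E_sym by auto
        ultimately show ?thesis using f mir_swap[OF E] by auto
      qed
    qed
  qed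
qed

lemma constant_curvature_iff: "constant_curvature V E c \<longleftrightarrow> (\<forall>x y. E x y \<longrightarrow> 2 + real (tri x y) = c)"
  unfolding constant_curvature_def using E_in by (auto simp: ollivier_eq)

lemma lap_dr:
  assumes c: "constant_curvature V E c" and "z \<in> V" "y \<in> V"
  shows "lap (dr z) y = real (deg V E z) - c * dr z y"
proof (rule lap_radial_eq[OF assms(2,3)])
  fix x y assume "E x y" "d z y = d z x + 1"
  then show "lap (dr z) y = lap (dr z) x - c"
    using lap_diff_dr[OF _ assms(2), of x y] c unfolding constant_curvature_iff by force
qed

end

context cgraph begin

lemma ex_edge: assumes "card V \<ge> 2" shows "\<exists>x y. E x y"
proof -
  obtain x y where "x \<in> V" "y \<in> V" "x \<noteq> y"
    using assms by (metis card_2_iff' card_le_Suc0_iff_eq finV not_less_eq_eq numeral_2_eq_2)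
  then show ?thesis using d_step by metis
qed

lemma min_curv_le: "E x y \<Longrightarrow> min_curv V E \<le> ollivier V E x y"
proof -
  have "{ollivier V E x y |x y. x \<in> V \<and> y \<in> V \<and> E x y} \<subseteq> (\<lambda>(x, y). ollivier V E x y) ` (V \<times> V)" by auto
  then have "finite {ollivier V E x y |x y. x \<in> V \<and> y \<in> V \<and> E x y}"
    using finV by (meson finite_SigmaI finite_imageI finite_subset)
  then show "E x y \<Longrightarrow> min_curv V E \<le> ollivier V E x y"
    unfolding min_curv_def using E_in by (intro Min_le) blast+
qed

lemma min_curv_const:
  assumes "constant_curvature V E c" "E x y" shows "min_curv V E = c"
proof -
  have "{ollivier V E x y |x y. x \<in> V \<and> y \<in> V \<and> E x y} = {c}"
    using assms E_in unfolding constant_curvature_def by fastforce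
  then show ?thesis unfolding min_curv_def by simp
qed

text \<open>Summing \<open>lap_dr\<close> over \<open>y\<close> annihilates the Laplacian, so every
  \<open>z\<close> has the same total distance \<open>card V * deg / c\<close>.\<close>

lemma sharp_if_reflective:
  assumes r: "reflective V E" and c: "constant_curvature V E c" and V2: "card V \<ge> 2"
  shows "bonnet_myers_sharp V E"
proof -
  interpret rgraph V E using reflective_imp_rgraph[OF r] .
  obtain x y where E: "E x y" using ex_edge V2 by blast
  have cpos: "c > 0" using c E unfolding constant_curvature_iff by (metis add_pos_nonneg of_nat_0_le_iff zero_less_numeral)
  have x: "x \<in> V" using E E_in by blast
  let ?D = "real (deg V E x)"
  have "deg V E ` V = {deg V E x}" using deg_eq x by blast
  then have mD: "real (max_deg V E) = ?D" unfolding max_deg_def by simp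
  have "c * (\<Sum>y\<in>V. dr z y) = real (card V) * ?D" if z: "z \<in> V" for z
  proof -
    have "0 = (\<Sum>y\<in>V. ?D - c * dr z y)"
      using sum_lap[of "dr z"] lap_dr[OF c z] deg_eq[OF z x] by simp
    then show ?thesis by (simp add: sum_subtractf sum_distrib_left)
  qed
  then have "(\<Sum>z\<in>V. \<Sum>y\<in>V. dr z y) = (\<Sum>z\<in>V. real (card V) * ?D / c)"
    using cpos by (intro sum.cong refl) (simp add: field_simps)
  then have "(\<Sum>z\<in>V. \<Sum>y\<in>V. dr z y) = real (card V) ^ 2 * (?D / c)" by (simp add: power2_eq_square)
  then have "eff_diam V E = ?D / c" unfolding eff_diam_dr using V2 by simp
  then show ?thesis unfolding bonnet_myers_sharp_def using min_curv_const[OF c E] cpos mD by simp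
qed

section \<open>Rigidity in the equality case: from Laplacians of distances to squares\<close>

context
  fixes D K :: real
  assumes eq: "\<And>z y. z \<in> V \<Longrightarrow> y \<in> V \<Longrightarrow> lap (dr z) y = D - K * dr z y"
    and curv: "\<And>x y. E x y \<Longrightarrow> K \<le> ollivier V E x y"
begin

lemma sharp_card: "z \<in> V \<Longrightarrow> real (card (nb z)) = D"
  using lap_dr_self[of z] eq[of z z] by (simp add: deg_def)

text \<open>What remains of the neighbours of \<open>x\<close> after removing \<open>y\<close> and
  the triangles on \<open>x y\<close>; these are the vertices that a mirror has to move, apart from
  \<open>y\<close>.\<close>

definition side :: "'a \<Rightarrow> 'a \<Rightarrow> 'a set" where "side x y = {u \<in> nb x. d u y = 2}"

lemma side_nb:
  assumes E: "E x y"
  shows "(\<Sum>u\<in>nb x. g u) = (g y :: real) + (\<Sum>u\<in>{z \<in> V. E x z \<and> E y z}. g u) + (\<Sum>u\<in>side x y. g u)"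
proof -
  have xy: "x \<in> V" "y \<in> V" using E E_in by auto
  have "u = y \<or> E y u \<or> d u y = 2" if "u \<in> nb x" for u
  proof -
    have u: "u \<in> V" "d u x = 1" using that d_edge E_sym by auto
    then show ?thesis using d_lip[OF u(1) E] d_eq1[of u y] d_eq0[of u y] E_commute xy d_nonneg[of u y] by smt
  qed
  then have "nb x = {y} \<union> {z \<in> V. E x z \<and> E y z} \<union> side x y" using E xy unfolding side_def by auto
  moreover have "d u y = 1" if "E y u" for u using that d_edge E_sym by blast
  then have "{z \<in> V. E x z \<and> E y z} \<inter> side x y = {}" "y \<notin> {z \<in> V. E x z \<and> E y z} \<union> side x y"
    using E_irrefl xy unfolding side_def by fastforce+
  moreover have "finite {z \<in> V. E x z \<and> E y z}" "finite (side x y)" using finV by (simp_all add: side_def)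
  ultimately show ?thesis by (simp only: Un_assoc) (simp add: sum.union_disjoint)
qed

lemma side_card: assumes "E x y" shows "card (side y x) = card (side x y)"
proof -
  have xy: "x \<in> V" "y \<in> V" using assms E_in by auto
  have "{z \<in> V. E y z \<and> E x z} = {z \<in> V. E x z \<and> E y z}" by blast
  then show ?thesis
    using side_nb[OF assms, of "\<lambda>_. 1"] side_nb[OF E_sym[OF assms], of "\<lambda>_. 1"] sharp_card[OF xy(1)] sharp_card[OF xy(2)]
    by simp
qed

text \<open>Each common neighbour contributes exactly \<open>f y - f x\<close>, so its own value
  cancels; only the two sides remain to be compared.\<close>

lemma side_lap:
  assumes E: "E x y"
  shows "lap f x - lap f y = (2 + real (tri x y) + real (card (side x y))) * (f y - f x)
     + (\<Sum>u\<in>side x y. f u) - (\<Sum>w\<in>side y x. f w)"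
proof -
  have c: "{z \<in> V. E y z \<and> E x z} = {z \<in> V. E x z \<and> E y z}" by blast
  show ?thesis
    unfolding laplacian_def side_nb[OF E] side_nb[OF E_sym[OF E]] c
    by (simp add: sum_subtractf side_card[OF E] algebra_simps)
qed

lemma side_dr: assumes "u \<in> side x y" "E x y" shows "u \<in> V" "dr x u = 1" "dr u x = 1" "dr y u = 2" "dr u y = 2"
  using assms d_edge E_in E_sym d_sym[of y u] unfolding side_def by auto

text \<open>For the distance from \<open>x\<close> the two sides have constant values 1 and 2, so
  they cancel the term \<open>card (side x y)\<close>.\<close>

lemma K_eq: assumes E: "E x y" shows "K = 2 + real (tri x y)"
proof -
  have xy: "x \<in> V" "y \<in> V" "dr x y = 1" using E E_in d_edge by auto
  have "(\<Sum>u\<in>side x y. dr x u) = real (card (side x y))" "(\<Sum>w\<in>side y x. dr x w) = 2 * real (card (side x y))"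
    using side_dr E E_sym side_card[OF E] by (simp_all cong: sum.cong)
  then show ?thesis using side_lap[OF E, of "dr x"] eq[of x x] eq[of x y] xy by simp
qed

text \<open>An averaged form of the mirror formula: passing from one side to the other changes the
  distance from \<open>z\<close> by its displacement in the mean. \<open>side_matching\<close> turns
  the mean into a pointwise statement.\<close>

lemma side_sum:
  assumes E: "E x y" and z: "z \<in> V"
  shows "(\<Sum>w\<in>side y x. dr z w) - (\<Sum>u\<in>side x y. dr z u) = real (card (side x y)) * (dr z y - dr z x)"
proof -
  have xy: "x \<in> V" "y \<in> V" using E E_in by auto
  show ?thesis using side_lap[OF E, of "dr z"] eq[OF z xy(1)] eq[OF z xy(2)] K_eq[OF E] by (simp add: algebra_simps)
qed

text \<open>The curvature bound is Hall's condition. Along a matched edge the distance from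
  \<open>z\<close> gains at most 1 in the direction of its displacement; when this displacement is 1
  or -1, the mean gain is already 1 by \<open>side_sum\<close>, so every pair gains 1.\<close>

lemma side_matching:
  assumes E: "E x y"
  obtains \<sigma> where "bij_betw \<sigma> (side x y) (side y x)" "\<And>u. u \<in> side x y \<Longrightarrow> E u (\<sigma> u)"
    "\<And>u z. u \<in> side x y \<Longrightarrow> z \<in> V \<Longrightarrow> d z y \<noteq> d z x \<Longrightarrow> d z (\<sigma> u) = d z u + (d z y - d z x)"
proof -
  let ?A = "side x y" and ?B = "side y x"
  have xy: "x \<in> V" "y \<in> V" using E E_in by auto
  have fin: "finite ?A" "finite ?B" using finV unfolding side_def by auto
  let ?N = "\<lambda>u. {w \<in> ?B. E u w}"
  have "\<exists>\<sigma>. inj_on \<sigma> ?A \<and> (\<forall>u\<in>?A. \<sigma> u \<in> ?N u)"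
  proof (rule hall)
    fix S assume S: "S \<subseteq> ?A"
    let ?NS = "\<Union>u\<in>S. ?N u"
    text \<open>A violation of Hall's condition gives a 1-Lipschitz function whose Laplacian drops by less than \<open>K\<close> along the edge.\<close>
    define P where "P v \<longleftrightarrow> v \<in> insert x S" for v
    define Q where "Q v \<longleftrightarrow> v \<in> ?B - ?NS" for v
    define f :: "'a \<Rightarrow> real" where "f v = (if P v then 0 else if Q v then 2 else 1)" for v
    have S0: "u \<noteq> y" "u \<notin> ?B" "u \<noteq> x" if "u \<in> ?A" for u
      using side_dr[OF that E] side_dr(2)[OF _ E_sym[OF E], of u] xy by auto
    have B0: "w \<noteq> y" "w \<notin> ?A" "w \<noteq> x" if "w \<in> ?B" for w
      using side_dr[OF that E_sym[OF E]] S0 xy that by auto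
    \<comment> \<open>The values 0 and 2 never meet: the vertices of value 2 are at distance two
      from \<open>x\<close> and have no neighbour in \<open>S\<close>.\<close>
    have no: "\<not> E v w" if "P v" "Q w" for v w
      using that side_dr(4)[OF _ E_sym[OF E], of w] d_edge[of x w] unfolding P_def Q_def by auto
    have "lip1 f" unfolding lip1_def
    proof (intro allI impI)
      fix v w assume "E v w"
      then have "\<not> (P v \<and> Q w)" "\<not> (P w \<and> Q v)" using no E_sym by blast+
      then show "\<bar>f v - f w\<bar> \<le> 1" by (auto simp: f_def)
    qed
    moreover have "f x = 0" by (simp add: f_def P_def)
    moreover have "y \<notin> ?A" "y \<notin> ?B" "y \<noteq> x" using S0(1) B0(1) E E_irrefl by blast+
    then have "\<not> P y" "\<not> Q y" using S unfolding P_def Q_def by blast+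
    then have "f y = 1" by (simp add: f_def)
    ultimately have "K \<le> lap f x - lap f y" using ollivier_le[OF E, of f] curv[OF E] by simp
    \<comment> \<open>Since the sides have equal size, counting values turns this into
      \<open>card S \<le> card ?NS\<close>.\<close>
    then have *: "(\<Sum>w\<in>?B. f w) - (\<Sum>u\<in>?A. f u) \<le> card ?A"
      using side_lap[OF E, of f] K_eq[OF E] \<open>f x = 0\<close> \<open>f y = 1\<close> by simp
    have "(\<Sum>u\<in>?A. f u) = (\<Sum>u\<in>?A. if u \<in> S then 0 else 1)"
      using S0 unfolding f_def P_def Q_def by (intro sum.cong) auto
    also have "\<dots> = real (card (?A - S))" using fin by (simp add: sum.If_cases Diff_eq)
    finally have a: "(\<Sum>u\<in>?A. f u) = real (card (?A - S))" .
    have "(\<Sum>w\<in>?B. f w) = (\<Sum>w\<in>?B. 1 + (if w \<in> ?NS then 0 else 1))"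
      using S B0 unfolding f_def P_def Q_def by (intro sum.cong) auto
    also have "(\<Sum>w\<in>?B. 1 + (if w \<in> M then 0 else 1)) = card ?B + real (card (?B - M))" for M
      using fin by (simp add: sum.distrib sum.If_cases Diff_eq)
    finally have b: "(\<Sum>w\<in>?B. f w) = card ?B + real (card (?B - ?NS))" .
    have "card (?A - S) = card ?A - card S" "card S \<le> card ?A"
      using S fin by (auto intro: card_Diff_subset card_mono finite_subset)
    moreover have "card (?B - ?NS) = card ?B - card ?NS" "card ?NS \<le> card ?B"
      using fin by (intro card_Diff_subset card_mono; auto intro: finite_subset)+
    ultimately show "card S \<le> card ?NS" using * a b side_card[OF E] by (simp add: of_nat_diff)
  qed (use fin in auto)
  then obtain \<sigma> where \<sigma>: "inj_on \<sigma> ?A" "\<And>u. u \<in> ?A \<Longrightarrow> \<sigma> u \<in> ?B \<and> E u (\<sigma> u)" by blast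
  have "\<sigma> ` ?A = ?B" using \<sigma> fin side_card[OF E] card_image[OF \<sigma>(1)] by (intro card_subset_eq) auto
  then have bij: "bij_betw \<sigma> ?A ?B" using \<sigma>(1) by (simp add: bij_betw_def)
  have "d z (\<sigma> u) = d z u + (d z y - d z x)" if u: "u \<in> ?A" and z: "z \<in> V" and ne: "d z y \<noteq> d z x" for u z
  proof -
    let ?e = "dr z y - dr z x"
    \<comment> \<open>The slack of a matched pair: nonnegative, with total zero by
      \<open>side_sum\<close>.\<close>
    let ?g = "\<lambda>u. 1 - ?e * (dr z (\<sigma> u) - dr z u)"
    have e: "?e = 1 \<or> ?e = -1" using ne d_lip[OF z E] by linarith
    have nn: "?g u \<ge> 0" if "u \<in> ?A" for u
      using e d_lip[OF z, of u "\<sigma> u"] \<sigma>(2)[OF that] by auto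
    have "(\<Sum>u\<in>?A. dr z (\<sigma> u)) = (\<Sum>w\<in>?B. dr z w)" by (rule sum.reindex_bij_betw[OF bij])
    then have "(\<Sum>u\<in>?A. dr z (\<sigma> u) - dr z u) = card ?A * ?e" using side_sum[OF E z] by (simp add: sum_subtractf)
    then have "(\<Sum>u\<in>?A. ?e * (dr z (\<sigma> u) - dr z u)) = ?e * (card ?A * ?e)" by (simp only: sum_distrib_left[symmetric])
    then have "(\<Sum>u\<in>?A. ?g u) = card ?A - card ?A * (?e * ?e)" by (simp add: sum_subtractf)
    also have "?e * ?e = 1" using e by auto
    finally have "?g u = 0" using sum_nonneg_eq_0_iff[OF fin(1), of ?g] nn u by simp
    then have "dr z (\<sigma> u) - dr z u = ?e" using e by auto
    then show ?thesis by linarith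
  qed
  then show ?thesis using that bij \<sigma>(2) by blast
qed

text \<open>\<open>side_matching\<close> is silent about \<open>z\<close> equidistant from
  \<open>x\<close> and \<open>y\<close>. The matching \<open>\<tau>\<close> at the opposite edge
  from \<open>u\<close> to \<open>\<sigma> u\<close> takes \<open>x\<close> to \<open>y\<close>, so
  if the distances from \<open>z\<close> to \<open>u\<close> and \<open>\<sigma> u\<close> differed,
  those to \<open>x\<close> and \<open>y\<close> would differ too.\<close>

lemma sharp_square:
  assumes E: "E x y" and xu: "E x u" and u: "d u y = d u x + 1"
  shows "\<exists>u'\<in>V. \<forall>z\<in>V. d z u' = d z u + (d z y - d z x)"
proof -
  obtain \<sigma> where \<sigma>: "bij_betw \<sigma> (side x y) (side y x)" "\<And>u. u \<in> side x y \<Longrightarrow> E u (\<sigma> u)"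
    "\<And>u z. u \<in> side x y \<Longrightarrow> z \<in> V \<Longrightarrow> d z y \<noteq> d z x \<Longrightarrow> d z (\<sigma> u) = d z u + (d z y - d z x)"
    using side_matching[OF E] by metis
  have xy: "x \<in> V" "y \<in> V" "d x y = 1" "u \<in> V" "d u x = 1" "d x u = 1" using E xu E_in d_edge E_sym by auto
  have uA: "u \<in> side x y" using xy xu u unfolding side_def by auto
  let ?u = "\<sigma> u"
  have Eu: "E u ?u" and u': "?u \<in> V" "E y ?u" using \<sigma>(2)[OF uA] uA \<sigma>(1) E_in unfolding side_def bij_betw_def by auto
  have xu': "d x ?u = 2" using \<sigma>(3)[OF uA, of x] xy by simp
  obtain \<tau> where \<tau>: "bij_betw \<tau> (side u ?u) (side ?u u)" 
    "\<And>v z. v \<in> side u ?u \<Longrightarrow> z \<in> V \<Longrightarrow> d z ?u \<noteq> d z u \<Longrightarrow> d z (\<tau> v) = d z v + (d z ?u - d z u)"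
    using side_matching[OF Eu] by metis
  have xA: "x \<in> side u ?u" using xu' xy E_sym[OF xu] by (simp add: side_def)
  have "d y u = 2" using xy u d_sym[OF xy(2,4)] by linarith
  then have "y \<in> side ?u u" using xy(2) E_sym[OF u'(2)] by (simp add: side_def)
  then have "y \<in> \<tau> ` side u ?u" by (simp only: bij_betw_imp_surj_on[OF \<tau>(1)])
  then obtain v where v: "v \<in> side u ?u" "\<tau> v = y" by (elim imageE) simp
  \<comment> \<open>The bracket is \<open>2 - 1\<close>, which leaves \<open>d x v = 0\<close>: the
    vertex matched with \<open>y\<close> is \<open>x\<close>.\<close>
  have "d x y = d x v + (d x ?u - d x u)" using \<tau>(2)[OF v(1), of x] v xu' xy by simp
  then have "v = x" using xu' xy d_eq0[of x v] v(1) unfolding side_def by simp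
  have "d z ?u = d z u + (d z y - d z x)" if z: "z \<in> V" for z
  proof (cases "d z y = d z x")
    case True
    then have "d z ?u = d z u" using \<tau>(2)[OF xA z] v(2) \<open>v = x\<close> by fastforce
    then show ?thesis using True by simp
  qed (use \<sigma>(3)[OF uA z] in simp)
  then show ?thesis using u' by blast
qed

lemma sharp_rgraph: "rgraph V E"
proof
  fix x y assume "E x y"
  then show "\<exists>\<phi>. mirror V E x y \<phi>"
  proof (rule square_imp_mirror[rotated])
    fix x y u assume "E x y" "E x u" "d u y = d u x + 1"
    then show "\<exists>u'\<in>V. \<forall>z\<in>V. d z u' = d z u + (d z y - d z x)" by (rule sharp_square)
  qed
qed

end

lemma sharp_imp:
  assumes s: "bonnet_myers_sharp V E" and V2: "card V \<ge> 2"
  shows "rgraph V E" "constant_curvature V E (min_curv V E)"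
proof -
  let ?K = "min_curv V E" and ?D = "real (max_deg V E)"
  have K: "?K > 0" and ed: "eff_diam V E = ?D / ?K" using s unfolding bonnet_myers_sharp_def by auto
  have degD: "real (deg V E z) \<le> ?D" if "z \<in> V" for z
    unfolding max_deg_def using that finV by simp
  \<comment> \<open>The slack of the radial estimate with the degree of \<open>z\<close> replaced by
    the maximal degree; it is nonnegative everywhere, and sharpness says that its total is
    zero.\<close>
  define g where "g z y = ?D - ?K * dr z y - lap (dr z) y" for z y
  have gnn: "g z y \<ge> 0" if z: "z \<in> V" and y: "y \<in> V" for z y
  proof -
    have "lap (dr z) y \<le> real (deg V E z) - ?K * dr z y"
    proof (rule lap_radial[OF z y])
      fix x y assume *: "E x y" "d z y = d z x + 1"
      then have "?K \<le> lap (dr z) x - lap (dr z) y"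
        using order.trans[OF min_curv_le ollivier_le, of x y "dr z"] lip1_dr[OF z] by simp
      then show "lap (dr z) y \<le> lap (dr z) x - ?K" by simp
    qed
    then show ?thesis using degD[OF z] unfolding g_def by linarith
  qed
  have "(\<Sum>z\<in>V. \<Sum>y\<in>V. g z y) = (\<Sum>z\<in>V. real (card V) * ?D - ?K * (\<Sum>y\<in>V. dr z y))"
    unfolding g_def by (simp add: sum_subtractf sum_lap sum_distrib_left)
  also have "\<dots> = real (card V) ^ 2 * ?D - ?K * (\<Sum>z\<in>V. \<Sum>y\<in>V. dr z y)"
    by (simp add: sum_subtractf sum_distrib_left power2_eq_square)
  also have "(\<Sum>z\<in>V. \<Sum>y\<in>V. dr z y) = real (card V) ^ 2 * (?D / ?K)"
    using ed V2 unfolding eff_diam_dr by (simp add: field_simps)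
  finally have "(\<Sum>z\<in>V. \<Sum>y\<in>V. g z y) = 0" using K by simp
  then have "g z y = 0" if "z \<in> V" "y \<in> V" for z y
    using that gnn finV by (simp add: sum_nonneg_eq_0_iff sum_nonneg)
  then have eq: "lap (dr z) y = ?D - ?K * dr z y" if "z \<in> V" "y \<in> V" for z y
    using that unfolding g_def by simp
  show r: "rgraph V E" using sharp_rgraph[of ?D ?K] eq min_curv_le by blast
  interpret rgraph V E by (rule r)
  show "constant_curvature V E ?K" unfolding constant_curvature_iff
    using K_eq[of ?D ?K, OF eq min_curv_le] by simp
qed

lemma sharp_iff:
  assumes "card V \<ge> 2"
  shows "bonnet_myers_sharp V E \<longleftrightarrow> reflective V E \<and> (\<exists>c. constant_curvature V E c)"
  using assms sharp_imp rgraph.reflective sharp_if_reflective by blast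

end

section \<open>Recognising graphs with mirrors, and transport along isomorphisms\<close>

lemma rgraphI:
  fixes \<delta> :: "'a \<Rightarrow> 'a \<Rightarrow> nat"
  assumes sg: "simple_graph V E"
    and refl: "\<And>x. x \<in> V \<Longrightarrow> \<delta> x x = 0"
    and lip: "\<And>x y z. x \<in> V \<Longrightarrow> E y z \<Longrightarrow> \<delta> x z \<le> \<delta> x y + 1"
    and step: "\<And>x y. x \<in> V \<Longrightarrow> y \<in> V \<Longrightarrow> x \<noteq> y \<Longrightarrow> \<exists>u\<in>V. E u y \<and> \<delta> x y = \<delta> x u + 1"
    and mir: "\<And>x y. E x y \<Longrightarrow> \<exists>\<phi>. \<forall>w\<in>V. \<phi> w \<in> V \<and> (\<forall>z\<in>V.
      int (\<delta> z (\<phi> w)) = int (\<delta> z w) + (int (\<delta> w y) - int (\<delta> w x)) * (int (\<delta> z y) - int (\<delta> z x)))"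
  shows "rgraph V E" and "\<And>x y. x \<in> V \<Longrightarrow> y \<in> V \<Longrightarrow> gdist V E x y = \<delta> x y"
proof -
  note conn = gdist_eqI(1)[of V E \<delta>, OF sg refl lip step]
  note dist = gdist_eqI(2)[of V E \<delta>, OF sg refl lip step]
  show "gdist V E x y = \<delta> x y" if "x \<in> V" "y \<in> V" for x y using dist that by blast
  show "rgraph V E"
  proof
    show "simple_graph V E" by (rule sg)
    show "connected_graph V E" by (rule conn)
    fix x y assume E: "E x y"
    then have xy: "x \<in> V" "y \<in> V" using sg by (auto simp: simple_graph_def)
    obtain \<phi> where "\<forall>w\<in>V. \<phi> w \<in> V \<and> (\<forall>z\<in>V.
      int (\<delta> z (\<phi> w)) = int (\<delta> z w) + (int (\<delta> w y) - int (\<delta> w x)) * (int (\<delta> z y) - int (\<delta> z x)))"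
      using mir[OF E] by blast
    then have "mirror V E x y \<phi>" unfolding mirror_def gd_def using xy by (simp add: dist)
    then show "\<exists>\<phi>. mirror V E x y \<phi>" by blast
  qed
qed

lemma (in cgraph) gdist_facts:
  "x \<in> V \<Longrightarrow> E y z \<Longrightarrow> gdist V E x z \<le> gdist V E x y + 1"
  "x \<in> V \<Longrightarrow> gdist V E x x = 0"
  "x \<in> V \<Longrightarrow> y \<in> V \<Longrightarrow> x \<noteq> y \<Longrightarrow> \<exists>u\<in>V. E u y \<and> gdist V E x y = gdist V E x u + 1"
proof -
  show "x \<in> V \<Longrightarrow> E y z \<Longrightarrow> gdist V E x z \<le> gdist V E x y + 1" using d_lip[of x y z] by (simp add: gd_def)
  show "x \<in> V \<Longrightarrow> gdist V E x x = 0" using d_self[of x] by (simp add: gd_def)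
  assume "x \<in> V" "y \<in> V" "x \<noteq> y"
  then obtain u where "u \<in> V" "E u y" "d x u = d x y - 1" by (rule d_step2)
  then show "\<exists>u\<in>V. E u y \<and> gdist V E x y = gdist V E x u + 1" by (intro bexI[of _ u]) (auto simp: gd_def)
qed

lemma graph_iso_sym:
  assumes "graph_iso V E W F" shows "graph_iso W F V E"
proof -
  obtain h where h: "bij_betw h V W" "\<forall>u\<in>V. \<forall>v\<in>V. E u v \<longleftrightarrow> F (h u) (h v)"
    using assms unfolding graph_iso_def by blast
  have "\<forall>u\<in>W. \<forall>v\<in>W. F u v \<longleftrightarrow> E (inv_into V h u) (inv_into V h v)"
    using h bij_betw_inv_into_right[OF h(1)] bij_betwE[OF bij_betw_inv_into[OF h(1)]] by auto
  then show ?thesis unfolding graph_iso_def using bij_betw_inv_into[OF h(1)] by blast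
qed

lemma graph_iso_trans:
  assumes "graph_iso V E W F" "graph_iso W F X H" shows "graph_iso V E X H"
proof -
  obtain h where h: "bij_betw h V W" "\<forall>u\<in>V. \<forall>v\<in>V. E u v \<longleftrightarrow> F (h u) (h v)"
    using assms unfolding graph_iso_def by blast
  obtain k where k: "bij_betw k W X" "\<forall>u\<in>W. \<forall>v\<in>W. F u v \<longleftrightarrow> H (k u) (k v)"
    using assms unfolding graph_iso_def by blast
  show ?thesis unfolding graph_iso_def
    using bij_betw_trans[OF h(1) k(1)] h k bij_betwE[OF h(1)] by (intro exI[of _ "k \<circ> h"]) auto
qed

lemma graph_iso_refl: "graph_iso V E V E"
  unfolding graph_iso_def by (intro exI[of _ id]) auto

lemma graph_iso_card: "graph_iso V E W F \<Longrightarrow> card V = card W"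
  unfolding graph_iso_def by (auto dest: bij_betw_same_card)

lemma iso_gdist:
  assumes sg: "simple_graph V E" and W: "cgraph W F" and h: "bij_betw h V W"
    and adj: "\<And>u v. u \<in> V \<Longrightarrow> v \<in> V \<Longrightarrow> E u v \<longleftrightarrow> F (h u) (h v)"
  shows "cgraph V E" and "\<And>x y. x \<in> V \<Longrightarrow> y \<in> V \<Longrightarrow> gdist V E x y = gdist W F (h x) (h y)"
proof -
  interpret W: cgraph W F by (rule W)
  have hV: "\<And>x. x \<in> V \<Longrightarrow> h x \<in> W" using h by (auto simp: bij_betw_def)
  have EV: "\<And>x y. E x y \<Longrightarrow> x \<in> V \<and> y \<in> V" using sg by (auto simp: simple_graph_def)
  have 1: "gdist W F (h x) (h z) \<le> gdist W F (h x) (h y) + 1" if "x \<in> V" "E y z" for x y z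
    using that EV[OF that(2)] adj[of y z] hV W.gdist_facts(1) by blast
  have 2: "\<exists>u\<in>V. E u y \<and> gdist W F (h x) (h y) = gdist W F (h x) (h u) + 1" if "x \<in> V" "y \<in> V" "x \<noteq> y" for x y
  proof -
    have "h x \<noteq> h y" using that h by (auto simp: bij_betw_def inj_on_def)
    with W.gdist_facts(3)[OF hV[OF that(1)] hV[OF that(2)]]
    obtain w where w: "w \<in> W" "F w (h y)" "gdist W F (h x) (h y) = gdist W F (h x) w + 1" by blast
    have "w \<in> h ` V" using w(1) h by (simp add: bij_betw_def)
    then obtain u where u: "u \<in> V" "w = h u" by blast
    then have "E u y" using adj[of u y] that(2) w(2) by simp
    then show ?thesis using u w(3) by (intro bexI[of _ u]) simp_all
  qed
  note fact = gdist_eqI[of V E "\<lambda>x y. gdist W F (h x) (h y)", OF sg W.gdist_facts(2)[OF hV] 1 2]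
  show "cgraph V E" using sg fact(1) by unfold_locales auto
  show "gdist V E x y = gdist W F (h x) (h y)" if "x \<in> V" "y \<in> V" for x y using fact(2) that by blast
qed

lemma iso_cgraph: "graph_iso V E W F \<Longrightarrow> simple_graph V E \<Longrightarrow> cgraph W F \<Longrightarrow> cgraph V E"
  unfolding graph_iso_def using iso_gdist(1) by blast

lemma iso_rgraph:
  assumes "graph_iso V E W F" "simple_graph V E" "rgraph W F" shows "rgraph V E"
proof -
  interpret W: rgraph W F by (rule assms)
  obtain h where h: "bij_betw h V W" "\<And>u v. u \<in> V \<Longrightarrow> v \<in> V \<Longrightarrow> E u v \<longleftrightarrow> F (h u) (h v)"
    using assms unfolding graph_iso_def by blast
  note D = iso_gdist[OF assms(2) W.cgraph_axioms h]
  interpret V: cgraph V E by (rule D(1))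
  have hV: "\<And>x. x \<in> V \<Longrightarrow> h x \<in> W" using h by (auto simp: bij_betw_def)
  define k where "k = inv_into V h"
  have k: "\<And>w. w \<in> W \<Longrightarrow> k w \<in> V \<and> h (k w) = w"
    unfolding k_def using bij_betw_inv_into_right[OF h(1)] bij_betwE[OF bij_betw_inv_into[OF h(1)]] by auto
  show ?thesis
  proof
    fix x y assume E: "E x y"
    have xV: "x \<in> V" "y \<in> V" using V.E_in[OF E] by simp_all
    have xy: "x \<in> V" "y \<in> V" "F (h x) (h y)" using xV h(2)[OF xV] E by simp_all
    note m = W.mir_in[OF xy(3)] W.mir_d[OF xy(3)]
    have "mirror V E x y (\<lambda>w. k (W.mir (h x) (h y) (h w)))"
      unfolding mirror_def gd_def using m xy k hV by (simp add: D(2) gd_def)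
    then show "\<exists>\<phi>. mirror V E x y \<phi>" by blast
  qed
qed

lemma iso_tri:
  assumes h: "bij_betw h V W" "\<And>u v. u \<in> V \<Longrightarrow> v \<in> V \<Longrightarrow> E u v \<longleftrightarrow> F (h u) (h v)" and xy: "x \<in> V" "y \<in> V"
  shows "card {z \<in> V. E x z \<and> E y z} = card {z \<in> W. F (h x) z \<and> F (h y) z}"
proof (rule bij_betw_same_card[of h])
  show "bij_betw h {z \<in> V. E x z \<and> E y z} {z \<in> W. F (h x) z \<and> F (h y) z}"
    using h xy unfolding bij_betw_def by (auto simp: inj_on_def)
qed

lemma iso_constant:
  assumes "graph_iso V E W F" "rgraph V E" "rgraph W F"
  shows "constant_curvature V E c \<longleftrightarrow> constant_curvature W F c"
proof -
  obtain h where h: "bij_betw h V W" "\<And>u v. u \<in> V \<Longrightarrow> v \<in> V \<Longrightarrow> E u v \<longleftrightarrow> F (h u) (h v)"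
    using assms unfolding graph_iso_def by blast
  interpret V: rgraph V E by fact
  interpret W: rgraph W F by fact
  have hV: "h ` V = W" using h(1) by (simp add: bij_betw_def)
  have t: "V.tri x y = W.tri (h x) (h y)" if "x \<in> V" "y \<in> V" for x y
    by (rule iso_tri[of h V W E F]) (use h that in auto)
  show ?thesis unfolding V.constant_curvature_iff W.constant_curvature_iff
  proof (intro iffI allI impI)
    fix a b assume *: "\<forall>x y. E x y \<longrightarrow> 2 + real (V.tri x y) = c" and ab: "F a b"
    have "a \<in> h ` V" "b \<in> h ` V" using W.E_in[OF ab] hV by simp_all
    then obtain x y where xy: "x \<in> V" "y \<in> V" "a = h x" "b = h y" by blast
    then have "E x y" using h(2)[OF xy(1,2)] ab by simp
    then show "2 + real (W.tri a b) = c" using *[rule_format, of x y] t[OF xy(1,2)] xy(3,4) by simp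
  next
    fix x y assume *: "\<forall>x y. F x y \<longrightarrow> 2 + real (W.tri x y) = c" and xy: "E x y"
    have V: "x \<in> V" "y \<in> V" using V.E_in[OF xy] by simp_all
    then have "F (h x) (h y)" using h(2)[OF V] xy by simp
    then show "2 + real (V.tri x y) = c" using * t[OF V] by simp
  qed
qed

subsection \<open>A graph is determined by a neighbourhood\<close>

context rgraph begin

lemma d_nb: "E b u \<Longrightarrow> E b v \<Longrightarrow> d u v = (if u = v then 0 else if E u v then 1 else 2)"
  using d_edge[of b u] d_edge[of u b] d_edge[of b v] d_triangle[of u b v] E_sym E_in d_eq0[of u v] d_eq1[of u v] d_nonneg[of u v]
  by (smt (verit))

text \<open>With squared distances \<open>2d\<close>, this is the inner product of \<open>z - b\<close> with the root \<open>u - b\<close>.\<close>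
definition pos :: "'a \<Rightarrow> 'a \<Rightarrow> 'a \<Rightarrow> int" where "pos b z u = d b z + 1 - d u z"

text \<open>Here \<open>2 - d v u\<close> is the inner product of the roots at \<open>v\<close> and
  \<open>u\<close>, which by \<open>d_nb\<close> depends only on adjacency among the neighbours of
  \<open>b\<close>. Hence codes are updated by purely local data.\<close>

lemma pos_mir:
  assumes "E b u" "E b v" "z \<in> V"
  shows "pos b (mir b u z) v = pos b z v + (1 - pos b z u) * (2 - d v u)"
proof -
  have V: "b \<in> V" "u \<in> V" "v \<in> V" "d b u = 1" "d v b = 1" "d b v = 1"
    using assms E_in d_edge E_sym by auto
  then show ?thesis using assms d_sym[of z u] d_sym[of z b] unfolding pos_def
    by (simp add: mir_d[OF assms(1)] algebra_simps)
qed

lemma pos_base: "E b u \<Longrightarrow> pos b b u = 0"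
  unfolding pos_def using d_edge[of u b] E_sym E_in by simp

lemma pos_nb: "E b u \<Longrightarrow> E b v \<Longrightarrow> pos b v u = 2 - d u v"
  unfolding pos_def using d_edge[of b v] by simp

lemma pos_zero: assumes "b \<in> V" "z \<in> V" "\<And>u. E b u \<Longrightarrow> pos b z u = 0" shows "z = b"
proof (rule ccontr)
  assume "z \<noteq> b"
  then obtain u where "u \<in> V" "E b u" "d u z = d b z - 1" using d_step[of b z] assms by metis
  then show False using assms(3)[of u] unfolding pos_def by simp
qed

text \<open>If \<open>u\<close> is the first step of a geodesic from \<open>b\<close> to
  \<open>z\<close>, the mirror in \<open>b u\<close> brings \<open>z\<close> one step nearer to
  \<open>b\<close>; so the mirrors at \<open>b\<close> generate all vertices from
  \<open>b\<close>.\<close>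

lemma mir_induct [consumes 2, case_names base step]:
  assumes "b \<in> V" "z \<in> V" and base: "P b"
    and step: "\<And>u z. E b u \<Longrightarrow> z \<in> V \<Longrightarrow> P z \<Longrightarrow> P (mir b u z)"
  shows "P z"
  using assms(2)
proof (induction "nat (d b z)" arbitrary: z)
  case 0
  then have "d b z = 0" using d_nonneg[of b z] by linarith
  then show ?case using assms(1) 0 base by simp
next
  case (Suc n)
  have "b \<noteq> z" using Suc assms(1) by auto
  then obtain u where u: "u \<in> V" "E b u" "d u z = d b z - 1" using d_step assms(1) Suc.prems by metis
  have "d b (mir b u z) = d b z - 1"
    using u assms(1) Suc.prems d_sym[of z u] d_sym[of z b] d_edge[OF u(2)] by (simp add: mir_d[OF u(2)])
  then have "P (mir b u z)" using Suc mir_in[OF u(2)] by (intro Suc.hyps) auto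
  then have "P (mir b u (mir b u z))" using step u(2) mir_in[OF u(2)] Suc.prems by blast
  then show ?case using mir_mir[OF u(2) Suc.prems] by simp
qed

text \<open>Equal codes stay equal under a common mirror, which reduces the claim to
  \<open>w = b\<close>, where the code vanishes.\<close>

lemma pos_inj:
  assumes "b \<in> V" "w \<in> V" "z \<in> V" "\<And>u. E b u \<Longrightarrow> pos b z u = pos b w u" shows "z = w"
  using assms
proof (induction arbitrary: z rule: mir_induct)
  case base
  then show ?case using pos_zero[of b z] pos_base assms(1) by simp
next
  case (step u w)
  note m = mir_in[OF step.hyps(1)] mir_mir[OF step.hyps(1)]
  have "mir b u z = w"
  proof (rule step.IH)
    fix v assume v: "E b v"
    have "pos b w v = pos b (mir b u (mir b u w)) v" using m step by simp
    also have "\<dots> = pos b (mir b u w) v + (1 - pos b (mir b u w) u) * (2 - d v u)"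
      by (rule pos_mir[OF step.hyps(1) v m(1)[OF step.hyps(2)]])
    also have "\<dots> = pos b (mir b u z) v" using pos_mir[OF step.hyps(1) v] step v by simp
    finally show "pos b (mir b u z) v = pos b w v" by simp
  qed (use m step in auto)
  then show ?case using m step by metis
qed

end

locale local_iso = G: rgraph V E + G': rgraph V' E'
  for V :: "'a set" and E and V' :: "'b set" and E' +
  fixes b b' h
  assumes b: "b \<in> V" "b' \<in> V'"
    and h: "bij_betw h {u \<in> V. E b u} {u \<in> V'. E' b' u}"
    and h_adj: "\<And>u v. E b u \<Longrightarrow> E b v \<Longrightarrow> E u v \<longleftrightarrow> E' (h u) (h v)"
begin

lemma h_nb: "E b u \<Longrightarrow> E' b' (h u)" using h G.E_in unfolding bij_betw_def by blast

lemma h_surj: "E' b' v \<Longrightarrow> \<exists>u. E b u \<and> v = h u"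
  using h G'.E_in unfolding bij_betw_def by blast

lemma h_d: assumes "E b u" "E b v" shows "G.d u v = G'.d (h u) (h v)"
proof -
  have "h u = h v \<longleftrightarrow> u = v" using assms h G.E_in by (auto simp: bij_betw_def inj_on_def)
  then show ?thesis using G.d_nb[OF assms] G'.d_nb[OF assms[THEN h_nb]] h_adj[OF assms] by simp
qed

text \<open>Equality of codes. Mirrors on both sides respect it (\<open>R_mir\<close>), which makes
  it total and onto, and \<open>pos_inj\<close> makes it one-to-one; hence it is the graph of the
  isomorphism.\<close>

definition R :: "'a \<Rightarrow> 'b \<Rightarrow> bool" where
  "R z z' \<longleftrightarrow> z \<in> V \<and> z' \<in> V' \<and> (\<forall>u. E b u \<longrightarrow> G.pos b z u = G'.pos b' z' (h u))"

lemma R_mir: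
  assumes u: "E b u" and R: "R z z'" shows "R (G.mir b u z) (G'.mir b' (h u) z')"
proof -
  have "G.pos b (G.mir b u z) v = G'.pos b' (G'.mir b' (h u) z') (h v)" if "E b v" for v
    using R u that G.pos_mir[OF u that] G'.pos_mir[OF h_nb[OF u] h_nb[OF that]] h_d unfolding R_def by simp
  then show ?thesis using R G.mir_in[OF u] G'.mir_in[OF h_nb[OF u]] unfolding R_def by simp
qed

lemma R_base: "R b b'"
  unfolding R_def using b G.pos_base G'.pos_base h_nb by auto

lemma R_nb: "E b v \<Longrightarrow> R v (h v)"
  unfolding R_def using G.pos_nb G'.pos_nb h_nb h_d G.E_in G'.E_in by metis

lemma R_total: assumes "z \<in> V" shows "\<exists>z'. R z z'"
  using b(1) assms by (induction rule: G.mir_induct) (use R_base R_mir in blast)+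

lemma R_surj: assumes "z' \<in> V'" shows "\<exists>z. R z z'"
  using b(2) assms
proof (induction rule: G'.mir_induct)
  case (step u z)
  then show ?case using R_mir h_surj by metis
qed (use R_base in blast)

lemma R_right: "R z z' \<Longrightarrow> R z w' \<Longrightarrow> z' = w'"
  unfolding R_def using b by (intro G'.pos_inj[of b']) (auto dest!: h_surj)

lemma R_left: "R z z' \<Longrightarrow> R w z' \<Longrightarrow> z = w"
  unfolding R_def using b by (intro G.pos_inj[of b]) auto

text \<open>Simultaneous mirrors move \<open>z\<close> to \<open>b\<close> and \<open>z'\<close> to
  \<open>b'\<close>; there adjacency means membership in the given neighbourhoods.\<close>

lemma R_adj:
  assumes "z \<in> V" "R z z'" "R w w'" shows "E z w \<longleftrightarrow> E' z' w'"
  using b(1) assms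
proof (induction arbitrary: z' w w' rule: G.mir_induct)
  case base
  then have "z' = b'" using R_right R_base by blast
  then show ?case using R_nb R_left R_right h_nb h_surj base by metis
next
  case (step u z)
  note m = G.mir_in[OF step.hyps(1)] G.mir_mir[OF step.hyps(1)] G.mir_E[OF step.hyps(1)]
  note m' = G'.mir_E[OF h_nb[OF step.hyps(1)]]
  have V: "w \<in> V" "z' \<in> V'" "w' \<in> V'" using step.prems unfolding R_def by auto
  have "R z (G'.mir b' (h u) z')" using R_mir[OF step.hyps(1) step.prems(1)] m step.hyps by simp
  moreover have "R (G.mir b u w) (G'.mir b' (h u) w')" using R_mir[OF step.hyps(1) step.prems(2)] .
  ultimately have "E z (G.mir b u w) \<longleftrightarrow> E' (G'.mir b' (h u) z') (G'.mir b' (h u) w')" by (rule step.IH)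
  moreover have "E (G.mir b u z) w \<longleftrightarrow> E z (G.mir b u w)"
    using m(3)[of "G.mir b u z" w] m(1,2) step.hyps(2) V by simp
  ultimately show ?case using m'[of z' w'] V by simp
qed

lemma iso: "graph_iso V E V' E'"
proof -
  define g where "g z = (SOME z'. R z z')" for z
  have g: "R z (g z)" if "z \<in> V" for z unfolding g_def using R_total[OF that] by (rule someI_ex)
  have "bij_betw g V V'"
    unfolding bij_betw_def
  proof
    show "inj_on g V" using g R_left by (metis inj_onI)
    show "g ` V = V'" using g R_surj R_right unfolding R_def by (smt (verit) image_iff set_eqI)
  qed
  then show ?thesis unfolding graph_iso_def using g R_adj by (intro exI[of _ g]) auto
qed

end

subsection \<open>Components of a neighbourhood\<close>

context rgraph begin

definition comp :: "'a \<Rightarrow> 'a \<Rightarrow> 'a set" where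
  "comp b u = {v. (\<lambda>x y. E x y \<and> E b x \<and> E b y)\<^sup>*\<^sup>* u v}"

abbreviation sub :: "'a set \<Rightarrow> 'a \<Rightarrow> 'a \<Rightarrow> bool" where
  "sub C x y \<equiv> E x y \<and> x \<in> C \<and> y \<in> C"

lemma comp_self: "u \<in> comp b u" by (simp add: comp_def)

lemma comp_nb: assumes "E b u" "v \<in> comp b u" shows "E b v"
proof -
  have "(\<lambda>x y. E x y \<and> E b x \<and> E b y)\<^sup>*\<^sup>* u v" using assms by (simp add: comp_def)
  then show ?thesis using assms(1) by (induction rule: rtranclp_induct) auto
qed

lemma comp_step: "v \<in> comp b u \<Longrightarrow> E b v \<Longrightarrow> E b w \<Longrightarrow> E v w \<Longrightarrow> w \<in> comp b u"
  unfolding comp_def by (simp add: rtranclp.rtrancl_into_rtrancl)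

lemma comp_eq: assumes "v \<in> comp b u" shows "comp b v = comp b u"
proof -
  let ?r = "\<lambda>x y. E x y \<and> E b x \<and> E b y"
  have "symp ?r" by (rule sympI) (use E_sym in blast)
  moreover have uv: "?r\<^sup>*\<^sup>* u v" using assms by (simp add: comp_def)
  ultimately have vu: "?r\<^sup>*\<^sup>* v u" using sympD[OF symp_rtranclp, of ?r u v] by simp
  show ?thesis
  proof (intro equalityI subsetI)
    fix w assume "w \<in> comp b v" then show "w \<in> comp b u"
      using rtranclp_trans[of ?r u v w, OF uv] by (simp add: comp_def)
  next
    fix w assume "w \<in> comp b u" then show "w \<in> comp b v"
      using rtranclp_trans[of ?r v u w, OF vu] by (simp add: comp_def)
  qed
qed

text \<open>A path of length three in a neighbourhood has a shortcut, namely the mirror image of its first vertex in its middle edge.\<close>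
lemma nb_shortcut:
  assumes "E b p" "E b q" "E b r" "E b s" "E p q" "E q r" "E r s"
  shows "p = s \<or> E p s \<or> (\<exists>w. E b w \<and> E p w \<and> E w s)"
proof (rule ccontr)
  assume n: "\<not> ?thesis"
  have V: "b \<in> V" "p \<in> V" "q \<in> V" "r \<in> V" "s \<in> V" using assms E_in by auto
  have ne: "\<not> E p r" "\<not> E q s" "p \<noteq> r" "q \<noteq> s" using n assms E_sym by metis+
  have D: "d p q = 1" "d p r = 2" "d s r = 1" "d s q = 2" "d s p = 2" "d b r = 1" "d b q = 1" "d b p = 1"
    using d_nb[of b] assms ne n E_commute d_edge by (auto simp: E_commute)
  let ?w = "mir q r p"
  note m = mir_in[OF assms(6)] mir_d[OF assms(6)]
  have "d b ?w = 1" "d s ?w = 1" using m(2)[of b p] m(2)[of s p] V D by simp_all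
  moreover have "E p ?w" using mir_adj[OF assms(6) V(2)] D by simp
  ultimately show False using n d_eq1 m(1) V E_sym by blast
qed

lemma comp_two:
  assumes u: "E b u" and v: "v \<in> comp b u" shows "u = v \<or> E u v \<or> (\<exists>w. E b w \<and> E u w \<and> E w v)"
proof -
  have "(\<lambda>x y. E x y \<and> E b x \<and> E b y)\<^sup>*\<^sup>* u v" using v by (simp add: comp_def)
  then show ?thesis
  proof (induction rule: rtranclp_induct)
    case (step y z)
    then show ?case using nb_shortcut[of b u _ y z] u by metis
  qed simp
qed

text \<open>By \<open>comp_two\<close> a component is isometrically embedded. The mirror of one of
  its edges fixes \<open>b\<close>, so it preserves the neighbourhood of \<open>b\<close>; a vertex
  that it moves goes to an adjacent vertex and thus stays in the component.\<close>

lemma comp_rgraph: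
  assumes u: "E b u"
  shows "rgraph (comp b u) (sub (comp b u))"
    and "\<And>x y. x \<in> comp b u \<Longrightarrow> y \<in> comp b u \<Longrightarrow> gdist (comp b u) (sub (comp b u)) x y = gdist V E x y"
proof -
  let ?C = "comp b u" and ?\<delta> = "gdist V E"
  have CV: "x \<in> V" "E b x" if "x \<in> ?C" for x using comp_nb[OF u that] E_in by auto
  have sg: "simple_graph ?C (sub ?C)"
    unfolding simple_graph_def using E_sym E_irrefl CV finite_subset[of ?C V, OF _ finV] by blast
  have step: "\<exists>v\<in>?C. sub ?C v y \<and> ?\<delta> x y = ?\<delta> x v + 1" if xy: "x \<in> ?C" "y \<in> ?C" "x \<noteq> y" for x y
  proof -
    have "y \<in> comp b x" using comp_eq xy by blast
    from comp_two[OF CV(2)[OF xy(1)] this] xy consider "E x y" | w where "E b w" "E x w" "E w y" "\<not> E x y" by blast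
    then show ?thesis
    proof cases
      case 1
      then show ?thesis using xy CV d_edge[OF 1] gdist_facts(2) by (intro bexI[of _ x]) (auto simp: gd_def)
    next
      case 2
      then have "w \<in> ?C" using comp_step[of x b u w] xy CV by blast
      moreover have "d x y = 2" "d x w = 1" using d_nb[of b x y] CV xy 2 d_edge by auto
      ultimately show ?thesis using 2 xy by (intro bexI[of _ w]) (auto simp: gd_def)
    qed
  qed
  have mir: "\<exists>\<phi>. \<forall>w\<in>?C. \<phi> w \<in> ?C \<and> (\<forall>z\<in>?C.
      int (?\<delta> z (\<phi> w)) = int (?\<delta> z w) + (int (?\<delta> w y) - int (?\<delta> w x)) * (int (?\<delta> z y) - int (?\<delta> z x)))"
    if xy: "sub ?C x y" for x y
  proof (intro exI[of _ "mir x y"] ballI conjI)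
    have E: "E x y" using xy by blast
    fix w assume w: "w \<in> ?C"
    show "mir x y w \<in> ?C"
    proof (cases "d w y = d w x")
      case True then show ?thesis using mir_fix[OF E] CV[OF w] w by simp
    next
      case False
      have "b \<in> V" using u E_in by blast
      then have "d b (mir x y w) = 1" using mir_d[OF E, of b w] CV w xy d_edge by simp
      then have "E b (mir x y w)" using d_eq1 \<open>b \<in> V\<close> mir_in[OF E] CV w by blast
      then show ?thesis using comp_step[OF w] CV[OF w] mir_adj[OF E _ False] by blast
    qed
    show "int (?\<delta> z (mir x y w)) = int (?\<delta> z w) + (int (?\<delta> w y) - int (?\<delta> w x)) * (int (?\<delta> z y) - int (?\<delta> z x))"
      if "z \<in> ?C" for z
      using mir_d[OF E, of z w] CV w that by (simp add: gd_def)
  qed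
  note facts = rgraphI[of ?C "sub ?C" ?\<delta>, OF sg _ _ step mir]
  show "rgraph ?C (sub ?C)" using facts(1) CV gdist_facts by blast
  show "gdist ?C (sub ?C) x y = ?\<delta> x y" if "x \<in> ?C" "y \<in> ?C" for x y using facts(2) that CV gdist_facts by blast
qed

end

section \<open>Constant curvature from a connected neighbourhood\<close>

context rgraph begin

lemma tri_mir:
  assumes E: "E x y" and "p \<in> V" "q \<in> V" shows "tri (mir x y p) (mir x y q) = tri p q"
  by (rule iso_tri[of "mir x y" V V E E, symmetric]) (use mir_bij[OF E] mir_E[OF E] assms in auto)

text \<open>For adjacent neighbours \<open>u\<close>, \<open>v\<close> of \<open>b\<close> the
  mirror in \<open>u v\<close> fixes \<open>b\<close> and exchanges the edges \<open>b u\<close> and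
  \<open>b v\<close>, so triangle counts agree along paths in the neighbourhood. Mirrors at
  \<open>b\<close> then carry the count to every vertex.\<close>

lemma constant_if_local_connected:
  assumes b: "b \<in> V" and con: "\<And>u v. E b u \<Longrightarrow> E b v \<Longrightarrow> v \<in> comp b u"
  shows "\<exists>c. constant_curvature V E c"
proof -
  have step: "tri b u = tri b v" if "E b u" "E b v" "E u v" for u v
  proof -
    have "mir u v b = b" using that d_edge E_in E_sym by (intro mir_fix) auto
    then show ?thesis using tri_mir[OF that(3), of b u] mir_swap[OF that(3)] that E_in by simp
  qed
  have "tri b u = tri b v" if "E b u" "E b v" for u v
  proof -
    have "(\<lambda>x y. E x y \<and> E b x \<and> E b y)\<^sup>*\<^sup>* u v" using con[OF that] by (simp add: comp_def)
    then show ?thesis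
    proof (induction rule: rtranclp_induct)
      case (step y z)
      then show ?case using \<open>\<And>u v. E b u \<Longrightarrow> E b v \<Longrightarrow> E u v \<Longrightarrow> tri b u = tri b v\<close>[of y z] by simp
    qed simp
  qed
  then obtain t where t: "\<And>u. E b u \<Longrightarrow> tri b u = t" by metis
  have "\<forall>w. E z w \<longrightarrow> tri z w = t" if "z \<in> V" for z
    using b that
  proof (induction rule: mir_induct)
    case base
    then show ?case using t by blast
  next
    case (step u z)
    show ?case
    proof (intro allI impI)
      fix w assume w: "E (mir b u z) w"
      note m = mir_in[OF step.hyps(1)] mir_mir[OF step.hyps(1)] mir_E[OF step.hyps(1)] tri_mir[OF step.hyps(1)]
      have wV: "w \<in> V" using w E_in by blast
      have "E z (mir b u w)" using m(3)[OF step.hyps(2) m(1)[OF wV]] m(2)[OF wV] w by simp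
      then show "tri (mir b u z) w = t"
        using step.IH m(4)[OF step.hyps(2) m(1)[OF wV]] m(2)[OF wV] by simp
    qed
  qed
  then show ?thesis unfolding constant_curvature_iff using E_in by (intro exI[of _ "2 + real t"]) auto
qed

end

subsection \<open>Cartesian products\<close>

lemma prod_V_length: "xs \<in> prod_V gs \<Longrightarrow> length xs = length gs"
  and prod_V_nth: "xs \<in> prod_V gs \<Longrightarrow> i < length gs \<Longrightarrow> xs ! i \<in> fst (gs ! i)"
  by (auto simp: prod_V_def)

lemma prod_V_update: "xs \<in> prod_V gs \<Longrightarrow> v \<in> fst (gs ! i) \<Longrightarrow> xs[i := v] \<in> prod_V gs"
  unfolding prod_V_def by simp (metis nth_list_update_eq nth_list_update_neq)

lemma finite_prod_V: assumes "\<And>H. H \<in> set gs \<Longrightarrow> finite (fst H)" shows "finite (prod_V gs)"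
proof -
  have "prod_V gs \<subseteq> {xs. set xs \<subseteq> (\<Union>H\<in>set gs. fst H) \<and> length xs = length gs}"
    unfolding prod_V_def by (auto simp: in_set_conv_nth) (metis nth_mem)
  then show ?thesis using finite_lists_length_eq[of "\<Union>H\<in>set gs. fst H"] assms finite_subset by blast
qed

locale graph_list =
  fixes gs :: "('b set \<times> ('b \<Rightarrow> 'b \<Rightarrow> bool)) list"
  assumes simple: "\<And>i. i < length gs \<Longrightarrow> simple_graph (fst (gs ! i)) (snd (gs ! i))"
begin

lemma prod_E_iff:
  "prod_E gs xs ys \<longleftrightarrow> xs \<in> prod_V gs \<and> (\<exists>i<length gs. \<exists>v. snd (gs ! i) (xs ! i) v \<and> ys = xs[i := v])"
proof
  assume "prod_E gs xs ys"
  then obtain i where i: "xs \<in> prod_V gs" "ys \<in> prod_V gs" "i < length gs" "snd (gs ! i) (xs ! i) (ys ! i)"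
    "\<forall>j<length gs. j \<noteq> i \<longrightarrow> xs ! j = ys ! j" unfolding prod_E_def by blast
  have "ys = xs[i := ys ! i]"
    using i prod_V_length[OF i(1)] prod_V_length[OF i(2)] by (intro nth_equalityI) (auto simp: nth_list_update)
  then show "xs \<in> prod_V gs \<and> (\<exists>i<length gs. \<exists>v. snd (gs ! i) (xs ! i) v \<and> ys = xs[i := v])" using i by metis
next
  assume "xs \<in> prod_V gs \<and> (\<exists>i<length gs. \<exists>v. snd (gs ! i) (xs ! i) v \<and> ys = xs[i := v])"
  then obtain i v where i: "xs \<in> prod_V gs" "i < length gs" "snd (gs ! i) (xs ! i) v" "ys = xs[i := v]" by blast
  have "v \<in> fst (gs ! i)" using simple[OF i(2)] i(3) unfolding simple_graph_def by blast
  then have "ys \<in> prod_V gs" using prod_V_update[OF i(1), of v i] i(4) by simp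
  then show "prod_E gs xs ys" unfolding prod_E_def using i prod_V_length[OF i(1)] by (auto simp: nth_list_update)
qed

lemma prod_E_update:
  assumes "xs \<in> prod_V gs" "i < length gs" shows "prod_E gs xs (xs[i := v]) \<longleftrightarrow> snd (gs ! i) (xs ! i) v"
proof
  assume "prod_E gs xs (xs[i := v])"
  then obtain j w where j: "j < length gs" "snd (gs ! j) (xs ! j) w" "xs[i := v] = xs[j := w]"
    using prod_E_iff by blast
  have "w \<noteq> xs ! j" using j simple[OF j(1)] unfolding simple_graph_def by blast
  then have "i = j" "w = v" using j assms prod_V_length[OF assms(1)] by (metis nth_list_update nth_list_update_neq)+
  then show "snd (gs ! i) (xs ! i) v" using j by simp
qed (use assms prod_E_iff in blast)

lemma prod_simple: "simple_graph (prod_V gs) (prod_E gs)"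
proof -
  have "finite (fst H)" if "H \<in> set gs" for H
    using that simple unfolding simple_graph_def in_set_conv_nth by blast
  then have "finite (prod_V gs)" by (rule finite_prod_V)
  moreover have "prod_E gs ys xs" if E: "prod_E gs xs ys" for xs ys
  proof -
    obtain i where i: "xs \<in> prod_V gs" "ys \<in> prod_V gs" "i < length gs" "snd (gs ! i) (xs ! i) (ys ! i)"
      "\<forall>j<length gs. j \<noteq> i \<longrightarrow> xs ! j = ys ! j" using E unfolding prod_E_def by blast
    then have "snd (gs ! i) (ys ! i) (xs ! i)" using simple[OF i(3)] unfolding simple_graph_def by blast
    then show ?thesis unfolding prod_E_def using i by metis
  qed
  moreover have "\<not> prod_E gs xs xs" for xs
    using simple unfolding prod_E_def simple_graph_def by blast
  ultimately show ?thesis unfolding simple_graph_def by (auto simp: prod_E_def)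
qed

lemma walk_nth:
  assumes "walk (prod_V gs) (prod_E gs) n xs ys" "i < length gs"
  shows "\<exists>m. walk (fst (gs ! i)) (snd (gs ! i)) m (xs ! i) (ys ! i)"
  using assms(1)
proof (induction n arbitrary: xs)
  case 0
  then show ?case using prod_V_nth[OF _ assms(2)] by (intro exI[of _ 0]) auto
next
  case (Suc n)
  then obtain zs where zs: "prod_E gs xs zs" "walk (prod_V gs) (prod_E gs) n zs ys" by auto
  then obtain m where m: "walk (fst (gs ! i)) (snd (gs ! i)) m (zs ! i) (ys ! i)" using Suc.IH by blast
  obtain j v where j: "xs \<in> prod_V gs" "j < length gs" "snd (gs ! j) (xs ! j) v" "zs = xs[j := v]"
    using zs(1) prod_E_iff by blast
  show ?case
  proof (cases "i = j")
    case True
    then have "zs ! i = v" using j prod_V_length[OF j(1)] by simp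
    then have "walk (fst (gs ! i)) (snd (gs ! i)) (Suc m) (xs ! i) (ys ! i)"
      using m j True simple[OF j(2)] unfolding simple_graph_def by auto
    then show ?thesis by blast
  next
    case False
    then show ?thesis using m j by auto
  qed
qed

text \<open>The listed families include disconnected graphs such as \<open>CP(1)\<close>; a
  connected product forces each factor to be connected, since walks project to walks.\<close>

lemma connected_factor:
  assumes "connected_graph (prod_V gs) (prod_E gs)" "prod_V gs \<noteq> {}" "i < length gs"
  shows "cgraph (fst (gs ! i)) (snd (gs ! i))"
proof
  obtain os where os: "os \<in> prod_V gs" using assms by blast
  show "connected_graph (fst (gs ! i)) (snd (gs ! i))" unfolding connected_graph_def
  proof (intro ballI)
    fix a b assume "a \<in> fst (gs ! i)" "b \<in> fst (gs ! i)"
    then have "os[i := a] \<in> prod_V gs" "os[i := b] \<in> prod_V gs" by (simp_all only: prod_V_update[OF os])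
    then obtain n where "walk (prod_V gs) (prod_E gs) n (os[i := a]) (os[i := b])"
      using assms(1) unfolding connected_graph_def by blast
    from walk_nth[OF this assms(3)]
    show "\<exists>n. walk (fst (gs ! i)) (snd (gs ! i)) n a b" using prod_V_length[OF os] assms(3) by simp
  qed
qed (rule simple[OF assms(3)])

text \<open>Two vertices that differ in coordinate \<open>i\<close> only cannot reach a common
  neighbour through another coordinate, so a triangle lies within one factor.\<close>

lemma prod_nb_same:
  assumes xs: "xs \<in> prod_V gs" and i: "i < length gs" and v: "snd (gs ! i) (xs ! i) v"
    and 1: "prod_E gs xs zs" and 2: "prod_E gs (xs[i := v]) zs"
  shows "\<exists>w. zs = xs[i := w] \<and> snd (gs ! i) (xs ! i) w \<and> snd (gs ! i) v w"
proof -
  obtain j w where j: "j < length gs" "snd (gs ! j) (xs ! j) w" "zs = xs[j := w]" using 1 prod_E_iff by blast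
  obtain k u where k: "k < length gs" "snd (gs ! k) (xs[i := v] ! k) u" "zs = xs[i := v, k := u]" using 2 prod_E_iff by blast
  have ir: "\<not> snd (gs ! l) a a" if "l < length gs" for l a using simple[OF that] unfolding simple_graph_def by blast
  have L: "length xs = length gs" by (rule prod_V_length[OF xs])
  have "i = j"
  proof (rule ccontr)
    assume "i \<noteq> j"
    have "k = j"
    proof (rule ccontr)
      assume "k \<noteq> j"
      then have "zs ! j = xs ! j" using k \<open>i \<noteq> j\<close> by simp
      then show False using j ir L by simp
    qed
    then have "zs ! i = v" using k \<open>i \<noteq> j\<close> L i by simp
    moreover have "zs ! i = xs ! i" using j \<open>i \<noteq> j\<close> by simp
    ultimately show False using v ir[OF i] by simp
  qed
  moreover have "k = i"
  proof (rule ccontr)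
    assume "k \<noteq> i"
    then have "zs ! k = xs ! k" "xs[i := v] ! k = xs ! k" using j(3) \<open>i = j\<close> by simp_all
    moreover have "zs ! k = u" using k(1,3) L by simp
    ultimately have "xs[i := v] ! k = u" by simp
    then show False using k ir[OF k(1)] by simp
  qed
  ultimately show ?thesis using j k L by (intro exI[of _ w]) (metis length_list_update nth_list_update_eq)
qed

lemma prod_tri:
  assumes xs: "xs \<in> prod_V gs" and i: "i < length gs" and v: "snd (gs ! i) (xs ! i) v"
  shows "card {zs \<in> prod_V gs. prod_E gs xs zs \<and> prod_E gs (xs[i := v]) zs}
       = card {z \<in> fst (gs ! i). snd (gs ! i) (xs ! i) z \<and> snd (gs ! i) v z}" (is "card ?A = card ?B")
proof (rule bij_betw_same_card[symmetric, of "\<lambda>z. xs[i := z]"])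
  have L: "length xs = length gs" by (rule prod_V_length[OF xs])
  have F: "snd (gs ! i) a b \<Longrightarrow> a \<in> fst (gs ! i) \<and> b \<in> fst (gs ! i)" for a b
    using simple[OF i] unfolding simple_graph_def by blast
  show "bij_betw (\<lambda>z. xs[i := z]) ?B ?A" unfolding bij_betw_def
  proof
    show "inj_on (\<lambda>z. xs[i := z]) ?B"
    proof (rule inj_onI)
      fix a b assume "xs[i := a] = xs[i := b]"
      then have "xs[i := a] ! i = xs[i := b] ! i" by simp
      then show "a = b" using L i by simp
    qed
    show "(\<lambda>z. xs[i := z]) ` ?B = ?A"
    proof
      show "(\<lambda>z. xs[i := z]) ` ?B \<subseteq> ?A"
      proof
        fix zs assume "zs \<in> (\<lambda>z. xs[i := z]) ` ?B"
        then obtain z where z: "z \<in> ?B" "zs = xs[i := z]" by blast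
        have xv: "xs[i := v] \<in> prod_V gs" using prod_V_update[OF xs] F v by blast
        have "prod_E gs (xs[i := v]) (xs[i := v, i := z])"
          using prod_E_update[OF xv i, of z] z L i by simp
        then have "prod_E gs (xs[i := v]) zs" using z by simp
        moreover have "prod_E gs xs zs" using prod_E_update[OF xs i, of z] z by simp
        ultimately show "zs \<in> ?A" by (simp add: prod_E_def)
      qed
      show "?A \<subseteq> (\<lambda>z. xs[i := z]) ` ?B" using prod_nb_same[OF xs i v] F by blast
    qed
  qed
qed

end

definition prod_dist :: "('b set \<times> ('b \<Rightarrow> 'b \<Rightarrow> bool)) list \<Rightarrow> 'b list \<Rightarrow> 'b list \<Rightarrow> nat" where
  "prod_dist gs xs ys = (\<Sum>i<length gs. gdist (fst (gs ! i)) (snd (gs ! i)) (xs ! i) (ys ! i))"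

lemma prod_dist_update:
  assumes "i < length gs" "length ys = length gs"
  shows "int (prod_dist gs zs (ys[i := v])) = int (prod_dist gs zs ys)
     + (gd (fst (gs ! i)) (snd (gs ! i)) (zs ! i) v - gd (fst (gs ! i)) (snd (gs ! i)) (zs ! i) (ys ! i))"
proof -
  let ?g = "\<lambda>ys i. gdist (fst (gs ! i)) (snd (gs ! i)) (zs ! i) (ys ! i)"
  have "prod_dist gs zs ys = ?g ys i + (\<Sum>j\<in>{..<length gs} - {i}. ?g ys j)" for ys
    unfolding prod_dist_def using assms(1) by (intro sum.remove) auto
  moreover have "(\<Sum>j\<in>{..<length gs} - {i}. ?g (ys[i := v]) j) = (\<Sum>j\<in>{..<length gs} - {i}. ?g ys j)"
    by (intro sum.cong) auto
  ultimately show ?thesis using assms by (simp add: gd_def)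
qed

locale rgraph_list =
  fixes gs :: "('b set \<times> ('b \<Rightarrow> 'b \<Rightarrow> bool)) list"
  assumes factor: "\<And>i. i < length gs \<Longrightarrow> rgraph (fst (gs ! i)) (snd (gs ! i))"

sublocale rgraph_list \<subseteq> graph_list gs
  using factor cgraph.simple rgraph.axioms(1) by unfold_locales blast

context rgraph_list begin

text \<open>Distances add over the factors, and the mirror of an edge in direction \<open>i\<close>
  acts on coordinate \<open>i\<close> alone.\<close>

lemma prod_rgraph: "rgraph (prod_V gs) (prod_E gs)"
  and prod_gdist: "\<And>xs ys. xs \<in> prod_V gs \<Longrightarrow> ys \<in> prod_V gs \<Longrightarrow> gdist (prod_V gs) (prod_E gs) xs ys = prod_dist gs xs ys"
proof -
  have refl: "prod_dist gs xs xs = 0" if "xs \<in> prod_V gs" for xs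
    unfolding prod_dist_def
  proof (intro sum.neutral ballI)
    fix i assume "i \<in> {..<length gs}"
    then have i: "i < length gs" by simp
    interpret rgraph "fst (gs ! i)" "snd (gs ! i)" by (rule factor[OF i])
    show "gdist (fst (gs ! i)) (snd (gs ! i)) (xs ! i) (xs ! i) = 0" using gdist_facts(2) prod_V_nth[OF that i] by blast
  qed
  have lip: "prod_dist gs xs zs \<le> prod_dist gs xs ys + 1" if xs: "xs \<in> prod_V gs" and E: "prod_E gs ys zs" for xs ys zs
  proof -
    obtain i v where i: "ys \<in> prod_V gs" "i < length gs" "snd (gs ! i) (ys ! i) v" "zs = ys[i := v]"
      using E prod_E_iff by blast
    interpret rgraph "fst (gs ! i)" "snd (gs ! i)" by (rule factor[OF i(2)])
    show ?thesis unfolding i(4)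
      using prod_dist_update[OF i(2) prod_V_length[OF i(1)], of xs v] d_lip[OF prod_V_nth[OF xs i(2)] i(3)] by linarith
  qed
  have step: "\<exists>us\<in>prod_V gs. prod_E gs us ys \<and> prod_dist gs xs ys = prod_dist gs xs us + 1"
    if xs: "xs \<in> prod_V gs" and ys: "ys \<in> prod_V gs" and ne: "xs \<noteq> ys" for xs ys
  proof -
    note L = prod_V_length[OF xs] prod_V_length[OF ys]
    obtain i where i: "i < length gs" "xs ! i \<noteq> ys ! i" using ne L by (metis nth_equalityI)
    interpret rgraph "fst (gs ! i)" "snd (gs ! i)" by (rule factor[OF i(1)])
    obtain u where u: "u \<in> fst (gs ! i)" "snd (gs ! i) u (ys ! i)" "d (xs ! i) u = d (xs ! i) (ys ! i) - 1"
      using d_step2[OF prod_V_nth[OF xs i(1)] prod_V_nth[OF ys i(1)] i(2)] by blast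
    have uP: "ys[i := u] \<in> prod_V gs" using prod_V_update[OF ys u(1)] .
    have "prod_E gs (ys[i := u]) (ys[i := u, i := ys ! i])"
      using prod_E_update[OF uP i(1), of "ys ! i"] u L i by simp
    then have "prod_E gs (ys[i := u]) ys" by (simp only: list_update_overwrite list_update_id)
    then show ?thesis using uP prod_dist_update[OF i(1) L(2), of xs u] u(3) by (intro bexI[of _ "ys[i := u]"]) auto
  qed
  have mir: "\<exists>\<phi>. \<forall>ws\<in>prod_V gs. \<phi> ws \<in> prod_V gs \<and> (\<forall>zs\<in>prod_V gs.
      int (prod_dist gs zs (\<phi> ws)) = int (prod_dist gs zs ws)
       + (int (prod_dist gs ws ys) - int (prod_dist gs ws xs)) * (int (prod_dist gs zs ys) - int (prod_dist gs zs xs)))"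
    if E: "prod_E gs xs ys" for xs ys
  proof -
    obtain i v where i: "xs \<in> prod_V gs" "i < length gs" "snd (gs ! i) (xs ! i) v" "ys = xs[i := v]"
      using E prod_E_iff by blast
    interpret rgraph "fst (gs ! i)" "snd (gs ! i)" by (rule factor[OF i(2)])
    note m = mir_in[OF i(3)] mir_d[OF i(3)]
    note up = prod_dist_update[OF i(2)]
    show ?thesis
    proof (intro exI[of _ "\<lambda>ws. ws[i := mir (xs ! i) v (ws ! i)]"] ballI conjI)
      fix ws assume ws: "ws \<in> prod_V gs"
      show "ws[i := mir (xs ! i) v (ws ! i)] \<in> prod_V gs"
        using prod_V_update[OF ws m(1)[OF prod_V_nth[OF ws i(2)]]] .
      fix zs assume zs: "zs \<in> prod_V gs"
      note L = prod_V_length[OF ws] prod_V_length[OF i(1)]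
      show "int (prod_dist gs zs (ws[i := mir (xs ! i) v (ws ! i)])) = int (prod_dist gs zs ws)
        + (int (prod_dist gs ws ys) - int (prod_dist gs ws xs)) * (int (prod_dist gs zs ys) - int (prod_dist gs zs xs))"
        unfolding i(4) up[OF L(1)] up[OF L(2)] m(2)[OF prod_V_nth[OF zs i(2)] prod_V_nth[OF ws i(2)]] by simp
    qed
  qed
  note f = rgraphI[of "prod_V gs" "prod_E gs" "prod_dist gs", OF prod_simple refl lip step mir]
  show "rgraph (prod_V gs) (prod_E gs)" using f(1) .
  show "gdist (prod_V gs) (prod_E gs) xs ys = prod_dist gs xs ys" if "xs \<in> prod_V gs" "ys \<in> prod_V gs" for xs ys
    using f(2) that by simp
qed

lemma prod_constant:
  assumes ne: "prod_V gs \<noteq> {}"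
  shows "constant_curvature (prod_V gs) (prod_E gs) c
     \<longleftrightarrow> (\<forall>i<length gs. constant_curvature (fst (gs ! i)) (snd (gs ! i)) c)"
proof -
  interpret P: rgraph "prod_V gs" "prod_E gs" by (rule prod_rgraph)
  show ?thesis
  proof (intro iffI allI impI)
    fix i assume c: "constant_curvature (prod_V gs) (prod_E gs) c" and i: "i < length gs"
    interpret F: rgraph "fst (gs ! i)" "snd (gs ! i)" by (rule factor[OF i])
    obtain os where os: "os \<in> prod_V gs" using ne by blast
    show "constant_curvature (fst (gs ! i)) (snd (gs ! i)) c"
      unfolding F.constant_curvature_iff
    proof (intro allI impI)
      fix x y assume xy: "snd (gs ! i) x y"
      have xs: "os[i := x] \<in> prod_V gs" using prod_V_update[OF os] F.E_in[OF xy] by blast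
      have n: "os[i := x] ! i = x" using i prod_V_length[OF os] by simp
      have "prod_E gs (os[i := x]) (os[i := x, i := y])" using prod_E_update[OF xs i, of y] n xy by simp
      then have "2 + real (P.tri (os[i := x]) (os[i := x, i := y])) = c"
        using c[unfolded P.constant_curvature_iff] by blast
      then show "2 + real (F.tri x y) = c" using prod_tri[OF xs i, of y] n xy by simp
    qed
  next
    assume c: "\<forall>i<length gs. constant_curvature (fst (gs ! i)) (snd (gs ! i)) c"
    show "constant_curvature (prod_V gs) (prod_E gs) c" unfolding P.constant_curvature_iff
    proof (intro allI impI)
      fix xs ys assume "prod_E gs xs ys"
      then obtain i v where i: "xs \<in> prod_V gs" "i < length gs" "snd (gs ! i) (xs ! i) v" "ys = xs[i := v]"
        using prod_E_iff by blast
      interpret F: rgraph "fst (gs ! i)" "snd (gs ! i)" by (rule factor[OF i(2)])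
      have "2 + real (F.tri (xs ! i) v) = c" using c i F.constant_curvature_iff by blast
      then show "2 + real (P.tri xs ys) = c" using prod_tri[OF i(1-3)] i(4) by simp
    qed
  qed
qed

end

lemma prod_single:
  assumes "simple_graph W F" shows "graph_iso (prod_V [(W, F)]) (prod_E [(W, F)]) W F"
  unfolding graph_iso_def
proof (intro exI[of _ hd] conjI ballI)
  have P: "prod_V [(W, F)] = (\<lambda>w. [w]) ` W"
    unfolding prod_V_def by (auto simp: length_Suc_conv image_def)
  show "bij_betw hd (prod_V [(W, F)]) W"
    unfolding P bij_betw_def by (auto simp: inj_on_def image_def)
  fix xs ys assume "xs \<in> prod_V [(W, F)]" "ys \<in> prod_V [(W, F)]"
  then show "prod_E [(W, F)] xs ys = F (hd xs) (hd ys)"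
    unfolding prod_E_def P by (auto simp: image_def)
qed

subsection \<open>Graphs embedded in Euclidean space\<close>

text \<open>When squared distances are \<open>2 * s\<close> times graph distances, the orthogonal
  reflection in an edge satisfies the mirror formula. It remains to see that the reflected point
  belongs to the configuration, and \<open>trans\<close> asks this for the side of \<open>x\<close>
  only; the other side is the same edge reversed.\<close>

lemma rgraph_embed:
  fixes \<delta> :: "'a \<Rightarrow> 'a \<Rightarrow> nat" and e :: "'a \<Rightarrow> 'i \<Rightarrow> int"
  assumes sg: "simple_graph V E" and s: "s > 0"
    and norm: "\<And>x y. x \<in> V \<Longrightarrow> y \<in> V \<Longrightarrow> (\<Sum>m\<in>I. (e x m - e y m)^2) = 2 * s * int (\<delta> x y)"
    and edge: "\<And>x y. E x y \<Longrightarrow> \<delta> x y = 1"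
    and lip: "\<And>x y z. x \<in> V \<Longrightarrow> E y z \<Longrightarrow> \<delta> x z \<le> \<delta> x y + 1"
    and step: "\<And>x y. x \<in> V \<Longrightarrow> y \<in> V \<Longrightarrow> x \<noteq> y \<Longrightarrow> \<exists>u\<in>V. E u y \<and> \<delta> x y = \<delta> x u + 1"
    and trans: "\<And>x y w. E x y \<Longrightarrow> w \<in> V \<Longrightarrow> \<delta> w y = \<delta> w x + 1 \<Longrightarrow> \<exists>w'\<in>V. \<forall>m\<in>I. e w' m = e w m + e y m - e x m"
  shows "rgraph V E" and "\<And>x y. x \<in> V \<Longrightarrow> y \<in> V \<Longrightarrow> gdist V E x y = \<delta> x y"
proof -
  have Ein: "x \<in> V \<and> y \<in> V \<and> E y x" if "E x y" for x y using sg that unfolding simple_graph_def by blast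
  \<comment> \<open>After summation over the coordinates every square on the right is a distance;
    \<open>t\<close> stands for the displacement of \<open>w\<close>.\<close>
  have polar: "(a - (b + t * (q - p)))^2 = (a - b)^2 - t * ((a - p)^2 - (a - q)^2 - (b - p)^2 + (b - q)^2) + t^2 * (q - p)^2"
    for a b t p q :: int by algebra
  have refl: "\<delta> x x = 0" if "x \<in> V" for x using norm[OF that that] s by simp
  have mir: "\<exists>\<phi>. \<forall>w\<in>V. \<phi> w \<in> V \<and> (\<forall>z\<in>V.
      int (\<delta> z (\<phi> w)) = int (\<delta> z w) + (int (\<delta> w y) - int (\<delta> w x)) * (int (\<delta> z y) - int (\<delta> z x)))"
    if E: "E x y" for x y
  proof -
    have xy: "x \<in> V" "y \<in> V" "E y x" using Ein[OF E] by auto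
    have "\<exists>w'\<in>V. \<forall>z\<in>V. int (\<delta> z w') = int (\<delta> z w) + (int (\<delta> w y) - int (\<delta> w x)) * (int (\<delta> z y) - int (\<delta> z x))"
      if w: "w \<in> V" for w
    proof -
      let ?\<epsilon> = "int (\<delta> w y) - int (\<delta> w x)"
      have "?\<epsilon> = 1 \<or> ?\<epsilon> = 0 \<or> ?\<epsilon> = -1" using lip[OF w E] lip[OF w xy(3)] by linarith
      moreover have "\<exists>w'\<in>V. \<forall>m\<in>I. e w' m = e w m + ?\<epsilon> * (e y m - e x m)" if one: "?\<epsilon> = 1"
      proof -
        have "\<delta> w y = \<delta> w x + 1" using one by linarith
        from trans[OF E w this] show ?thesis unfolding one by (simp add: algebra_simps)
      qed
      moreover have "\<exists>w'\<in>V. \<forall>m\<in>I. e w' m = e w m + ?\<epsilon> * (e y m - e x m)" if one: "?\<epsilon> = -1"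
      proof -
        have "\<delta> w x = \<delta> w y + 1" using one by linarith
        from trans[OF xy(3) w this] show ?thesis unfolding one by (simp add: algebra_simps)
      qed
      ultimately have "\<exists>w'\<in>V. \<forall>m\<in>I. e w' m = e w m + ?\<epsilon> * (e y m - e x m)" using w by fastforce
      then obtain w' where w': "w' \<in> V" "\<And>m. m \<in> I \<Longrightarrow> e w' m = e w m + ?\<epsilon> * (e y m - e x m)" by blast
      have "int (\<delta> z w') = int (\<delta> z w) + ?\<epsilon> * (int (\<delta> z y) - int (\<delta> z x))" if z: "z \<in> V" for z
      proof -
        have "2 * s * int (\<delta> z w') = (\<Sum>m\<in>I. (e z m - e w' m)^2)" using norm[OF z w'(1)] by (rule sym)
        also have "\<dots> = (\<Sum>m\<in>I. (e z m - e w m)^2 - ?\<epsilon> * ((e z m - e x m)^2 - (e z m - e y m)^2 - (e w m - e x m)^2 + (e w m - e y m)^2)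
            + ?\<epsilon>^2 * (e y m - e x m)^2)"
        proof (rule sum.cong[OF HOL.refl])
          fix m assume "m \<in> I"
          show "(e z m - e w' m)^2 = (e z m - e w m)^2 - ?\<epsilon> * ((e z m - e x m)^2 - (e z m - e y m)^2 - (e w m - e x m)^2 + (e w m - e y m)^2)
            + ?\<epsilon>^2 * (e y m - e x m)^2"
            unfolding w'(2)[OF \<open>m \<in> I\<close>] by (rule polar)
        qed
        also have "\<dots> = 2 * s * int (\<delta> z w) - ?\<epsilon> * (2 * s * int (\<delta> z x) - 2 * s * int (\<delta> z y) - 2 * s * int (\<delta> w x) + 2 * s * int (\<delta> w y))
            + ?\<epsilon>^2 * (2 * s * int (\<delta> y x))"
          using norm z w xy by (simp add: sum.distrib sum_subtractf sum_distrib_left[symmetric])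
        \<comment> \<open>The terms quadratic in the displacement cancel because the edge has length
          one.\<close>
        also have "\<dots> = 2 * s * (int (\<delta> z w) + ?\<epsilon> * (int (\<delta> z y) - int (\<delta> z x)))"
          using edge[OF xy(3)] by (simp add: power2_eq_square algebra_simps)
        finally show ?thesis using s by simp
      qed
      then show ?thesis using w' by blast
    qed
    then show ?thesis by metis
  qed
  note f = rgraphI[of V E \<delta>, OF sg refl lip step mir]
  show "rgraph V E" by (rule f(1))
  show "gdist V E x y = \<delta> x y" if "x \<in> V" "y \<in> V" for x y using f(2) that by simp
qed

subsection \<open>Johnson graphs and halved cubes\<close>

lemma sum_indicator: "A \<subseteq> {..<n::nat} \<Longrightarrow> (\<Sum>m<n. if m \<in> A then 1 else 0 :: int) = int (card A)"
  using sum.inter_restrict[of "{..<n}" "\<lambda>_. 1::int" A] by (simp add: Int_absorb1)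

lemma sum_indicator_diff:
  fixes n :: nat
  assumes "A \<subseteq> {..<n}" "B \<subseteq> {..<n}"
  shows "(\<Sum>m<n. ((if m \<in> A then 1 else 0) - (if m \<in> B then 1 else 0 :: int))^2) = int (card (A - B)) + int (card (B - A))"
proof -
  have "(\<Sum>m<n. ((if m \<in> A then 1 else 0) - (if m \<in> B then 1 else 0 :: int))^2)
      = (\<Sum>m<n. (if m \<in> A - B then 1 else 0) + (if m \<in> B - A then 1 else 0))"
    by (intro sum.cong) auto
  moreover have "A - B \<subseteq> {..<n}" "B - A \<subseteq> {..<n}" using assms by auto
  ultimately show ?thesis by (simp only: sum.distrib sum_indicator)
qed

lemma johnson_fin: "A \<in> johnson_V n k \<Longrightarrow> finite A"
  unfolding johnson_V_def using finite_subset[of A "{..<n}"] by auto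

lemma johnson_simple: "simple_graph (johnson_V n k) (johnson_E n k)"
proof -
  have "finite (johnson_V n k)" unfolding johnson_V_def by (rule finite_subset[of _ "Pow {..<n}"]) auto
  then show ?thesis unfolding simple_graph_def johnson_E_def by (auto simp: Int_commute)
qed

lemma johnson_swap:
  assumes A: "A \<in> johnson_V n k" and a: "a \<in> A" and b: "b \<notin> A" "b < n"
  shows "insert b (A - {a}) \<in> johnson_V n k" "johnson_E n k A (insert b (A - {a}))"
proof -
  have fin: "finite A" by (rule johnson_fin[OF A])
  have c: "card (A - {a}) + 1 = k" using A a fin card_Suc_Diff1[OF fin a] by (simp add: johnson_V_def)
  then show V: "insert b (A - {a}) \<in> johnson_V n k" using A b fin by (auto simp: johnson_V_def)
  have "A \<inter> insert b (A - {a}) = A - {a}" using b by auto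
  then show "johnson_E n k A (insert b (A - {a}))" unfolding johnson_E_def using A V c b by auto
qed

lemma johnson_card_diff:
  assumes "A \<in> johnson_V n k" "B \<in> johnson_V n k" shows "card (A - B) + card (A \<inter> B) = k" "card (B - A) = card (A - B)"
proof -
  have f: "finite A" "finite B" "card A = k" "card B = k"
    using assms johnson_fin[OF assms(1)] johnson_fin[OF assms(2)] by (simp_all add: johnson_V_def)
  have "card (A - B) + card (A \<inter> B) = card A" if "finite A" for A B :: "nat set"
    using card_Diff_subset_Int[of A B] card_mono[OF that, of "A \<inter> B"] that by simp
  from this[OF f(1), of B] this[OF f(2), of A]
  have "card (A - B) + card (A \<inter> B) = k" "card (B - A) + card (A \<inter> B) = k"
    unfolding f(3,4) Int_commute[of B A] .
  then show "card (A - B) + card (A \<inter> B) = k" "card (B - A) = card (A - B)" by linarith+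
qed

lemma johnson_E_swap:
  assumes "johnson_E n k A B" obtains a b where "a \<in> A" "b \<notin> A" "b < n" "B = insert b (A - {a})"
proof -
  have V: "A \<in> johnson_V n k" "B \<in> johnson_V n k" "card (A \<inter> B) + 1 = k" using assms by (auto simp: johnson_E_def)
  then have "card (A - B) = 1" "card (B - A) = 1" using johnson_card_diff[OF V(1,2)] by auto
  then obtain a b where ab: "A - B = {a}" "B - A = {b}" by (meson card_1_singletonE)
  have "b < n" using V ab by (auto simp: johnson_V_def)
  moreover have "B = insert b (A - {a})" using ab by blast
  ultimately show ?thesis using that ab by blast
qed

text \<open>Characteristic vectors give the embedding. An edge replaces \<open>a\<close> by
  \<open>b\<close>, and its mirror is the transposition of \<open>a\<close> and
  \<open>b\<close>.\<close>

lemma johnson_rgraph: "rgraph (johnson_V n k) (johnson_E n k)"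
  and johnson_gdist: "\<And>A B. A \<in> johnson_V n k \<Longrightarrow> B \<in> johnson_V n k \<Longrightarrow> gdist (johnson_V n k) (johnson_E n k) A B = card (A - B)"
proof -
  let ?V = "johnson_V n k" and ?E = "johnson_E n k"
  let ?e = "\<lambda>A m. if m \<in> A then 1 else 0 :: int"
  have sub: "A \<subseteq> {..<n}" if "A \<in> ?V" for A using that by (auto simp: johnson_V_def)
  have norm: "(\<Sum>m<n. (?e A m - ?e B m)^2) = 2 * 1 * int (card (A - B))" if "A \<in> ?V" "B \<in> ?V" for A B
    using sum_indicator_diff[OF sub sub] that johnson_card_diff(2)[OF that] by simp
  have edge: "card (A - B) = 1" if "?E A B" for A B
    using that johnson_card_diff[of A n k B] by (auto simp: johnson_E_def)
  have lip: "card (X - B) \<le> card (X - A) + 1" if X: "X \<in> ?V" and E: "?E A B" for X A B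
  proof -
    obtain a b where "B = insert b (A - {a})" using johnson_E_swap[OF E] by metis
    then have "X - B \<subseteq> insert a (X - A)" by blast
    then have "card (X - B) \<le> card (insert a (X - A))" using johnson_fin[OF X] by (intro card_mono) auto
    also have "\<dots> \<le> card (X - A) + 1" using card_insert_le_m1[of "card (X - A) + 1"] by (simp add: card_insert_if johnson_fin[OF X])
    finally show ?thesis .
  qed
  have step: "\<exists>U\<in>?V. ?E U B \<and> card (A - B) = card (A - U) + 1" if A: "A \<in> ?V" and B: "B \<in> ?V" and ne: "A \<noteq> B" for A B
  proof -
    have "card (A - B) \<noteq> 0"
    proof
      assume "card (A - B) = 0"
      then have "card (A - B) = 0" "card (B - A) = 0" using johnson_card_diff(2)[OF A B] by simp_all
      then have "A - B = {}" "B - A = {}"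
        using johnson_fin[OF A] johnson_fin[OF B] by (metis card_eq_0_iff finite_Diff)+
      then show False using ne by blast
    qed
    then have "card (B - A) \<noteq> 0" using johnson_card_diff(2)[OF A B] by simp
    then obtain a b where ab: "a \<in> A - B" "b \<in> B - A" using \<open>card (A - B) \<noteq> 0\<close> by (metis card.empty equals0I)
    let ?U = "insert a (B - {b})"
    have "a < n" using ab sub[OF A] by auto
    then have U: "?U \<in> ?V" "?E B ?U" using johnson_swap[OF B, of b a] ab by auto
    have "A - B = insert a (A - ?U)" "a \<notin> A - ?U" using ab by auto
    then have "card (A - B) = card (A - ?U) + 1" using johnson_fin[OF A] by simp
    moreover have "?E ?U B" using U(2) johnson_simple unfolding simple_graph_def by blast
    ultimately show ?thesis using U by blast
  qed
  have trans: "\<exists>W'\<in>?V. \<forall>m\<in>{..<n}. ?e W' m = ?e W m + ?e B m - ?e A m"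
    if E: "?E A B" and W: "W \<in> ?V" and c: "card (W - B) = card (W - A) + 1" for A B W
  proof -
    obtain a b where ab: "a \<in> A" "b \<notin> A" "b < n" "B = insert b (A - {a})" using johnson_E_swap[OF E] by metis
    have fW: "finite W" by (rule johnson_fin[OF W])
    have a: "a \<in> W"
    proof (rule ccontr)
      assume "a \<notin> W"
      then have "W - B \<subseteq> W - A" using ab by auto
      then have "card (W - B) \<le> card (W - A)" using fW by (intro card_mono) auto
      then show False using c by simp
    qed
    have b: "b \<notin> W"
    proof
      assume "b \<in> W"
      then have "insert b (W - B) = insert a (W - A)" "b \<notin> W - B" "a \<notin> W - A" using ab a by auto
      then have "card (W - B) + 1 = card (W - A) + 1" using fW by (metis Suc_eq_plus1 card_insert_disjoint finite_Diff)
      then show False using c by simp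
    qed
    have "insert b (W - {a}) \<in> ?V" using johnson_swap[OF W a b ab(3)] by simp
    then show ?thesis using ab a b by (intro bexI[of _ "insert b (W - {a})"]) auto
  qed
  note f = rgraph_embed[where V="?V" and E="?E" and s=1 and I="{..<n}" and e="?e" and \<delta>="\<lambda>A B. card (A - B)", OF johnson_simple _ norm edge lip step trans]
  show "rgraph ?V ?E" using f(1) by simp
  show "gdist ?V ?E A B = card (A - B)" if "A \<in> ?V" "B \<in> ?V" for A B using f(2) that by simp
qed

lemma card_sd: fixes A B :: "nat set" assumes "finite A" "finite B" shows "card (sym_diff A B) + 2 * card (A \<inter> B) = card A + card B"
proof -
  have "card (A - B) + card (A \<inter> B) = card A" if "finite A" for A B :: "nat set"
    using card_Diff_subset_Int[of A B] card_mono[OF that, of "A \<inter> B"] that by simp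
  from this[OF assms(1), of B] this[OF assms(2), of A]
  have "card (A - B) + card (A \<inter> B) = card A" "card (B - A) + card (A \<inter> B) = card B"
    unfolding Int_commute[of B A] .
  moreover have "card (sym_diff A B) = card (A - B) + card (B - A)" using assms by (intro card_Un_disjoint) auto
  ultimately show ?thesis by linarith
qed

lemma even_sd: fixes A B :: "nat set" assumes "finite A" "finite B" shows "even (card (sym_diff A B)) \<longleftrightarrow> even (card A + card B)"
  using card_sd[OF assms] by (metis even_add even_mult_iff even_numeral)

lemma card_sd_pair:
  fixes A :: "nat set"
  assumes "finite A" "i \<noteq> j"
  shows "card (sym_diff A {i, j}) = (if i \<in> A \<and> j \<in> A then card A - 2 else if i \<notin> A \<and> j \<notin> A then card A + 2 else card A)"
proof -
  have "A \<inter> {i, j} = (if i \<in> A then {i} else {}) \<union> (if j \<in> A then {j} else {})" by auto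
  then show ?thesis using card_sd[OF assms(1), of "{i, j}"] assms(2) by (auto split: if_splits)
qed

lemma halved_fin: "A \<in> halved_V n \<Longrightarrow> finite A"
  unfolding halved_V_def using finite_subset[of A "{..<n}"] by auto

lemma halved_simple: "simple_graph (halved_V n) (halved_E n)"
proof -
  have "finite (halved_V n)" unfolding halved_V_def by (rule finite_subset[of _ "Pow {..<n}"]) auto
  then show ?thesis unfolding simple_graph_def halved_E_def by (auto simp: Un_commute)
qed

lemma halved_flip:
  assumes A: "A \<in> halved_V n" and ij: "i < n" "j < n" "i \<noteq> j"
  shows "sym_diff A {i, j} \<in> halved_V n" "halved_E n A (sym_diff A {i, j})"
proof -
  have "even (card (sym_diff A {i, j}))" using even_sd[OF halved_fin[OF A], of "{i, j}"] A ij by (simp add: halved_V_def)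
  then show V: "sym_diff A {i, j} \<in> halved_V n" using A ij by (auto simp: halved_V_def)
  have "sym_diff A (sym_diff A {i, j}) = {i, j}" by auto
  then show "halved_E n A (sym_diff A {i, j})" unfolding halved_E_def using A V ij by simp
qed

lemma halved_E_flip:
  assumes "halved_E n A B" obtains i j where "i < n" "j < n" "i \<noteq> j" "B = sym_diff A {i, j}"
proof -
  obtain i j where ij: "sym_diff A B = {i, j}" "i \<noteq> j" using assms unfolding halved_E_def by (meson card_2_iff)
  moreover have "i < n" "j < n" using assms ij(1) unfolding halved_E_def halved_V_def by auto
  moreover have "B = sym_diff A {i, j}" using ij(1)[symmetric] by auto
  ultimately show ?thesis using that by blast
qed

lemma halved_even: "A \<in> halved_V n \<Longrightarrow> B \<in> halved_V n \<Longrightarrow> even (card (sym_diff A B))"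
  using even_sd[OF halved_fin halved_fin] by (auto simp: halved_V_def)

text \<open>The squared distance is the Hamming distance, twice the graph distance. An edge flips
  \<open>i\<close> and \<open>j\<close>; its mirror flips both in the sets that agree with one of
  the two ends on both, and fixes the others.\<close>

lemma halved_rgraph: "rgraph (halved_V n) (halved_E n)"
  and halved_gdist: "\<And>A B. A \<in> halved_V n \<Longrightarrow> B \<in> halved_V n \<Longrightarrow> gdist (halved_V n) (halved_E n) A B = card (sym_diff A B) div 2"
proof -
  let ?V = "halved_V n" and ?E = "halved_E n"
  let ?e = "\<lambda>A m. if m \<in> A then 1 else 0 :: int"
  have sub: "A \<subseteq> {..<n}" if "A \<in> ?V" for A using that by (auto simp: halved_V_def)
  have norm: "(\<Sum>m<n. (?e A m - ?e B m)^2) = 2 * 1 * int (card (sym_diff A B) div 2)" if "A \<in> ?V" "B \<in> ?V" for A B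
  proof -
    have "card (sym_diff A B) = card (A - B) + card (B - A)"
      using that halved_fin by (intro card_Un_disjoint) auto
    moreover have "2 * (card (sym_diff A B) div 2) = card (sym_diff A B)" using halved_even[OF that] by simp
    then have "2 * 1 * int (card (sym_diff A B) div 2) = int (card (sym_diff A B))" by linarith
    ultimately show ?thesis using sum_indicator_diff[OF sub sub] that by simp
  qed
  have edge: "card (sym_diff A B) div 2 = 1" if "?E A B" for A B
    using that by (simp add: halved_E_def)
  have flip: "sym_diff X (sym_diff A C) = sym_diff (sym_diff X A) C" for X A C :: "nat set" by auto
  have lip: "card (sym_diff X B) div 2 \<le> card (sym_diff X A) div 2 + 1" if X: "X \<in> ?V" and E: "?E A B" for X A B
  proof -
    obtain i j where ij: "i \<noteq> j" "B = sym_diff A {i, j}" using halved_E_flip[OF E] by metis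
    have "A \<in> ?V" using E by (simp add: halved_E_def)
    then have fin: "finite (sym_diff X A)" using X halved_fin by simp
    have le: "card (sym_diff S {i, j}) \<le> card S + 2" if "finite S" for S using card_sd_pair[OF that ij(1)] by auto
    have "card (sym_diff (sym_diff X A) {i, j}) \<le> card (sym_diff X A) + 2" by (rule le[OF fin])
    then show ?thesis unfolding ij(2) flip by linarith
  qed
  have step: "\<exists>U\<in>?V. ?E U B \<and> card (sym_diff A B) div 2 = card (sym_diff A U) div 2 + 1" if A: "A \<in> ?V" and B: "B \<in> ?V" and ne: "A \<noteq> B" for A B
  proof -
    have fin: "finite (sym_diff A B)" using A B halved_fin by simp
    have "card (sym_diff A B) \<noteq> 0" using fin ne by auto
    then have "2 \<le> card (sym_diff A B)" using halved_even[OF A B] by presburger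
    then obtain T where "T \<subseteq> sym_diff A B" "card T = 2" by (meson obtain_subset_with_card_n)
    then obtain i j where ij: "i \<in> sym_diff A B" "j \<in> sym_diff A B" "i \<noteq> j" by (metis card_2_iff insert_subset)
    have n: "i < n" "j < n" using ij sub[OF A] sub[OF B] by auto
    let ?U = "sym_diff B {i, j}"
    have U: "?U \<in> ?V" "?E B ?U" using halved_flip[OF B n ij(3)] by auto
    have "card (sym_diff A ?U) = card (sym_diff A B) - 2" unfolding flip using card_sd_pair[OF fin ij(3)] ij by simp
    then have "card (sym_diff A B) div 2 = card (sym_diff A ?U) div 2 + 1" using \<open>2 \<le> card (sym_diff A B)\<close> by linarith
    moreover have "?E ?U B" using U(2) halved_simple unfolding simple_graph_def by blast
    ultimately show ?thesis using U by blast
  qed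
  have trans: "\<exists>W'\<in>?V. \<forall>m\<in>{..<n}. ?e W' m = ?e W m + ?e B m - ?e A m"
    if E: "?E A B" and W: "W \<in> ?V" and c: "card (sym_diff W B) div 2 = card (sym_diff W A) div 2 + 1" for A B W
  proof -
    obtain i j where ij: "i < n" "j < n" "i \<noteq> j" "B = sym_diff A {i, j}" using halved_E_flip[OF E] by metis
    have A: "A \<in> ?V" using E by (simp add: halved_E_def)
    have fin: "finite (sym_diff W A)" using A W halved_fin by simp
    have "i \<notin> sym_diff W A \<and> j \<notin> sym_diff W A"
      using c card_sd_pair[OF fin ij(3)] unfolding ij(4) flip by (auto split: if_splits)
    moreover have "sym_diff W {i, j} \<in> ?V" using halved_flip[OF W ij(1-3)] by simp
    ultimately show ?thesis using ij by (intro bexI[of _ "sym_diff W {i, j}"]) auto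
  qed
  note f = rgraph_embed[where V="?V" and E="?E" and s=1 and I="{..<n}" and e="?e" and \<delta>="\<lambda>A B. card (sym_diff A B) div 2", OF halved_simple _ norm edge lip step trans]
  show "rgraph ?V ?E" using f(1) by simp
  show "gdist ?V ?E A B = card (sym_diff A B) div 2" if "A \<in> ?V" "B \<in> ?V" for A B using f(2) that by simp
qed

subsection \<open>Cocktail party graphs\<close>

definition cp_E :: "nat \<Rightarrow> nat \<Rightarrow> nat \<Rightarrow> bool" where
  "cp_E k i j \<longleftrightarrow> i < 2 * k \<and> j < 2 * k \<and> i div 2 \<noteq> j div 2"

lemma cp_simple: "simple_graph {..<2 * k} (cp_E k)"
  by (auto simp: simple_graph_def cp_E_def)

lemma cocktail_iso: "graph_iso (cocktail_V k) cocktail_E {..<2 * k} (cp_E k)"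
proof (rule graph_iso_sym)
  have "cocktail_V k = (\<lambda>i. {i}) ` {..<2 * k}" by (auto simp: cocktail_V_def)
  then have "bij_betw (\<lambda>i. {i}) {..<2 * k} (cocktail_V k)" by (auto simp: bij_betw_def)
  then show "graph_iso {..<2 * k} (cp_E k) (cocktail_V k) cocktail_E"
    unfolding graph_iso_def cocktail_E_def cp_E_def by (intro exI[of _ "\<lambda>i. {i}"]) auto
qed

text \<open>The vertices are the signed unit vectors of the cross-polytope in dimension
  \<open>k\<close>, with \<open>2 * a\<close> and \<open>2 * a + 1\<close> antipodal.\<close>

lemma cp_rgraph:
  assumes "k \<ge> 2" shows "rgraph {..<2 * k} (cp_E k)"
proof -
  let ?V = "{..<2 * k}" and ?E = "cp_E k"
  let ?s = "\<lambda>i. if even i then 1 else -1 :: int"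
  let ?e = "\<lambda>i m. if m = i div 2 then ?s i else 0"
  let ?\<delta> = "\<lambda>i j. if i = j then 0 else if i div 2 = j div 2 then 2 else 1 :: nat"
  have par: "i = j" if "i div 2 = j div 2" "even i = even j" for i j :: nat using that by (metis div_mult_mod_eq even_iff_mod_2_eq_zero not_mod_2_eq_1_eq_0)
  have norm: "(\<Sum>m<k. (?e i m - ?e j m)^2) = 2 * 1 * int (?\<delta> i j)" if "i \<in> ?V" "j \<in> ?V" for i j
  proof -
    have k: "i div 2 < k" "j div 2 < k" using that by auto
    have "(\<Sum>m<k. (?e i m - ?e j m)^2) = (\<Sum>m<k. (if m = i div 2 then 1 else 0) + (if m = j div 2 then 1 else 0)
        - (if m = i div 2 then 2 * (if i div 2 = j div 2 then ?s i * ?s j else 0) else 0))"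
      by (intro sum.cong refl) (auto simp: power2_eq_square)
    also have "\<dots> = 2 - 2 * (if i div 2 = j div 2 then ?s i * ?s j else 0)"
      using k by (simp add: sum.distrib sum_subtractf)
    also have "\<dots> = 2 * 1 * int (?\<delta> i j)" using par[of i j] by auto
    finally show ?thesis .
  qed
  have trans: "\<exists>w'\<in>?V. \<forall>m\<in>{..<k}. ?e w' m = ?e w m + ?e y m - ?e x m"
    if E: "?E x y" and w: "w \<in> ?V" and c: "?\<delta> w y = ?\<delta> w x + 1" for x y w
  proof (cases "w = x")
    case True
    then show ?thesis using E by (intro bexI[of _ y]) (auto simp: cp_E_def)
  next
    case False
    then have wy: "w \<noteq> y" "w div 2 = y div 2" "w div 2 \<noteq> x div 2" using c by (auto split: if_splits)
    then have s: "?s w = - ?s y" using par[of w y] by auto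
    \<comment> \<open>Here \<open>w\<close> is the antipode of \<open>y\<close>, so translating it
      by \<open>y - x\<close> yields the antipode of \<open>x\<close>.\<close>
    let ?w = "if even x then x + 1 else x - 1"
    have "x = 2 * (x div 2) + (if even x then 0 else 1)" "x div 2 < k" using E by (auto simp: cp_E_def)
    then have "?w div 2 = x div 2" "even ?w \<longleftrightarrow> odd x" "?w < 2 * k" by (auto elim!: evenE oddE)
    then show ?thesis using wy s by (intro bexI[of _ ?w]) auto
  qed
  have step: "\<exists>u\<in>?V. ?E u j \<and> ?\<delta> i j = ?\<delta> i u + 1" if ij: "i \<in> ?V" "j \<in> ?V" "i \<noteq> j" for i j
  proof (cases "i div 2 = j div 2")
    case True
    define u where "u = (if i div 2 = 0 then 2 else 0 :: nat)"
    have "u div 2 \<noteq> i div 2" "u < 2 * k" using assms by (auto simp: u_def)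
    then show ?thesis using True ij by (intro bexI[of _ u]) (auto simp: cp_E_def)
  qed (use ij in \<open>intro bexI[of _ i]; auto simp: cp_E_def\<close>)
  show ?thesis
    by (rule rgraph_embed(1)[where V="?V" and E="?E" and s=1 and I="{..<k}" and e="?e" and \<delta>="?\<delta>", OF cp_simple _ norm _ _ step trans])
      (auto simp: cp_E_def)
qed

text \<open>The 4-cycle has disconnected neighbourhoods, so \<open>constant_if_local\<close> does
  not apply; it has no triangles, whence the value 2.\<close>

lemma cp_constant_two: "constant_curvature {..<2 * 2} (cp_E 2) 2"
proof -
  interpret rgraph "{..<2 * 2}" "cp_E 2" by (rule cp_rgraph) simp
  have no: "\<not> (cp_E 2 x z \<and> cp_E 2 y z)" if "cp_E 2 x y" for x y z
  proof
    assume "cp_E 2 x z \<and> cp_E 2 y z"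
    then have "x div 2 < 2" "y div 2 < 2" "z div 2 < 2" "x div 2 \<noteq> y div 2" "x div 2 \<noteq> z div 2" "y div 2 \<noteq> z div 2"
      using that by (auto simp: cp_E_def)
    then show False by linarith
  qed
  show ?thesis unfolding constant_curvature_iff
  proof (intro allI impI)
    fix x y assume "cp_E 2 x y"
    then have "{z \<in> {..<2 * 2}. cp_E 2 x z \<and> cp_E 2 y z} = {}" using no by blast
    then show "2 + real (tri x y) = 2" by (simp only: card.empty)
  qed
qed

subsection \<open>The Gosset graph\<close>

definition gV :: "(bool \<times> nat set) set" where "gV = UNIV \<times> johnson_V 8 2"
definition gE :: "bool \<times> nat set \<Rightarrow> bool \<times> nat set \<Rightarrow> bool" where
  "gE x y \<longleftrightarrow> x \<in> gV \<and> y \<in> gV \<and>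
    (fst x = fst y \<and> card (snd x \<inter> snd y) = 1 \<or> fst x \<noteq> fst y \<and> snd x \<inter> snd y = {})"

definition gdel :: "bool \<times> nat set \<Rightarrow> bool \<times> nat set \<Rightarrow> nat" where
  "gdel x y = (if fst x = fst y then 2 - card (snd x \<inter> snd y) else 1 + card (snd x \<inter> snd y))"

text \<open>The vectors (3,3,-1,-1,-1,-1,-1,-1) up to permutation and sign, \<open>True\<close>
  being the negative sign. Edges have squared length 32, which is the origin of the scale
  16.\<close>

definition gvec :: "bool \<times> nat set \<Rightarrow> nat \<Rightarrow> int" where
  "gvec x m = (if fst x then -1 else 1) * (4 * (if m \<in> snd x then 1 else 0) - 1)"

lemma J82: "P \<in> johnson_V 8 2 \<longleftrightarrow> (\<exists>a b. P = {a, b} \<and> a \<noteq> b \<and> a < 8 \<and> b < 8)"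
  unfolding johnson_V_def by (auto simp: card_2_iff)

lemma J82_fin: "P \<in> johnson_V 8 2 \<Longrightarrow> finite P \<and> card P = 2 \<and> P \<subseteq> {..<8}"
  using johnson_fin[of P 8 2] by (simp add: johnson_V_def)

lemma J82_Int: "P \<in> johnson_V 8 2 \<Longrightarrow> card (P \<inter> Q) \<le> 2"
  using J82_fin[of P] card_mono[of P "P \<inter> Q"] by auto

lemma gE_simple: "simple_graph gV gE"
proof -
  have "finite gV" unfolding gV_def using johnson_simple by (simp add: simple_graph_def)
  moreover have "\<not> gE x x" for x using J82_fin by (auto simp: gE_def gV_def)
  ultimately show ?thesis by (auto simp: simple_graph_def gE_def Int_commute)
qed

lemma gdel_edge: "gE x y \<Longrightarrow> gdel x y = 1"
  by (auto simp: gE_def gdel_def)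

lemma gvec_norm:
  assumes "x \<in> gV" "y \<in> gV" shows "(\<Sum>m<8. (gvec x m - gvec y m)^2) = 2 * 16 * int (gdel x y)"
proof -
  obtain s P t Q where xy: "x = (s, P)" "y = (t, Q)" by (metis surj_pair)
  have PQ: "P \<in> johnson_V 8 2" "Q \<in> johnson_V 8 2" using assms xy by (auto simp: gV_def)
  note sub = J82_fin[OF PQ(1)] J82_fin[OF PQ(2)]
  show ?thesis
  proof (cases "s = t")
    case True
    have "(\<Sum>m<8. (gvec x m - gvec y m)^2) = (\<Sum>m<8. 16 * ((if m \<in> P then 1 else 0) - (if m \<in> Q then 1 else 0 :: int))^2)"
      unfolding gvec_def xy True by (intro sum.cong refl) (auto simp: power2_eq_square)
    also have "\<dots> = 16 * (int (card (P - Q)) + int (card (Q - P)))"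
      using sum_indicator_diff[of P 8 Q] sub by (simp add: sum_distrib_left[symmetric])
    also have "\<dots> = 32 * int (card (P - Q))" using johnson_card_diff(2)[OF PQ] by simp
    also have "card (P - Q) = 2 - card (P \<inter> Q)" using johnson_card_diff(1)[OF PQ] by simp
    finally show ?thesis by (simp add: gdel_def xy True)
  next
    case False
    have "(\<Sum>m<8. (gvec x m - gvec y m)^2) = (\<Sum>m<8. 4 + 32 * (if m \<in> P \<inter> Q then 1 else 0 :: int))"
      unfolding gvec_def xy using False by (intro sum.cong refl) (auto simp: power2_eq_square)
    also have "\<dots> = 32 + 32 * (\<Sum>m<8. if m \<in> P \<inter> Q then 1 else 0 :: int)"
      by (simp only: sum.distrib sum_distrib_left[symmetric]) simp
    also have "(\<Sum>m<8. if m \<in> P \<inter> Q then 1 else 0 :: int) = int (card (P \<inter> Q))"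
      using sub by (intro sum_indicator) auto
    finally show ?thesis using False by (simp add: gdel_def xy)
  qed
qed

lemma gdel_lip:
  assumes x: "x \<in> gV" and E: "gE y z" shows "gdel x z \<le> gdel x y + 1"
proof -
  obtain r P s Q t R where xyz: "x = (r, P)" "y = (s, Q)" "z = (t, R)" by (metis surj_pair)
  have J: "P \<in> johnson_V 8 2" "Q \<in> johnson_V 8 2" "R \<in> johnson_V 8 2" using assms xyz by (auto simp: gV_def gE_def)
  note f = J82_fin[OF J(1)] J82_fin[OF J(2)] J82_fin[OF J(3)]
  have le: "card (P \<inter> Q) \<le> 2" "card (P \<inter> R) \<le> 2" using J82_Int[OF J(1)] by auto
  have near: "card (P \<inter> A) \<le> card (P \<inter> B) + 1" if "A \<in> johnson_V 8 2" "B \<in> johnson_V 8 2" "card (A \<inter> B) = 1" for A B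
  proof -
    have "card (A - B) = 1" using johnson_card_diff(1)[OF that(1,2)] that(3) by simp
    then obtain a where a: "A - B = {a}" by (meson card_1_singletonE)
    then have "P \<inter> A \<subseteq> insert a (P \<inter> B)" by blast
    then have "card (P \<inter> A) \<le> card (insert a (P \<inter> B))" using f by (intro card_mono) auto
    also have "\<dots> \<le> card (P \<inter> B) + 1" using f by (simp add: card_insert_if)
    finally show ?thesis .
  qed
  show ?thesis
  proof (cases "s = t")
    case True
    then have "card (Q \<inter> R) = 1" "card (R \<inter> Q) = 1" using E xyz by (auto simp: gE_def Int_commute)
    then show ?thesis using near[OF J(2,3)] near[OF J(3,2)] le by (auto simp: gdel_def xyz True)
  next
    case False
    then have "Q \<inter> R = {}" using E xyz by (auto simp: gE_def)
    then have "card (P \<inter> Q) + card (P \<inter> R) = card (P \<inter> Q \<union> P \<inter> R)" using f by (intro card_Un_disjoint[symmetric]) auto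
    also have "\<dots> \<le> card P" using f by (intro card_mono) auto
    finally show ?thesis using f False le by (auto simp: gdel_def xyz)
  qed
qed

lemma gdel_step:
  assumes x: "x \<in> gV" and y: "y \<in> gV" and ne: "x \<noteq> y"
  shows "\<exists>u\<in>gV. gE u y \<and> gdel x y = gdel x u + 1"
proof -
  obtain s P t Q where xy: "x = (s, P)" "y = (t, Q)" by (metis surj_pair)
  have J: "P \<in> johnson_V 8 2" "Q \<in> johnson_V 8 2" using x y xy by (auto simp: gV_def)
  note f = J82_fin[OF J(1)] J82_fin[OF J(2)]
  have le: "card (P \<inter> Q) \<le> 2" using J82_Int[OF J(1)] by auto
  have selfx: "gdel x x = 0" using f by (simp add: gdel_def xy)
  consider "gE x y" | "s = t" "card (P \<inter> Q) \<noteq> 1" | "s \<noteq> t" "P \<inter> Q \<noteq> {}"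
    using x y by (auto simp: gE_def xy)
  then show ?thesis
  proof cases
    case 1
    then show ?thesis using selfx gdel_edge[OF 1] x by (intro bexI[of _ x]) auto
  next
    case 2
    have "card (P \<inter> Q) \<noteq> 2"
    proof
      assume "card (P \<inter> Q) = 2"
      then have "P \<inter> Q = P" "P \<inter> Q = Q" using f by (intro card_subset_eq; simp)+
      then show False using ne xy 2 by simp
    qed
    then have "card (P \<inter> Q) = 0" using 2 le by linarith
    then have e: "P \<inter> Q = {}" using f by simp
    obtain p p' q q' where pq: "P = {p, p'}" "Q = {q, q'}" "p \<noteq> p'" "q \<noteq> q'" "p < 8" "q < 8" using J J82 by metis
    let ?R = "{p, q}"
    have R: "?R \<inter> Q = {q}" "P \<inter> ?R = {p}" using e pq by auto
    have "?R \<in> johnson_V 8 2" using e pq by (auto simp: johnson_V_def)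
    then have "gE (s, ?R) y" "(s, ?R) \<in> gV" using R y 2 by (auto simp: gE_def gV_def xy)
    moreover have "gdel x (s, ?R) = 1" "gdel x y = 2" using R e 2 by (auto simp: gdel_def xy)
    ultimately show ?thesis by (intro bexI[of _ "(s, ?R)"]) auto
  next
    case 3
    then obtain a where a: "a \<in> P" "a \<in> Q" by blast
    then obtain q where q: "Q = {a, q}" "q \<noteq> a" "q < 8" using J82 J(2) by (metis doubleton_eq_iff insertE singletonD)
    have "card (P \<union> Q) \<le> 4" using card_Un_le[of P Q] f by simp
    then have "card ({..<8} - (P \<union> Q)) \<noteq> 0" using f by (subst card_Diff_subset) auto
    then obtain m where m: "m < 8" "m \<notin> P" "m \<notin> Q" by (metis (no_types, lifting) Diff_iff UnCI card.empty ex_in_conv lessThan_iff)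
    let ?R = "{q, m}"
    have R: "?R \<inter> Q = {q}" "P \<inter> Q = insert a (P \<inter> ?R)" "a \<notin> P \<inter> ?R" using q m a by auto
    have "?R \<in> johnson_V 8 2" using m q by (auto simp: johnson_V_def)
    then have "gE (t, ?R) y" "(t, ?R) \<in> gV" using R(1) y by (auto simp: gE_def gV_def xy)
    moreover have "card (P \<inter> Q) = card (P \<inter> ?R) + 1" using R(2,3) f by simp
    then have "gdel x y = gdel x (t, ?R) + 1" using 3 by (simp add: gdel_def xy)
    ultimately show ?thesis by (intro bexI[of _ "(t, ?R)"]) auto
  qed
qed

text \<open>If \<open>x\<close> and \<open>y\<close> have the same sign, the difference is supported
  on two positions and the image of \<open>w\<close> exchanges them. If the signs differ,
  \<open>w\<close> changes sign, and its pair is complemented within \<open>P \<union> Q\<close> or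
  within the rest of the eight positions.\<close>

lemma gvec_trans:
  assumes E: "gE x y" and w: "w \<in> gV" and c: "gdel w y = gdel w x + 1"
  shows "\<exists>w'\<in>gV. \<forall>m\<in>{..<8}. gvec w' m = gvec w m + gvec y m - gvec x m"
proof -
  obtain s P t Q r R where xyw: "x = (s, P)" "y = (t, Q)" "w = (r, R)" by (metis surj_pair)
  have J: "P \<in> johnson_V 8 2" "Q \<in> johnson_V 8 2" "R \<in> johnson_V 8 2" using assms xyw by (auto simp: gV_def gE_def)
  note f = J82_fin[OF J(1)] J82_fin[OF J(2)] J82_fin[OF J(3)]
  have le: "card (R \<inter> Q) \<le> 2" "card (R \<inter> P) \<le> 2" using J82_Int[OF J(3)] by auto
  show ?thesis
  proof (cases "s = t")
    case True
    have "card (P \<inter> Q) = 1" using E xyw True by (simp add: gE_def)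
    then have "johnson_E 8 2 P Q" using J f by (auto simp: johnson_E_def)
    then obtain p q where pq: "p \<in> P" "q \<notin> P" "q < 8" "Q = insert q (P - {p})" by (rule johnson_E_swap)
    have cards: "card (R \<inter> P) = card (R \<inter> (P - {p})) + (if p \<in> R then 1 else 0)"
      "card (R \<inter> Q) = card (R \<inter> (P - {p})) + (if q \<in> R then 1 else 0)"
    proof -
      have "R \<inter> P = (if p \<in> R then {p} else {}) \<union> (R \<inter> (P - {p}))" "R \<inter> Q = (if q \<in> R then {q} else {}) \<union> (R \<inter> (P - {p}))"
        using pq by auto
      then show "card (R \<inter> P) = card (R \<inter> (P - {p})) + (if p \<in> R then 1 else 0)"
        "card (R \<inter> Q) = card (R \<inter> (P - {p})) + (if q \<in> R then 1 else 0)"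
        using f pq by auto
    qed
    show ?thesis
    proof (cases "r = s")
      case rs: True
      have "card (R \<inter> P) = card (R \<inter> Q) + 1" using c le by (simp add: gdel_def xyw rs True)
      then have *: "p \<in> R" "q \<notin> R" using cards by (auto split: if_splits)
      then have "insert q (R - {p}) \<in> johnson_V 8 2" using johnson_swap(1)[OF J(3) _ _ pq(3)] by blast
      then show ?thesis using pq * by (intro bexI[of _ "(r, insert q (R - {p}))"]) (auto simp: gvec_def xyw rs True gV_def)
    next
      case rs: False
      have "card (R \<inter> Q) = card (R \<inter> P) + 1" using c rs by (simp add: gdel_def xyw True[symmetric])
      then have *: "p \<notin> R" "q \<in> R" using cards by (auto split: if_splits)
      have "p < 8" using pq f by auto
      then have "insert p (R - {q}) \<in> johnson_V 8 2" using johnson_swap(1)[OF J(3)] * by blast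
      then show ?thesis using pq * rs by (intro bexI[of _ "(r, insert p (R - {q}))"]) (auto simp: gvec_def xyw True[symmetric] gV_def)
    qed
  next
    case False
    \<comment> \<open>Up to sign \<open>y - x\<close> is now -2 on \<open>P \<union> Q\<close> and 2
      elsewhere. The assumption on distances forces \<open>R\<close> into
      \<open>P \<union> Q\<close> when \<open>w\<close> has the sign of \<open>x\<close>, and away
      from it otherwise.\<close>
    have PQ: "P \<inter> Q = {}" using E xyw False by (simp add: gE_def)
    show ?thesis
    proof (cases "r = s")
      case rs: True
      have "card (R \<inter> Q) + card (R \<inter> P) = 2" using c le False by (simp add: gdel_def xyw rs)
      moreover have "card (R \<inter> Q \<union> R \<inter> P) = card (R \<inter> Q) + card (R \<inter> P)" using f PQ by (intro card_Un_disjoint) auto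
      ultimately have "R \<inter> Q \<union> R \<inter> P = R" using f by (intro card_subset_eq) auto
      then have sub: "R \<subseteq> P \<union> Q" by blast
      have "card (P \<union> Q) = 4" using f PQ by (simp add: card_Un_disjoint)
      then have "card (P \<union> Q - R) = 2" using sub f by (simp add: card_Diff_subset)
      then have "P \<union> Q - R \<in> johnson_V 8 2" using f by (auto simp: johnson_V_def)
      then show ?thesis using False PQ sub
        by (intro bexI[of _ "(t, P \<union> Q - R)"]) (auto simp: gvec_def xyw rs gV_def)
    next
      case rs: False
      then have rt: "r = t" using False by blast
      have "card (R \<inter> Q) = 0" "card (R \<inter> P) = 0" using c le False by (auto simp: gdel_def xyw rt)
      then have e: "R \<inter> Q = {}" "R \<inter> P = {}" using f by auto
      let ?R = "{..<8} - (P \<union> Q \<union> R)"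
      have "card (P \<union> Q) = 4" using f PQ by (simp add: card_Un_disjoint)
      moreover have "(P \<union> Q) \<inter> R = {}" using e by blast
      ultimately have "card (P \<union> Q \<union> R) = 6" using f card_Un_disjoint[of "P \<union> Q" R] by simp
      then have "card ?R = 2" using f by (subst card_Diff_subset) auto
      then have "?R \<in> johnson_V 8 2" by (auto simp: johnson_V_def)
      then show ?thesis using False PQ e
        by (intro bexI[of _ "(s, ?R)"]) (auto simp: gvec_def xyw rt gV_def)
    qed
  qed
qed

lemma gE_rgraph: "rgraph gV gE" and gE_gdist: "\<And>x y. x \<in> gV \<Longrightarrow> y \<in> gV \<Longrightarrow> gdist gV gE x y = gdel x y"
proof -
  note f = rgraph_embed[where V=gV and E=gE and s=16 and I="{..<8}" and e=gvec and \<delta>=gdel,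
      OF gE_simple _ gvec_norm gdel_edge gdel_lip gdel_step gvec_trans]
  show "rgraph gV gE" using f(1) by simp
  show "gdist gV gE x y = gdel x y" if "x \<in> gV" "y \<in> gV" for x y using f(2) that by simp
qed

definition gpair :: "nat set \<Rightarrow> bool \<times> nat set" where "gpair A = (8 \<in> A, A \<inter> {..<8})"

lemma gpair_bij: "bij_betw gpair gosset_V gV"
proof (rule bij_betw_byWitness[of _ "\<lambda>(s, P). if s then insert 8 P else P"])
  have l9: "{..<9::nat} = insert 8 {..<8}" by auto
  show "\<forall>a\<in>gosset_V. (case gpair a of (s, P) \<Rightarrow> if s then insert 8 P else P) = a"
    unfolding gosset_V_def gpair_def l9 by auto
  have "P \<inter> {..<8} = P" "8 \<notin> P" "insert 8 P \<inter> {..<8} = P" if "P \<in> johnson_V 8 2" for P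
    using J82_fin[OF that] by auto
  then show "\<forall>a'\<in>gV. gpair (case a' of (s, P) \<Rightarrow> if s then insert 8 P else P) = a'"
    and "(\<lambda>(s, P). if s then insert 8 P else P) ` gV \<subseteq> gosset_V"
    unfolding gV_def gosset_V_def gpair_def l9 by (auto simp: johnson_V_def split: if_splits)
  show "gpair ` gosset_V \<subseteq> gV"
    unfolding gV_def gosset_V_def gpair_def johnson_V_def by auto
qed

lemma gpair_E: "A \<in> gosset_V \<Longrightarrow> B \<in> gosset_V \<Longrightarrow> gosset_E A B \<longleftrightarrow> gE (gpair A) (gpair B)"
proof -
  assume AB: "A \<in> gosset_V" "B \<in> gosset_V"
  then have "gpair A \<in> gV" "gpair B \<in> gV" using gpair_bij by (auto simp: bij_betw_def)
  moreover have "A \<inter> {..<8} \<inter> (B \<inter> {..<8}) = A \<inter> B \<inter> {..<8}" by blast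
  ultimately show "gosset_E A B \<longleftrightarrow> gE (gpair A) (gpair B)"
    using AB unfolding gosset_E_def gE_def by (simp add: gpair_def)
qed

lemma gosset_simple: "simple_graph gosset_V gosset_E"
proof -
  have "finite gosset_V" unfolding gosset_V_def by (rule finite_subset[of _ "Pow {..<9}"]) auto
  moreover have "\<not> gosset_E x x" for x
  proof
    assume "gosset_E x x"
    then have "x \<in> gosset_V" "gE (gpair x) (gpair x)" using gpair_E[of x x] by (auto simp: gosset_E_def)
    then show False using gE_simple unfolding simple_graph_def by blast
  qed
  moreover have "gosset_E y x" if "gosset_E x y" for x y
    using that by (simp add: gosset_E_def Int_commute) (metis Int_commute)
  ultimately show ?thesis unfolding simple_graph_def by (auto simp: gosset_E_def)
qed

lemma gosset_iso: "graph_iso gosset_V gosset_E gV gE"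
  unfolding graph_iso_def using gpair_bij gpair_E by blast

lemma gosset_rgraph: "rgraph gosset_V gosset_E"
  by (rule iso_rgraph[OF gosset_iso gosset_simple gE_rgraph])

subsection \<open>Neighbourhoods in the model graphs\<close>

lemma graph_isoI:
  "bij_betw h V W \<Longrightarrow> (\<And>u v. u \<in> V \<Longrightarrow> v \<in> V \<Longrightarrow> E u v \<longleftrightarrow> F (h u) (h v)) \<Longrightarrow> graph_iso V E W F"
  unfolding graph_iso_def by blast

lemma local_transport:
  assumes h: "bij_betw h V W" "\<And>u v. u \<in> V \<Longrightarrow> v \<in> V \<Longrightarrow> E u v \<longleftrightarrow> F (h u) (h v)" and b: "b \<in> V"
  shows "graph_iso {u \<in> V. E b u} E {u \<in> W. F (h b) u} F"
proof (rule graph_isoI[of h])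
  have "h ` {u \<in> V. E b u} = {u \<in> W. F (h b) u}"
    using h(2)[OF b] h(1) unfolding bij_betw_def by auto
  then show "bij_betw h {u \<in> V. E b u} {u \<in> W. F (h b) u}"
    using h(1) unfolding bij_betw_def by (auto intro: inj_on_subset)
qed (use h in auto)

lemma local_transport_ex:
  assumes "graph_iso V E W F" "b' \<in> W"
  shows "\<exists>b\<in>V. graph_iso {u \<in> V. E b u} E {u \<in> W. F b' u} F"
proof -
  obtain h where h: "bij_betw h V W" "\<forall>u\<in>V. \<forall>v\<in>V. E u v \<longleftrightarrow> F (h u) (h v)" using assms unfolding graph_iso_def by blast
  then have "b' \<in> h ` V" using assms(2) by (simp add: bij_betw_def)
  then obtain b where "b \<in> V" "b' = h b" by blast
  then show ?thesis using local_transport[of h V W E F b] h by blast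
qed

lemma connected_local:
  assumes r: "rgraph W F" and iso: "graph_iso {u \<in> W. F b u} F L LE" and L: "cgraph L LE"
    and u: "F b u" and v: "F b v"
  shows "v \<in> rgraph.comp F b u"
proof -
  interpret rgraph W F by (rule r)
  let ?N = "{u \<in> W. F b u}"
  have sg: "simple_graph ?N (sub ?N)" using simple unfolding simple_graph_def by auto
  have "graph_iso ?N (sub ?N) L LE" using iso unfolding graph_iso_def by auto
  then interpret N: cgraph ?N "sub ?N" using iso_cgraph[OF _ sg L] by blast
  have "v \<in> ?N" "u \<in> ?N" using u v E_in by auto
  then obtain n where n: "walk ?N (sub ?N) n u v" using N.conn unfolding connected_graph_def by blast
  have "walk ?N (sub ?N) n u v \<Longrightarrow> u \<in> comp b u0 \<Longrightarrow> v \<in> comp b u0" for u0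
  proof (induction n arbitrary: u)
    case (Suc n)
    then obtain z where "sub ?N u z" "walk ?N (sub ?N) n z v" by auto
    then show ?case using Suc.IH[of z] comp_step[of u b u0 z] Suc.prems by blast
  qed auto
  then show ?thesis using n comp_self by blast
qed

lemma constant_if_local:
  assumes "rgraph W F" "b \<in> W" "graph_iso {u \<in> W. F b u} F L LE" "cgraph L LE"
  shows "\<exists>c. constant_curvature W F c"
  using rgraph.constant_if_local_connected[OF assms(1,2)] connected_local[OF assms(1,3,4)] by blast

text \<open>The rook's graph, a product of two cliques. It is the neighbourhood of
  \<open>{..<a}\<close> in \<open>J(a + b, a)\<close>: one coordinate names the element removed, the
  other the element inserted.\<close>

definition grid_V :: "nat \<Rightarrow> nat \<Rightarrow> (nat \<times> nat) set" where "grid_V a b = {..<a} \<times> {..<b}"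
definition grid_E :: "nat \<Rightarrow> nat \<Rightarrow> nat \<times> nat \<Rightarrow> nat \<times> nat \<Rightarrow> bool" where
  "grid_E a b x y \<longleftrightarrow> x \<in> grid_V a b \<and> y \<in> grid_V a b \<and> (fst x = fst y) \<noteq> (snd x = snd y)"

lemma grid_cgraph: "cgraph (grid_V a b) (grid_E a b)"
proof
  show sg: "simple_graph (grid_V a b) (grid_E a b)"
    unfolding simple_graph_def grid_E_def by (auto simp: grid_V_def)
  let ?\<delta> = "\<lambda>x y. (if fst x = fst y then 0 else 1) + (if snd x = snd y then 0 else 1 :: nat)"
  have step: "\<exists>u\<in>grid_V a b. grid_E a b u y \<and> ?\<delta> x y = ?\<delta> x u + 1" if "x \<in> grid_V a b" "y \<in> grid_V a b" "x \<noteq> y" for x y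
  proof (cases "fst x = fst y")
    case True
    then show ?thesis using that by (intro bexI[of _ x]) (auto simp: grid_E_def prod_eq_iff)
  next
    case False
    then show ?thesis using that by (intro bexI[of _ "(fst x, snd y)"]) (auto simp: grid_E_def grid_V_def)
  qed
  show "connected_graph (grid_V a b) (grid_E a b)"
    by (rule gdist_eqI(1)[OF sg, of ?\<delta>, OF _ _ step]) (auto simp: grid_E_def)
qed

lemma johnson_E_card:
  "A \<in> johnson_V n k \<Longrightarrow> B \<in> johnson_V n k \<Longrightarrow> johnson_E n k A B \<longleftrightarrow> card (A - B) = 1"
  using johnson_card_diff[of A n k B] johnson_fin[of A n k] by (auto simp: johnson_E_def)

lemma johnson_local:
  fixes a b :: nat
  shows "{..<a} \<in> johnson_V (a + b) a"
    and "graph_iso (grid_V a b) (grid_E a b) {A \<in> johnson_V (a + b) a. johnson_E (a + b) a {..<a} A} (johnson_E (a + b) a)"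
proof -
  show O: "{..<a} \<in> johnson_V (a + b) a" by (auto simp: johnson_V_def)
  let ?N = "{A \<in> johnson_V (a + b) a. johnson_E (a + b) a {..<a} A}"
  define h where "h = (\<lambda>(i, j). insert (a + j) ({..<a} - {i}))"
  have mem: "h (i, j) \<in> ?N" if "i < a" "j < b" for i j
    using johnson_swap[OF O, of i "a + j"] that by (simp add: h_def)
  show "graph_iso (grid_V a b) (grid_E a b) ?N (johnson_E (a + b) a)"
  proof (rule graph_isoI)
    show "bij_betw h (grid_V a b) ?N" unfolding bij_betw_def
    proof
      show "inj_on h (grid_V a b)"
      proof (rule inj_onI, clarify)
        fix i j i' j' assume *: "(i, j) \<in> grid_V a b" "(i', j') \<in> grid_V a b" "h (i, j) = h (i', j')"
        then have "i < a" "i' < a" by (auto simp: grid_V_def)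
        have "a + j \<in> h (i', j')" using *(3)[symmetric] by (simp add: h_def)
        then have "j = j'" by (simp add: h_def)
        moreover have "i \<notin> h (i', j')" using *(3)[symmetric] \<open>i < a\<close> by (simp add: h_def)
        then have "i = i'" using \<open>i < a\<close> by (simp add: h_def)
        ultimately show "i = i' \<and> j = j'" by simp
      qed
      show "h ` grid_V a b = ?N"
      proof (intro equalityI subsetI)
        fix A assume "A \<in> ?N"
        then have "johnson_E (a + b) a {..<a} A" by simp
        then obtain i m where im: "i \<in> {..<a}" "m \<notin> {..<a}" "m < a + b" "A = insert m ({..<a} - {i})" by (rule johnson_E_swap)
        then have "A = h (i, m - a)" "(i, m - a) \<in> grid_V a b" by (auto simp: h_def grid_V_def)
        then show "A \<in> h ` grid_V a b" by blast
      qed (use mem in \<open>auto simp: grid_V_def\<close>)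
    qed
    fix u v assume uv: "u \<in> grid_V a b" "v \<in> grid_V a b"
    obtain i j i' j' where ij: "u = (i, j)" "v = (i', j')" by (metis surj_pair)
    then have lt: "i < a" "j < b" "i' < a" "j' < b" using uv by (auto simp: grid_V_def)
    have "h u - h v = (if j = j' then {} else {a + j}) \<union> (if i = i' then {} else {i'})"
      using lt unfolding ij h_def by auto
    then have "card (h u - h v) = 1 \<longleftrightarrow> (i = i') \<noteq> (j = j')" using lt by auto
    then show "grid_E a b u v \<longleftrightarrow> johnson_E (a + b) a (h u) (h v)"
      using johnson_E_card[of "h u" "a + b" a "h v"] mem lt uv by (auto simp: grid_E_def ij)
  qed
qed

lemma halved_local:
  "{} \<in> halved_V n" "graph_iso (johnson_V n 2) (johnson_E n 2) {A \<in> halved_V n. halved_E n {} A} (halved_E n)"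
proof -
  show O: "{} \<in> halved_V n" by (simp add: halved_V_def)
  have N: "{A \<in> halved_V n. halved_E n {} A} = johnson_V n 2"
    using O by (auto simp: halved_E_def halved_V_def johnson_V_def)
  have "johnson_E n 2 A B \<longleftrightarrow> halved_E n A B" if J: "A \<in> johnson_V n 2" "B \<in> johnson_V n 2" for A B
  proof -
    have H: "A \<in> halved_V n" "B \<in> halved_V n" using J unfolding N[symmetric] by auto
    have "card (sym_diff A B) + 2 * card (A \<inter> B) = 4"
      using card_sd[OF johnson_fin[OF J(1)] johnson_fin[OF J(2)]] J by (simp add: johnson_V_def)
    moreover have "card (A - B) + card (A \<inter> B) = 2" using johnson_card_diff(1)[OF J] .
    ultimately have "card (A - B) = 1 \<longleftrightarrow> card (sym_diff A B) = 2" by linarith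
    then show ?thesis using johnson_E_card[OF J] H by (simp add: halved_E_def)
  qed
  then show "graph_iso (johnson_V n 2) (johnson_E n 2) {A \<in> halved_V n. halved_E n {} A} (halved_E n)"
    unfolding N by (intro graph_isoI[of id]) auto
qed

text \<open>The shift by 2 skips the base vertex 0 and its antipode 1.\<close>

lemma cp_local: "graph_iso {..<2 * k} (cp_E k) {i \<in> {..<2 * Suc k}. cp_E (Suc k) 0 i} (cp_E (Suc k))"
proof (rule graph_isoI[of "\<lambda>i. i + 2"])
  have "{i \<in> {..<2 * Suc k}. cp_E (Suc k) 0 i} = {2..<2 * k + 2}" by (auto simp: cp_E_def div_greater_zero_iff)
  moreover have "(\<lambda>i. i + 2) ` {..<2 * k} = {2..<2 * k + 2}"
    unfolding lessThan_atLeast0 image_add_atLeastLessThan' by (simp add: numeral_2_eq_2)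
  ultimately show "bij_betw (\<lambda>i. i + 2) {..<2 * k} {i \<in> {..<2 * Suc k}. cp_E (Suc k) 0 i}"
    by (simp add: bij_betw_def inj_on_def)
qed (auto simp: cp_E_def)

subsection \<open>The Schlaefli graph as a neighbourhood in the Gosset graph\<close>

definition gb :: "bool \<times> nat set" where "gb = (False, {0, 1})"
definition gu :: "bool \<times> nat set" where "gu = (False, {0, 2})"
definition sV :: "(bool \<times> nat set) set" where "sV = {u \<in> gV. gE gb u}"
definition sE :: "bool \<times> nat set \<Rightarrow> bool \<times> nat set \<Rightarrow> bool" where "sE x y \<longleftrightarrow> gE x y \<and> x \<in> sV \<and> y \<in> sV"

lemma gb_in: "gb \<in> gV" and gu_in: "gu \<in> gV" by (auto simp: gb_def gu_def gV_def johnson_V_def)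

lemma gE_in: "gE x y \<Longrightarrow> x \<in> gV \<and> y \<in> gV" by (simp add: gE_def)

interpretation G: rgraph gV gE by (rule gE_rgraph)

lemma card_Int_pair: "a \<noteq> b \<Longrightarrow> card (S \<inter> {a, b}) = (if a \<in> S then 1 else 0) + (if b \<in> S then 1 else 0)"
  by (simp add: Int_insert_right)

lemma pair_other: "a \<in> P \<Longrightarrow> P = {p, q} \<Longrightarrow> p \<noteq> q \<Longrightarrow> \<exists>b. P = {a, b} \<and> b \<noteq> a" by auto

lemma sV_iff: "x \<in> sV \<longleftrightarrow> x \<in> gV \<and> (if fst x then 0 \<notin> snd x \<and> 1 \<notin> snd x else (0 \<in> snd x) \<noteq> (1 \<in> snd x))"
proof -
  have "x \<in> sV \<longleftrightarrow> x \<in> gV \<and> (fst x = False \<and> card (snd x \<inter> {0, 1}) = 1 \<or> fst x \<noteq> False \<and> snd x \<inter> {0, 1} = {})"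
    unfolding sV_def gE_def gb_def using gb_in by (auto simp: gb_def Int_commute)
  then show ?thesis by (simp add: card_Int_pair)
qed

lemma gu_sV: "gu \<in> sV" using gu_in by (simp add: sV_iff gu_def)

text \<open>Connectedness of this neighbourhood makes it a single component, so
  \<open>comp_rgraph\<close> supplies its mirrors.\<close>

lemma sV_comp: "sV = G.comp gb gu"
proof
  have bu: "gE gb gu" using gu_sV by (simp add: sV_def)
  then show "G.comp gb gu \<subseteq> sV" using G.comp_nb[OF bu] gE_in unfolding sV_def by blast
  have nb: "gE gb x" if "x \<in> sV" for x using that by (simp add: sV_def)
  have mem: "(s, {p, q}) \<in> gV" if "p \<noteq> q" "p < 8" "q < 8" for s p q using that by (auto simp: gV_def johnson_V_def)
  have adj: "gE (s, P) (s, Q)" if "(s, P) \<in> gV" "(s, Q) \<in> gV" "P \<inter> Q = {a}" for s P Q a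
    using that by (simp add: gE_def)
  have 0: "(False, {0, a}) \<in> G.comp gb gu" if "2 \<le> a" "a < 8" for a
  proof (cases "a = 2")
    case True then show ?thesis using G.comp_self gu_def by metis
  next
    case False
    have m: "(False, {0, a}) \<in> gV" using mem that by auto
    then have "(False, {0, a}) \<in> sV" using that by (simp add: sV_iff)
    moreover have "gE gu (False, {0, a})" unfolding gu_def by (rule adj[of _ _ _ 0]) (use m gu_in False that in \<open>auto simp: gu_def\<close>)
    ultimately show ?thesis using G.comp_step[OF G.comp_self bu nb] by blast
  qed
  show "sV \<subseteq> G.comp gb gu"
  proof
    fix x assume x: "x \<in> sV"
    obtain s P where sP: "x = (s, P)" by (metis surj_pair)
    have P: "P \<in> johnson_V 8 2" using x sP by (auto simp: sV_iff gV_def)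
    then obtain p q where pq: "P = {p, q}" "p \<noteq> q" "p < 8" "q < 8" using J82 by blast
    show "x \<in> G.comp gb gu"
    proof (cases s)
      case True
      then have n: "0 \<notin> P" "1 \<notin> P" using x by (auto simp: sV_iff sP)
      \<comment> \<open>The pair \<open>{0, c}\<close> is to be disjoint from \<open>P\<close>,
        hence adjacent to it with the opposite sign.\<close>
      obtain c where c: "2 \<le> c" "c < 8" "c \<notin> P"
      proof (cases "2 \<in> P")
        case True
        then show ?thesis using that[of 3] that[of 4] pq by fastforce
      qed (use that[of 2] in simp)
      have "gE (False, {0, c}) x" unfolding sP using mem[of 0 c False] c x n True by (auto simp: gE_def sV_iff sP)
      then show ?thesis using G.comp_step[OF 0[OF c(1,2)]] nb x 0[OF c(1,2)] G.comp_nb[OF bu] by blast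
    next
      case False
      then have "0 \<in> P \<longleftrightarrow> 1 \<notin> P" using x by (simp add: sV_iff sP)
      moreover have "\<exists>a. P = {0, a} \<and> 2 \<le> a \<and> a < 8" if z: "0 \<in> P" "1 \<notin> P"
      proof -
        obtain a where a: "P = {0, a}" "a \<noteq> 0" using pair_other[OF z(1) pq(1,2)] by blast
        have "a \<in> P" unfolding a(1) by blast
        then have "a \<noteq> 1" using z(2) by (intro notI) simp
        moreover have "a < 8" using \<open>a \<in> P\<close> J82_fin[OF P] lessThan_iff by blast
        ultimately show ?thesis using a by (intro exI[of _ a]) auto
      qed
      moreover have "\<exists>a. P = {1, a} \<and> 2 \<le> a \<and> a < 8" if z: "1 \<in> P" "0 \<notin> P"
      proof -
        obtain a where a: "P = {1, a}" "a \<noteq> 1" using pair_other[OF z(1) pq(1,2)] by blast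
        have "a \<in> P" unfolding a(1) by blast
        then have "a \<noteq> 0" using z(2) by (intro notI) simp
        moreover have "a < 8" using \<open>a \<in> P\<close> J82_fin[OF P] lessThan_iff by blast
        ultimately show ?thesis using a by (intro exI[of _ a]) auto
      qed
      ultimately consider a where "P = {0, a}" "2 \<le> a" "a < 8" | a where "P = {1, a}" "2 \<le> a" "a < 8" by blast
      then show ?thesis
      proof cases
        case 1 then show ?thesis using 0 sP False by simp
      next
        case 2
        have "gE (False, {0, a}) x" unfolding sP using False 2
          by (auto intro!: adj[of _ _ _ a] mem)
        then show ?thesis using G.comp_step[OF 0[OF 2(2,3)]] nb x 0[OF 2(2,3)] G.comp_nb[OF bu] by blast
      qed
    qed
  qed
qed

lemma sE_sub: "sE = G.sub sV" by (intro ext) (simp add: sE_def)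

lemma sE_rgraph: "rgraph sV sE"
  unfolding sE_sub unfolding sV_comp using G.comp_rgraph(1)[of gb gu] gu_sV by (simp add: sV_def)

text \<open>The common neighbours of \<open>gb\<close> and \<open>gu\<close> are the positive pair
  \<open>{1, 2}\<close>, the five positive pairs \<open>{0, m}\<close> and the ten negative pairs
  inside \<open>{3..7}\<close>. They correspond to the empty set, the 4-sets (through the missing
  element) and the 2-sets of the halved 5-cube.\<close>

lemma sE_local: "graph_iso (halved_V 5) (halved_E 5) {u \<in> sV. sE gu u} sE"
proof -
  define f :: "nat \<Rightarrow> nat" where "f i = i + 3" for i
  define h where "h A = (if A = {} then (False, {1, 2}) else if card A = 2 then (True, f ` A)
    else (False, insert 0 (f ` ({..<5} - A))))" for A
  let ?N = "{u \<in> sV. sE gu u}"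
  have N_iff: "x \<in> ?N \<longleftrightarrow> x \<in> sV \<and> (if fst x then 2 \<notin> snd x else (0 \<in> snd x) \<noteq> (2 \<in> snd x))" for x
  proof -
    have "x \<in> ?N \<longleftrightarrow> x \<in> sV \<and> (fst x = False \<and> card (snd x \<inter> {0, 2}) = 1 \<or> fst x \<noteq> False \<and> snd x \<inter> {0, 2} = {})"
      using gu_sV gu_in unfolding sE_def gE_def gu_def sV_def by (auto simp: Int_commute)
    then show ?thesis by (auto simp: card_Int_pair sV_iff)
  qed
  have finj: "inj f" by (simp add: f_def inj_def)
  have f3: "f i \<notin> {0, 1, 2}" for i by (simp add: f_def)
  have fsurj: "\<exists>i<5. m = f i" if "m < 8" "m \<noteq> 0" "m \<noteq> 1" "m \<noteq> 2" for m
    using that by (intro exI[of _ "m - 3"]) (auto simp: f_def)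
  have forms: "A = {} \<or> (\<exists>i j. i < 5 \<and> j < 5 \<and> i \<noteq> j \<and> A = {i, j}) \<or> (\<exists>i<5. A = {..<5} - {i})"
    if A: "A \<in> halved_V 5" for A
  proof -
    have fin: "finite A" by (rule halved_fin[OF A])
    have sub: "A \<subseteq> {..<5}" "even (card A)" using A by (auto simp: halved_V_def)
    have "card A \<le> 5" using card_mono[OF _ sub(1)] by simp
    then have "card A = 0 \<or> card A = 2 \<or> card A = 4" using sub(2) by presburger
    then show ?thesis
    proof (elim disjE)
      assume "card A = 2"
      then show ?thesis using sub(1) unfolding card_2_iff by auto
    next
      assume "card A = 4"
      then have "card ({..<5} - A) = 1" using sub(1) fin by (subst card_Diff_subset) auto
      then obtain i where "{..<5} - A = {i}" by (meson card_1_singletonE)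
      then have "A = {..<5} - {i}" "i < 5" using sub(1) by auto
      then show ?thesis by blast
    qed (use fin in simp)
  qed
  have memb: "{} \<in> halved_V 5" "i < 5 \<Longrightarrow> j < 5 \<Longrightarrow> i \<noteq> j \<Longrightarrow> {i, j} \<in> halved_V 5" "i < 5 \<Longrightarrow> {..<5} - {i} \<in> halved_V 5" for i j
    by (auto simp: halved_V_def)
  have h0: "h {} = (False, {1, 2})" and h2: "i \<noteq> j \<Longrightarrow> h {i, j} = (True, {f i, f j})" for i j
    by (simp_all add: h_def)
  have h4: "h ({..<5} - {i}) = (False, {0, f i})" if "i < 5" for i
  proof -
    have c: "card ({..<5} - {i}) = 4" using that by simp
    then have "{..<5} - {i} \<noteq> {}" by (metis card.empty zero_neq_numeral)
    moreover have "{..<5} - ({..<5} - {i}) = {i}" using that by auto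
    ultimately show ?thesis using c by (simp add: h_def)
  qed
  have into: "h A \<in> ?N" if A: "A \<in> halved_V 5" for A
    using forms[OF A]
  proof (elim disjE exE conjE)
    assume "A = {}" then show ?thesis unfolding N_iff using h0 by (simp add: sV_iff gV_def johnson_V_def)
  next
    fix i j assume "i < 5" "j < 5" "i \<noteq> j" "A = {i, j}"
    then show ?thesis unfolding N_iff using h2[of i j] by (simp add: sV_iff gV_def johnson_V_def f_def)
  next
    fix i assume "i < 5" "A = {..<5} - {i}"
    then show ?thesis unfolding N_iff using h4[of i] by (simp add: sV_iff gV_def johnson_V_def f_def)
  qed
  have surj: "\<exists>A\<in>halved_V 5. x = h A" if x: "x \<in> ?N" for x
  proof -
    obtain s P where sP: "x = (s, P)" by (metis surj_pair)
    have PJ: "P \<in> johnson_V 8 2" using x[unfolded N_iff] by (auto simp: sV_iff gV_def sP)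
    then obtain p q where pq: "P = {p, q}" "p \<noteq> q" "p < 8" "q < 8" using J82 by blast
    show ?thesis
    proof (cases s)
      case True
      then have "0 \<notin> P" "1 \<notin> P" "2 \<notin> P" using x[unfolded N_iff] by (auto simp: sV_iff sP)
      then obtain i j where ij: "i < 5" "p = f i" "j < 5" "q = f j" using pq fsurj[of p] fsurj[of q] by auto
      then have "i \<noteq> j" using pq by auto
      with ij show ?thesis using memb(2)[of i j] h2[of i j] pq sP True by (intro bexI[of _ "{i, j}"]) auto
    next
      case False
      then have n: "(0 \<in> P) \<noteq> (1 \<in> P)" "(0 \<in> P) \<noteq> (2 \<in> P)" using x[unfolded N_iff] by (auto simp: sV_iff sP)
      show ?thesis
      proof (cases "0 \<in> P")
        case True
        then obtain a where a: "P = {0, a}" "a \<noteq> 0" using pair_other[OF True pq(1,2)] by blast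
        have "a \<in> P" unfolding a(1) by blast
        then have "a < 8" "a \<noteq> 1" "a \<noteq> 2" using n True J82_fin[OF PJ] lessThan_iff by blast+
        then obtain i where "i < 5" "a = f i" using fsurj[of a] a(2) by blast
        then show ?thesis using memb(3)[of i] h4[of i] a sP False by (intro bexI[of _ "{..<5} - {i}"]) auto
      next
        case no: False
        then have "1 \<in> P" "2 \<in> P" using n by auto
        then have "P = {1, 2}" using pq by auto
        then show ?thesis using h0 memb(1) sP False by (intro bexI[of _ "{}"]) auto
      qed
    qed
  qed
  have card_sd2: "halved_E 5 A B \<longleftrightarrow> card (sym_diff A B) = 2" if "A \<in> halved_V 5" "B \<in> halved_V 5" for A B
    using that by (simp add: halved_E_def)
  have gN: "sE x y \<longleftrightarrow> (fst x = fst y \<and> card (snd x \<inter> snd y) = 1 \<or> fst x \<noteq> fst y \<and> snd x \<inter> snd y = {})"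
    if "x \<in> ?N" "y \<in> ?N" for x y
  proof -
    have "x \<in> sV" "y \<in> sV" using that by blast+
    moreover from this have "x \<in> gV" "y \<in> gV" by (simp_all add: sV_def)
    ultimately show ?thesis by (simp add: sE_def gE_def)
  qed
  have finjD: "f i = f j \<longleftrightarrow> i = j" for i j by (simp add: f_def)
  have sdp: "card (sym_diff A {k, l}) = (if k \<in> A \<and> l \<in> A then card A - 2 else if k \<notin> A \<and> l \<notin> A then card A + 2 else card A)"
    if "finite A" "k \<noteq> l" for A :: "nat set" and k l using card_sd_pair that by blast
  have adj: "halved_E 5 A B \<longleftrightarrow> sE (h A) (h B)" if A: "A \<in> halved_V 5" and B: "B \<in> halved_V 5" for A B
  proof -
    \<comment> \<open>All cases that involve a 2-set are reduced by symmetry to one in which it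
      comes second.\<close>
    have C2: "halved_E 5 A {k, l} \<longleftrightarrow> sE (h A) (h {k, l})" if A: "A \<in> halved_V 5" and kl: "k < 5" "l < 5" "k \<noteq> l" for A k l
    proof -
      have i: "sE (h A) (h {k, l}) \<longleftrightarrow> (fst (h A) = True \<and> card (snd (h A) \<inter> {f k, f l}) = 1 \<or> fst (h A) \<noteq> True \<and> snd (h A) \<inter> {f k, f l} = {})"
        using gN[OF into[OF A] into[OF memb(2)[OF kl]]] h2[OF kl(3)] by simp
      have ii: "halved_E 5 A {k, l} \<longleftrightarrow> card (sym_diff A {k, l}) = 2" using card_sd2[OF A memb(2)[OF kl]] .
      have flk: "f k \<noteq> f l" using kl by (simp add: f_def)
      show ?thesis using forms[OF A]
      proof (elim disjE exE conjE)
        assume "A = {}" then show ?thesis unfolding i ii using kl f3 h0 by (simp add: f_def)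
      next
        fix p q assume p: "p < 5" "q < 5" "p \<noteq> q" "A = {p, q}"
        show ?thesis unfolding i ii sdp[OF halved_fin[OF A] kl(3)] card_Int_pair[OF flk]
          using p kl by (simp add: h2 finjD)
      next
        fix p assume p: "p < 5" "A = {..<5} - {p}"
        then have "card A = 4" by simp
        then show ?thesis unfolding i ii sdp[OF halved_fin[OF A] kl(3)]
          using p kl by (simp add: h4 finjD f_def)
      qed
    qed
    have sym: "halved_E 5 A B \<longleftrightarrow> halved_E 5 B A" "sE x y \<longleftrightarrow> sE y x" for A B x y
      by (auto simp: halved_E_def Un_commute sE_def gE_def Int_commute)
    show ?thesis using forms[OF A] forms[OF B]
    proof (elim disjE exE conjE)
      assume "A = {}" "B = {}"
      then show ?thesis using card_sd2[OF A B] gN[OF into[OF A] into[OF B]] by (simp add: h0)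
    next
      fix i assume i: "i < 5" and e: "A = {}" "B = {..<5} - {i}"
      then show ?thesis using card_sd2[OF A B] gN[OF into[OF A] into[OF B]] by (simp add: h0 h4 f_def)
    next
      fix i assume i: "i < 5" and e: "B = {}" "A = {..<5} - {i}"
      then show ?thesis using card_sd2[OF A B] gN[OF into[OF A] into[OF B]] by (simp add: h0 h4 f_def)
    next
      fix i j assume i: "i < 5" "j < 5" and e: "A = {..<5} - {i}" "B = {..<5} - {j}"
      have "sym_diff A B = (if i = j then {} else {i, j})" using i e by auto
      then have "card (sym_diff A B) = 2 \<longleftrightarrow> i \<noteq> j" by simp
      moreover have "{0, f i} \<inter> {0, f j} = (if i = j then {0, f i} else {0})" using f3 finjD by auto
      then have "card ({0, f i} \<inter> {0, f j}) = 1 \<longleftrightarrow> i \<noteq> j"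
        using f3[of j] by (cases "i = j") (simp_all only: if_True if_False, auto)
      ultimately show ?thesis using card_sd2[OF A B] gN[OF into[OF A] into[OF B]] e i by (simp add: h4)
    qed (use C2 A B sym in metis)+
  qed
  have inj: "inj_on h (halved_V 5)"
  proof (rule inj_onI)
    fix A B assume A: "A \<in> halved_V 5" and B: "B \<in> halved_V 5" and eq: "h A = h B"
    have f0: "f i \<noteq> 0" for i by (simp add: f_def)
    have n: "{Suc 0, 2} \<noteq> {0, f i}" for i by (simp add: doubleton_eq_iff)
    show "A = B" using forms[OF A] forms[OF B]
    proof (elim disjE exE conjE)
      fix i j k l assume "i \<noteq> j" "k \<noteq> l" and e: "A = {i, j}" "B = {k, l}"
      then have "{f i, f j} = {f k, f l}" using eq by (simp add: h2)
      then show ?thesis unfolding e doubleton_eq_iff finjD .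
    next
      fix i j assume "i < 5" "j < 5" and e: "A = {..<5} - {i}" "B = {..<5} - {j}"
      then have "{0, f i} = {0, f j}" using eq by (simp add: h4)
      then have "i = j" using f0 by (auto simp: doubleton_eq_iff finjD)
      then show ?thesis using e by simp
    qed (use eq n in \<open>auto simp: h0 h2 h4\<close>)
  qed
  have "h ` halved_V 5 = ?N"
  proof
    show "?N \<subseteq> h ` halved_V 5" using surj by (intro subsetI) (erule bexE | blast)+
  qed (use into in blast)
  then have "bij_betw h (halved_V 5) ?N" using inj by (simp add: bij_betw_def)
  then show ?thesis using adj by (rule graph_isoI)
qed

subsection \<open>The Schlaefli graph\<close>

text \<open>The complement of a strongly regular graph with parameters (27,16,10,8) is the collinearity graph
  of a generalised quadrangle with lines of size three: every point off a line is collinear with exactly one of its points.\<close>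

locale schlafli =
  fixes V :: "'a set" and E :: "'a \<Rightarrow> 'a \<Rightarrow> bool"
  assumes srg: "srg V E 27 16 10 8"
begin

definition col :: "'a \<Rightarrow> 'a \<Rightarrow> bool" where "col x y \<longleftrightarrow> x \<in> V \<and> y \<in> V \<and> x \<noteq> y \<and> \<not> E x y"

lemma sg: "simple_graph V E" and cardV: "card V = 27" and cardN: "x \<in> V \<Longrightarrow> card {z \<in> V. E x z} = 16"
  and lam: "E x y \<Longrightarrow> card {z \<in> V. E x z \<and> E y z} = 10"
  and mu: "x \<in> V \<Longrightarrow> y \<in> V \<Longrightarrow> x \<noteq> y \<Longrightarrow> \<not> E x y \<Longrightarrow> card {z \<in> V. E x z \<and> E y z} = 8"
  using srg unfolding srg_def deg_def simple_graph_def by auto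

lemma fin: "finite V" and Ein: "E x y \<Longrightarrow> x \<in> V \<and> y \<in> V" and Esym: "E x y \<Longrightarrow> E y x" and Eir: "\<not> E x x"
  using sg unfolding simple_graph_def by blast+

lemma col_sym: "col x y \<Longrightarrow> col y x" using Esym unfolding col_def by blast

text \<open>Inclusion-exclusion with valency 16. It turns the parameters into counts of common
  non-neighbours: 27 - 22 = 5 for an edge, and 27 - 24 - 2 = 1 for a non-edge.\<close>

lemma card_nbs: "x \<in> V \<Longrightarrow> y \<in> V \<Longrightarrow> card ({z \<in> V. E x z} \<union> {z \<in> V. E y z}) + card {z \<in> V. E x z \<and> E y z} = 32"
proof -
  assume "x \<in> V" "y \<in> V"
  moreover have "{z \<in> V. E x z} \<inter> {z \<in> V. E y z} = {z \<in> V. E x z \<and> E y z}" by auto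
  ultimately show ?thesis using card_Un_Int[of "{z \<in> V. E x z}" "{z \<in> V. E y z}"] cardN fin by simp
qed

lemma col_count: assumes "x \<in> V" shows "card {z. col x z} = 10"
proof -
  have "{z. col x z} = V - insert x {z \<in> V. E x z}" using assms by (auto simp: col_def)
  moreover have "card (insert x {z \<in> V. E x z}) = 17" using cardN[OF assms] Eir fin by simp
  ultimately show ?thesis using assms fin cardV by (simp add: card_Diff_subset)
qed

lemma col_common: assumes "E x y" shows "card {z. col x z \<and> col y z} = 5"
proof -
  let ?U = "{z \<in> V. E x z} \<union> {z \<in> V. E y z}"
  have xy: "x \<in> V" "y \<in> V" "x \<in> ?U" "y \<in> ?U" using assms Ein Esym by blast+
  have "card ?U = 22" using card_nbs[OF xy(1,2)] lam[OF assms] by simp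
  moreover have "{z. col x z \<and> col y z} = V - ?U" using xy by (auto simp: col_def)
  ultimately show ?thesis using fin cardV by (simp add: card_Diff_subset)
qed

lemma col_unique: assumes "col x y" shows "card {z. col x z \<and> col y z} = 1"
proof -
  let ?U = "{z \<in> V. E x z} \<union> {z \<in> V. E y z}"
  have xy: "x \<in> V" "y \<in> V" "x \<noteq> y" "\<not> E x y" "\<not> E y x" using assms Esym unfolding col_def by blast+
  have "card ?U = 24" using card_nbs[OF xy(1,2)] mu[OF xy(1-4)] by simp
  moreover have "x \<notin> ?U" "y \<notin> ?U" using xy Eir by auto
  ultimately have "card (insert x (insert y ?U)) = 26" using fin xy(3) by simp
  moreover have "{z. col x z \<and> col y z} = V - insert x (insert y ?U)" using xy by (auto simp: col_def)
  moreover have "insert x (insert y ?U) \<subseteq> V" using xy by auto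
  ultimately show ?thesis using fin cardV card_Diff_subset[of "insert x (insert y ?U)" V] by (simp add: finite_subset)
qed

text \<open>The third point on the line through two collinear points.\<close>

definition th :: "'a \<Rightarrow> 'a \<Rightarrow> 'a" where "th x y = (THE z. col x z \<and> col y z)"

lemma th_ex1: assumes "col x y" shows "\<exists>!z. col x z \<and> col y z"
proof -
  obtain a where "{z. col x z \<and> col y z} = {a}" using col_unique[OF assms] by (rule card_1_singletonE)
  then show ?thesis by (intro ex1I[of _ a]) blast+
qed

lemma th_col: assumes "col x y" shows "col x (th x y)" "col y (th x y)"
  using theI'[OF th_ex1[OF assms]] unfolding th_def by auto

lemma th_eq: assumes "col x y" "col x z" "col y z" shows "z = th x y"
  using th_ex1[OF assms(1)] th_col[OF assms(1)] assms by blast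

lemma th_th: "col x y \<Longrightarrow> th x (th x y) = y"
  using th_col[of x y] th_eq[of x "th x y" y] col_sym by metis

text \<open>The ten points collinear with \<open>x\<close> form five pairs
  \<open>{a, th x a}\<close>. The point \<open>p\<close> is collinear with five of the ten and with
  at most one in each pair, hence with exactly one.\<close>

lemma gq:
  assumes E: "E p x" and a: "col x a" shows "col p a \<longleftrightarrow> \<not> col p (th x a)"
proof -
  let ?N = "{z. col x z}" and ?C = "{z. col p z \<and> col x z}"
  have xV: "x \<in> V" using Ein[OF E] by blast
  have finN: "finite ?N" using fin by (rule rev_finite_subset) (auto simp: col_def)
  have inj: "inj_on (th x) ?N" by (metis (no_types, lifting) inj_onI mem_Collect_eq th_th)
  have sub: "th x ` ?C \<subseteq> ?N" using th_col by blast
  \<comment> \<open>Otherwise \<open>p\<close> and \<open>x\<close> would both be the third point of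
    the line through \<open>a\<close> and \<open>th x a\<close>.\<close>
  have both: "\<not> (col p a \<and> col p (th x a))" if "col x a" for a
  proof
    assume *: "col p a \<and> col p (th x a)"
    have "col a (th x a)" using th_col that by blast
    then have "p = th a (th x a)" "x = th a (th x a)" using th_eq * that th_col(1)[OF that] col_sym by blast+
    then show False using E Eir by simp
  qed
  then have "?C \<inter> th x ` ?C = {}" using th_th by fastforce
  moreover have "card (th x ` ?C) = 5" using card_image[OF inj_on_subset[OF inj, of ?C]] col_common[OF E] by auto
  ultimately have "card (?C \<union> th x ` ?C) = 10"
    using col_common[OF E] finN by (subst card_Un_disjoint) (auto intro: rev_finite_subset)
  then have "?C \<union> th x ` ?C = ?N" using sub finN col_count[OF xV] by (intro card_subset_eq) auto
  then have "a \<in> ?C \<or> a \<in> th x ` ?C" using a by blast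
  then have "col p a \<or> col p (th x a)" using th_th by auto
  then show ?thesis using both[OF a] by blast
qed

lemma line:
  assumes ab: "col a b" and z: "z \<in> V" "z \<noteq> a" "z \<noteq> b" "z \<noteq> th a b"
  shows "(if col z a then 1 else 0) + (if col z b then 1 else 0) + (if col z (th a b) then 1 else 0) = (1::int)"
proof (cases "col z a")
  case True
  have "\<not> col z b" using th_eq[OF ab] True z(4) col_sym by blast
  moreover have "\<not> col z (th a b)" using th_eq[OF th_col(1)[OF ab]] th_th[OF ab] True z(3) col_sym by metis
  ultimately show ?thesis using True by simp
next
  case False
  then have "E z a" using z ab unfolding col_def by blast
  then show ?thesis using gq[OF _ ab] False by simp
qed

text \<open>Distances between distinct points are 1 plus the indicator of collinearity. For two
  lines through \<open>p\<close>, with further points \<open>y\<close>, \<open>u\<close> and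
  \<open>x\<close>, \<open>u'\<close>, the identity \<open>line\<close> makes the indicators of
  \<open>y\<close> and \<open>u\<close> and those of \<open>x\<close> and \<open>u'\<close> have
  equal sums; this is the square condition.\<close>

lemma rgraph: "rgraph V E"
proof -
  define \<delta> :: "'a \<Rightarrow> 'a \<Rightarrow> nat" where "\<delta> x y = (if x = y then 0 else if E x y then 1 else 2)" for x y
  have step: "\<exists>u\<in>V. E u y \<and> \<delta> x y = \<delta> x u + 1" if "x \<in> V" "y \<in> V" "x \<noteq> y" for x y
  proof (cases "E x y")
    case False
    then have "{z \<in> V. E x z \<and> E y z} \<noteq> {}" using mu[OF that False] by (metis card.empty zero_neq_numeral)
    then obtain u where "u \<in> V" "E x u" "E y u" by blast
    then show ?thesis using False that Esym Eir by (intro bexI[of _ u]) (auto simp: \<delta>_def)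
  qed (use that in \<open>intro bexI[of _ x]; auto simp: \<delta>_def\<close>)
  have lip: "\<delta> x z \<le> \<delta> x y + 1" if "E y z" for x y z using that by (auto simp: \<delta>_def)
  have "\<delta> x x = 0" for x by (simp add: \<delta>_def)
  note g = gdist_eqI[OF sg, of \<delta>, OF this lip step]
  interpret cgraph V E using sg g(1) by unfold_locales auto
  have dist: "d x y = (if x = y then 0 else if E x y then 1 else 2)" if "x \<in> V" "y \<in> V" for x y
    using g(2)[of x y] that unfolding gd_def by (simp add: \<delta>_def)
  have dcol: "d x y = 1 + (if col x y then 1 else 0)" if "x \<in> V" "y \<in> V" "x \<noteq> y" for x y
    using dist[OF that(1,2)] that by (simp add: col_def)
  show ?thesis
  proof
    fix x y assume "E x y"
    then show "\<exists>\<phi>. mirror V E x y \<phi>"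
    proof (rule square_imp_mirror[rotated])
      fix x y u assume E: "E x y" and xu: "E x u" and u: "d u y = d u x + 1"
      have V: "x \<in> V" "y \<in> V" "u \<in> V" using Ein E xu by blast+
      have "d u x = 1" using d_edge[OF Esym[OF xu]] .
      then have yu: "col y u" using u dist[OF V(3,2)] V Esym by (auto simp: col_def split: if_splits)
      \<comment> \<open>The line through the non-adjacent \<open>y\<close> and \<open>u\<close> has
        a third point \<open>p\<close>; it is collinear with \<open>x\<close>, and \<open>u'\<close>
        will be the third point of the line through \<open>x\<close> and \<open>p\<close>.\<close>
      define p where "p = th y u"
      have yp: "col y p" and up: "col u p" using th_col[OF yu] by (simp_all add: p_def)
      have "\<not> col x u" using xu by (simp add: col_def)
      then have xp: "col x p" using gq[OF E yu] by (simp add: p_def)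
      define u' where "u' = th x p"
      have xu': "col x u'" and pu': "col p u'" using th_col[OF xp] by (simp_all add: u'_def)
      have nyu: "\<not> col y u'" using gq[OF Esym[OF E] xp] yp by (simp add: u'_def)
      have u'V: "u' \<in> V" "p \<in> V" using xu' pu' by (auto simp: col_def)
      have ne: "u' \<noteq> y" "u' \<noteq> u" "u' \<noteq> x" "u \<noteq> x" "u \<noteq> y" "x \<noteq> y" "p \<noteq> x" "p \<noteq> y" "p \<noteq> u" "p \<noteq> u'"
        using xu' E xu yu xp yp up pu' Eir by (auto simp: col_def)
      have nuu: "\<not> col u u'"
      proof
        assume "col u u'"
        then have "u = th p u'" "x = th p u'" using th_eq[OF pu'] up xp xu' col_sym by blast+
        then show False using ne by simp
      qed
      show "\<exists>u'\<in>V. \<forall>z\<in>V. d z u' = d z u + (d z y - d z x)"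
      proof (intro bexI[of _ u'] ballI u'V(1))
        fix z assume z: "z \<in> V"
        have cs: "col a b = col b a" for a b using col_sym by blast
        have "\<not> col x y" using E by (simp add: col_def)
        note c = xu' pu' nyu nuu xp yp up yu \<open>\<not> col x u\<close> this
        \<comment> \<open>The identity \<open>line\<close> is available only off the two lines;
          their five points are checked one by one.\<close>
        consider "z = x" | "z = y" | "z = u" | "z = u'" | "z = p" | "z \<notin> {x, y, u, u', p}" by blast
        then show "d z u' = d z u + (d z y - d z x)"
        proof cases
          case 1
          then show ?thesis using c ne V u'V E xu by (simp add: dcol d_edge)
        next
          case 2
          then show ?thesis using c ne V u'V E xu d_edge[OF Esym[OF E]] by (simp add: dcol)
        next
          case 3
          then show ?thesis using c ne V u'V d_edge[OF Esym[OF xu]] u by (simp add: dcol)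
        next
          case 4
          then show ?thesis using c ne V u'V cs[of u' u] cs[of u' y] cs[of u' x] by (simp add: dcol)
        next
          case 5
          then show ?thesis using c ne V u'V cs[of p u] cs[of p y] cs[of p x] by (simp add: dcol)
        next
          case 6
          then show ?thesis using line[OF xp z] line[OF yu z] z V u'V by (simp add: dcol p_def[symmetric] u'_def[symmetric])
        qed
      qed
    qed
  qed
qed

lemma curvature_twelve: "constant_curvature V E 12"
proof -
  interpret rgraph V E by (rule rgraph)
  show ?thesis unfolding constant_curvature_iff using lam by simp
qed

end

section \<open>Parameters of a graph of diameter two from its curvature\<close>

context rgraph begin

context
  fixes c z
  assumes c: "constant_curvature V E c" and z: "z \<in> V" and diam: "\<And>w. w \<in> V \<Longrightarrow> d z w \<le> 2"
begin

text \<open>At distance two from \<open>z\<close> only the neighbours nearer to \<open>z\<close>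
  contribute to the Laplacian, each with -1; compare with \<open>lap_dr\<close>.\<close>

lemma diam_two_mu:
  assumes y: "y \<in> V" "d z y = 2" shows "real (card {w \<in> V. E z w \<and> E y w}) = 2 * c - real (deg V E z)"
proof -
  have "lap (dr z) y = (\<Sum>w\<in>nb y. if E z w then -1 else 0)"
    unfolding laplacian_def
  proof (intro sum.cong refl)
    fix w assume w: "w \<in> nb y"
    have "w \<noteq> z" using w y d_edge E_sym by force
    then have "d z w \<noteq> 0" "d z w \<le> 2" using w z diam[of w] by auto
    then have "d z w = 1 \<or> d z w = 2" using d_nonneg[of z w] by linarith
    then show "dr z w - dr z y = (if E z w then -1 else 0)" using d_eq1[of z w] w z y by auto
  qed
  also have "\<dots> = (\<Sum>w\<in>{w \<in> nb y. E z w}. -1)" using finV by (intro sum.inter_filter[symmetric]) auto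
  also have "{w \<in> nb y. E z w} = {w \<in> V. E z w \<and> E y w}" by auto
  finally show ?thesis using lap_dr[OF c z y(1)] y(2) by simp
qed

text \<open>Summing \<open>lap_dr\<close> over all vertices gives a linear equation for the number
  of vertices.\<close>

lemma diam_two_card:
  "real (card V) * real (deg V E z) = c * (2 * real (card V) - 2 - real (deg V E z))"
proof -
  have "(\<Sum>y\<in>V. dr z y) = (\<Sum>y\<in>V. 2 - (if y = z then 2 else 0) - (if E z y then 1 else 0))"
  proof (intro sum.cong refl)
    fix y assume y: "y \<in> V"
    then have "0 \<le> d z y" "d z y \<le> 2" "d z y = 0 \<longleftrightarrow> y = z" "d z y = 1 \<longleftrightarrow> E z y" using diam d_eq1 z by auto
    then have "d z y = 2 - (if y = z then 2 else 0) - (if E z y then 1 else 0)" using E_irrefl[of z] by (smt (verit))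
    then show "dr z y = 2 - (if y = z then 2 else 0) - (if E z y then 1 else 0)" by simp
  qed
  also have "\<dots> = 2 * real (card V) - 2 - (\<Sum>y\<in>V. if E z y then 1 else 0)" using z finV by (simp add: sum_subtractf)
  also have "(\<Sum>y\<in>V. if E z y then 1 else (0::real)) = (\<Sum>y\<in>nb z. 1)" using finV by (intro sum.inter_filter[symmetric]) auto
  finally have s: "(\<Sum>y\<in>V. dr z y) = 2 * real (card V) - 2 - real (deg V E z)" by (simp add: deg_def)
  have "0 = (\<Sum>y\<in>V. real (deg V E z) - c * dr z y)" using sum_lap[of "dr z"] lap_dr[OF c z] by simp
  then show ?thesis using s by (simp add: sum_subtractf sum_distrib_left[symmetric])
qed

end

end

lemma card_johnson: "card (johnson_V n k) = n choose k"
  unfolding johnson_V_def using n_subsets[of "{..<n}" k] by simp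

lemma card_halved5: "card (halved_V 5) = 16"
proof -
  have "halved_V 5 = johnson_V 5 0 \<union> johnson_V 5 2 \<union> johnson_V 5 4"
  proof (intro equalityI subsetI)
    fix A assume A: "A \<in> halved_V 5"
    then have s: "A \<subseteq> {..<5}" "even (card A)" by (auto simp: halved_V_def)
    have "card A \<le> 5" using card_mono[OF _ s(1)] by simp
    then have "card A = 0 \<or> card A = 2 \<or> card A = 4" using s(2) by presburger
    then show "A \<in> johnson_V 5 0 \<union> johnson_V 5 2 \<union> johnson_V 5 4" using s(1) by (auto simp: johnson_V_def)
  qed (auto simp: johnson_V_def halved_V_def)
  moreover have "finite (johnson_V 5 k)" for k using johnson_simple by (simp add: simple_graph_def)
  moreover have "(johnson_V 5 0 \<union> johnson_V 5 2) \<inter> johnson_V 5 4 = {}" "johnson_V 5 0 \<inter> johnson_V 5 2 = {}"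
    by (auto simp: johnson_V_def)
  ultimately have "card (halved_V 5) = (5 choose 0) + (5 choose 2) + (5 choose 4)"
    by (simp add: card_Un_disjoint card_johnson)
  moreover have "5 choose 2 = (10 :: nat)" "5 choose 4 = (5 :: nat)"
    using binomial_symmetric[of 4 "5 :: nat"] by (simp_all add: choose_two)
  ultimately show ?thesis by simp
qed

lemma graph_iso_deg:
  assumes "graph_iso L LE N F" "w \<in> L" obtains v where "v \<in> N" "card {z \<in> L. LE w z} = card {z \<in> N. F v z}"
proof -
  obtain h where h: "bij_betw h L N" "\<And>u v. u \<in> L \<Longrightarrow> v \<in> L \<Longrightarrow> LE u v \<longleftrightarrow> F (h u) (h v)"
    using assms unfolding graph_iso_def by blast
  have "card {z \<in> L. LE w z \<and> LE w z} = card {z \<in> N. F (h w) z \<and> F (h w) z}"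
    by (rule iso_tri[of h L N LE F]) (use h assms in auto)
  then show ?thesis using that[of "h w"] h(1) assms(2) by (auto simp: bij_betw_def)
qed

lemma sE_diam: assumes "x \<in> sV" "y \<in> sV" shows "gd sV sE x y \<le> 2"
proof -
  have "gE gb gu" using gu_sV by (simp add: sV_def)
  then have "gdist sV sE x y = gdist gV gE x y"
    using G.comp_rgraph(2)[of gb gu x y] assms unfolding sE_sub unfolding sV_comp by blast
  moreover have "gd gV gE x y \<le> 2" using G.d_nb[of gb x y] assms by (auto simp: sV_def)
  ultimately show ?thesis by (simp add: gd_def)
qed

text \<open>Counting the halved 5-cube gives valency 16, its own valency 10 is the triangle count,
  and so the curvature is 12. Then \<open>diam_two_mu\<close> gives 24 - 16 = 8, and
  \<open>diam_two_card\<close> gives 27 vertices.\<close>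

lemma sE_srg: "srg sV sE 27 16 10 8"
proof -
  interpret rgraph sV sE by (rule sE_rgraph)
  have cg: "cgraph (halved_V 5) (halved_E 5)" using halved_rgraph[of 5] by (rule rgraph.axioms(1))
  obtain c where c: "constant_curvature sV sE c"
    using constant_if_local[OF sE_rgraph gu_sV graph_iso_sym[OF sE_local] cg] by blast
  have "deg sV sE gu = 16" using graph_iso_card[OF sE_local] card_halved5 by (simp add: deg_def)
  then have deg: "deg sV sE x = 16" if "x \<in> sV" for x using deg_eq[OF that gu_sV] by simp
  obtain v where v: "v \<in> {u \<in> sV. sE gu u}"
    "card {A \<in> halved_V 5. halved_E 5 {} A} = card {z \<in> {u \<in> sV. sE gu u}. sE v z}"
    by (rule graph_iso_deg[OF sE_local halved_local(1)])
  have choose: "5 choose 2 = (10 :: nat)" by (simp add: choose_two)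
  have "card {A \<in> halved_V 5. halved_E 5 {} A} = 10"
    using graph_iso_card[OF halved_local(2)[of 5]] card_johnson[of 5 2] choose by simp
  moreover have "{z \<in> {u \<in> sV. sE gu u}. sE v z} = {z \<in> sV. sE gu z \<and> sE v z}" by auto
  ultimately have "tri gu v = 10" using v(2) by simp
  moreover have "2 + real (tri gu v) = c" using c[unfolded constant_curvature_iff] v(1) by blast
  ultimately have c12: "c = 12" by simp
  have tri: "tri x y = 10" if "sE x y" for x y
  proof -
    have "2 + real (tri x y) = c" using c[unfolded constant_curvature_iff] that by blast
    then show ?thesis using c12 by simp
  qed
  have mu: "tri x y = 8" if xy: "x \<in> sV" "y \<in> sV" "x \<noteq> y" "\<not> sE x y" for x y
  proof -
    have "d x y \<noteq> 0" "d x y \<noteq> 1" using d_eq0[OF xy(1,2)] d_eq1[OF xy(1,2)] xy by simp_all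
    then have "d x y = 2" using sE_diam[OF xy(1,2)] d_nonneg[of x y] by linarith
    then have "real (tri x y) = 2 * c - real (deg sV sE x)"
      using diam_two_mu[OF c xy(1) sE_diam[OF xy(1)] xy(2)] by simp
    then show ?thesis using deg[OF xy(1)] c12 by simp
  qed
  have "real (card sV) * 16 = 12 * (2 * real (card sV) - 2 - 16)"
    using diam_two_card[OF c gu_sV sE_diam[OF gu_sV]] deg[OF gu_sV] c12 by simp
  then have "card sV = 27" by simp
  then show ?thesis unfolding srg_def using simple deg tri mu by blast
qed

lemma srg_iso:
  assumes iso: "graph_iso V E W F" and sg: "simple_graph V E" and s: "srg W F n k l m" shows "srg V E n k l m"
proof -
  obtain h where h: "bij_betw h V W" "\<And>u v. u \<in> V \<Longrightarrow> v \<in> V \<Longrightarrow> E u v \<longleftrightarrow> F (h u) (h v)"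
    using iso unfolding graph_iso_def by blast
  have hW: "x \<in> V \<Longrightarrow> h x \<in> W" and inj: "x \<in> V \<Longrightarrow> y \<in> V \<Longrightarrow> h x = h y \<longleftrightarrow> x = y" for x y
    using h(1) by (auto simp: bij_betw_def inj_on_def)
  have t: "card {z \<in> V. E x z \<and> E y z} = card {z \<in> W. F (h x) z \<and> F (h y) z}" if "x \<in> V" "y \<in> V" for x y
    by (rule iso_tri[of h V W E F]) (use h that in auto)
  have "deg V E v = deg W F (h v)" if "v \<in> V" for v using t[OF that that] by (simp add: deg_def)
  then show ?thesis using s sg graph_iso_card[OF iso] t hW inj h(2) unfolding srg_def by simp
qed

subsection \<open>The list of graphs\<close>

text \<open>\<open>cocktail_E\<close> relates singletons of arbitrary numbers; restricting it to the
  vertex set gives a simple graph.\<close>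

definition ck_E :: "nat \<Rightarrow> nat set \<Rightarrow> nat set \<Rightarrow> bool" where
  "ck_E k A B \<longleftrightarrow> cocktail_E A B \<and> A \<in> cocktail_V k \<and> B \<in> cocktail_V k"

text \<open>A copy of the Schlaefli graph on sets of naturals, the vertex type that
  \<open>in_family\<close> requires.\<close>

definition s0_V :: "nat set set" where "s0_V = {A \<in> gosset_V. gosset_E {0, 1} A}"
definition s0_E :: "nat set \<Rightarrow> nat set \<Rightarrow> bool" where "s0_E A B \<longleftrightarrow> gosset_E A B \<and> A \<in> s0_V \<and> B \<in> s0_V"

lemma ck_simple: "simple_graph (cocktail_V k) (ck_E k)"
proof -
  have "cocktail_V k = (\<lambda>i. {i}) ` {..<2 * k}" by (auto simp: cocktail_V_def)
  then have "finite (cocktail_V k)" by simp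
  then show ?thesis unfolding simple_graph_def ck_E_def cocktail_E_def by auto
qed

lemma ck_iso: "graph_iso (cocktail_V k) (ck_E k) {..<2 * k} (cp_E k)"
  using cocktail_iso[of k] unfolding graph_iso_def by (auto simp: ck_E_def)

lemma base_in: "{0, 1} \<in> gosset_V" and gpair_base: "gpair {0, 1} = gb"
proof -
  have "{0, 1} \<inter> {..<8} = {0, 1 :: nat}" by auto
  then show "{0, 1} \<in> gosset_V" "gpair {0, 1} = gb" by (auto simp: gosset_V_def gpair_def gb_def)
qed

lemma s0_iso: "graph_iso s0_V s0_E sV sE"
proof -
  have "graph_iso {A \<in> gosset_V. gosset_E {0, 1} A} gosset_E {u \<in> gV. gE (gpair {0, 1}) u} gE"
    using local_transport[of gpair gosset_V gV gosset_E gE "{0, 1}"] gpair_bij gpair_E base_in by blast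
  then have "graph_iso s0_V gosset_E sV gE" by (simp only: s0_V_def sV_def gpair_base)
  then obtain h where h: "bij_betw h s0_V sV" "\<forall>u\<in>s0_V. \<forall>v\<in>s0_V. gosset_E u v \<longleftrightarrow> gE (h u) (h v)"
    unfolding graph_iso_def by blast
  then have "\<forall>u\<in>s0_V. h u \<in> sV" by (auto simp: bij_betw_def)
  then show ?thesis using h unfolding graph_iso_def s0_E_def sE_def by blast
qed

lemma s0_simple: "simple_graph s0_V s0_E"
  using gosset_simple unfolding simple_graph_def s0_E_def s0_V_def by auto

lemma s0_srg: "srg s0_V s0_E 27 16 10 8" by (rule srg_iso[OF s0_iso s0_simple sE_srg])

lemma s0_rgraph: "rgraph s0_V s0_E" by (rule iso_rgraph[OF s0_iso s0_simple sE_rgraph])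

text \<open>The ranges exclude one-vertex and disconnected graphs, the 4-cycle (a product of two edges), and the halved cubes
  that are complete or cocktail party graphs.\<close>

inductive model :: "nat set set \<Rightarrow> (nat set \<Rightarrow> nat set \<Rightarrow> bool) \<Rightarrow> bool" where
  johnson: "1 \<le> k \<Longrightarrow> k < n \<Longrightarrow> model (johnson_V n k) (johnson_E n k)"
| cocktail: "3 \<le> k \<Longrightarrow> model (cocktail_V k) (ck_E k)"
| halved: "5 \<le> n \<Longrightarrow> model (halved_V n) (halved_E n)"
| schlaefli: "model s0_V s0_E"
| gosset: "model gosset_V gosset_E"

lemma ck_rgraph: "k \<ge> 2 \<Longrightarrow> rgraph (cocktail_V k) (ck_E k)"
  by (rule iso_rgraph[OF ck_iso ck_simple cp_rgraph])

lemma model_rgraph: "model W F \<Longrightarrow> rgraph W F"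
  by (induction rule: model.induct) (simp_all add: johnson_rgraph ck_rgraph halved_rgraph s0_rgraph gosset_rgraph)

lemma model_family: assumes "model W F" shows "in_family W F"
proof -
  have sg: "simple_graph W F" using model_rgraph[OF assms] by (simp add: rgraph_def cgraph_def)
  have ck: "graph_iso (cocktail_V k) (ck_E k) (cocktail_V k) cocktail_E" for k
    unfolding graph_iso_def by (intro exI[of _ id]) (auto simp: ck_E_def)
  from assms show ?thesis
  proof cases
    case (cocktail k)
    then show ?thesis using sg ck unfolding in_family_def by blast
  next
    case schlaefli
    then show ?thesis using sg s0_srg unfolding in_family_def is_schlafli_def by blast
  qed (use sg graph_iso_refl in \<open>simp only: in_family_def, blast\<close>)+
qed

text \<open>Every factor thus adds at least 1 to the diameter of a product, which is how the number
  of factors gets bounded.\<close>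

lemma model_two: assumes "model W F" shows "\<exists>x\<in>W. \<exists>y\<in>W. x \<noteq> y"
proof -
  have s0: "\<exists>x\<in>s0_V. \<exists>y\<in>s0_V. x \<noteq> y"
  proof (rule ccontr)
    assume "\<not> ?thesis"
    then have "card s0_V \<le> 1" by (metis card_le_Suc0_iff_eq One_nat_def s0_simple simple_graph_def)
    then show False using s0_srg by (simp add: srg_def)
  qed
  then have g: "\<exists>x\<in>gosset_V. \<exists>y\<in>gosset_V. x \<noteq> y" by (auto simp: s0_V_def)
  have J: "\<exists>x\<in>johnson_V n k. \<exists>y\<in>johnson_V n k. x \<noteq> y" if "1 \<le> k" "k < n" for n k
  proof -
    have A: "{..<k} \<in> johnson_V n k" using that by (auto simp: johnson_V_def)
    have "insert k ({..<k} - {0}) \<in> johnson_V n k" using johnson_swap(1)[OF A, of 0 k] that by simp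
    moreover have "{..<k} \<noteq> insert k ({..<k} - {0})" by auto
    ultimately show ?thesis by (intro bexI[OF _ A] bexI)
  qed
  have C: "\<exists>x\<in>cocktail_V k. \<exists>y\<in>cocktail_V k. x \<noteq> y" if "k \<ge> 3" for k
  proof (intro bexI)
    show "{0} \<in> cocktail_V k" "{1} \<in> cocktail_V k" using that by (auto simp: cocktail_V_def)
  qed simp
  have H: "\<exists>x\<in>halved_V n. \<exists>y\<in>halved_V n. x \<noteq> y" if "n \<ge> 5" for n
  proof (intro bexI)
    show "{} \<in> halved_V n" "{0, 1} \<in> halved_V n" using that by (auto simp: halved_V_def)
  qed simp
  show ?thesis using assms by (induction rule: model.induct) (simp_all add: s0 g J C H)
qed

definition is_nbhd :: "'a set \<Rightarrow> ('a \<Rightarrow> 'a \<Rightarrow> bool) \<Rightarrow> bool" where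
  "is_nbhd L LE \<longleftrightarrow> (\<exists>W F b. model W F \<and> b \<in> W \<and> graph_iso L LE {u \<in> W. F b u} F)"

lemma nbhd_iso: "graph_iso L LE M ME \<Longrightarrow> is_nbhd M ME \<Longrightarrow> is_nbhd L LE"
  unfolding is_nbhd_def using graph_iso_trans by blast

lemma nbhd_grid: assumes "1 \<le> a" "1 \<le> b" shows "is_nbhd (grid_V a b) (grid_E a b)"
proof -
  have "model (johnson_V (a + b) a) (johnson_E (a + b) a)" using assms by (intro model.johnson) simp_all
  then show ?thesis unfolding is_nbhd_def using johnson_local by blast
qed

text \<open>A clique is a rook's graph with one column, i.e. a neighbourhood in the clique
  \<open>J(m + 1, m)\<close>.\<close>

lemma nbhd_complete:
  assumes fin: "finite L" and ne: "L \<noteq> {}" and LE: "\<And>u v. u \<in> L \<Longrightarrow> v \<in> L \<Longrightarrow> LE u v \<longleftrightarrow> u \<noteq> v"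
  shows "is_nbhd L LE"
proof (rule nbhd_iso)
  have "bij_betw (\<lambda>i. (i, 0)) {..<card L} (grid_V (card L) 1)" by (auto simp: bij_betw_def inj_on_def grid_V_def)
  moreover obtain f where f: "bij_betw f L {..<card L}" using ex_bij_betw_finite_nat[OF fin] by (auto simp: lessThan_atLeast0)
  ultimately have b: "bij_betw ((\<lambda>i. (i, 0)) \<circ> f) L (grid_V (card L) 1)" using bij_betw_trans by blast
  have "f u = f v \<longleftrightarrow> u = v" "f u < card L" if "u \<in> L" "v \<in> L" for u v
    using f that by (auto simp: bij_betw_def inj_on_def)
  then show "graph_iso L LE (grid_V (card L) 1) (grid_E (card L) 1)"
    by (intro graph_isoI[OF b]) (auto simp: LE grid_E_def grid_V_def)
  show "is_nbhd (grid_V (card L) 1) (grid_E (card L) 1)" using nbhd_grid[of "card L" 1] fin ne by (simp add: Suc_le_eq card_gt_0_iff)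
qed

lemma nbhd_two_cliques:
  assumes fin: "finite A" "finite B" and ne: "A \<noteq> {}" "B \<noteq> {}"
    and f: "bij_betw f L (A \<times> B)" and LE: "\<And>u v. u \<in> L \<Longrightarrow> v \<in> L \<Longrightarrow> LE u v \<longleftrightarrow> (fst (f u) = fst (f v)) \<noteq> (snd (f u) = snd (f v))"
  shows "is_nbhd L LE"
proof (rule nbhd_iso)
  obtain p where p: "bij_betw p A {..<card A}" using ex_bij_betw_finite_nat[OF fin(1)] by (auto simp: lessThan_atLeast0)
  obtain q where q: "bij_betw q B {..<card B}" using ex_bij_betw_finite_nat[OF fin(2)] by (auto simp: lessThan_atLeast0)
  have g: "bij_betw (map_prod p q \<circ> f) L (grid_V (card A) (card B))"
    using bij_betw_trans[OF f bij_betw_map_prod[OF p q]] by (simp add: grid_V_def)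
  have mem: "f u \<in> A \<times> B" if "u \<in> L" for u using f that by (auto simp: bij_betw_def)
  have pi: "p x = p y \<longleftrightarrow> x = y" if "x \<in> A" "y \<in> A" for x y using p that by (auto simp: bij_betw_def inj_on_def)
  have qi: "q x = q y \<longleftrightarrow> x = y" if "x \<in> B" "y \<in> B" for x y using q that by (auto simp: bij_betw_def inj_on_def)
  show "graph_iso L LE (grid_V (card A) (card B)) (grid_E (card A) (card B))"
  proof (rule graph_isoI[OF g])
    fix u v assume uv: "u \<in> L" "v \<in> L"
    have "(map_prod p q \<circ> f) u \<in> grid_V (card A) (card B)" "(map_prod p q \<circ> f) v \<in> grid_V (card A) (card B)"
      using g uv by (auto simp: bij_betw_def)
    moreover have "fst (f u) \<in> A" "fst (f v) \<in> A" "snd (f u) \<in> B" "snd (f v) \<in> B" using mem[OF uv(1)] mem[OF uv(2)] by auto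
    ultimately show "LE u v \<longleftrightarrow> grid_E (card A) (card B) ((map_prod p q \<circ> f) u) ((map_prod p q \<circ> f) v)"
      using LE[OF uv] pi qi by (simp add: grid_E_def)
  qed
  show "is_nbhd (grid_V (card A) (card B)) (grid_E (card A) (card B))"
    using fin ne by (intro nbhd_grid) (simp_all add: Suc_le_eq card_gt_0_iff)
qed

lemma nbhd_cp: assumes "k \<ge> 2" shows "is_nbhd {..<2 * k} (cp_E k)"
proof -
  have "0 \<in> {..<2 * Suc k}" by simp
  from local_transport_ex[OF ck_iso this] obtain b where b: "b \<in> cocktail_V (Suc k)"
    "graph_iso {u \<in> cocktail_V (Suc k). ck_E (Suc k) b u} (ck_E (Suc k)) {i \<in> {..<2 * Suc k}. cp_E (Suc k) 0 i} (cp_E (Suc k))" by blast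
  have "model (cocktail_V (Suc k)) (ck_E (Suc k))" using assms by (intro model.cocktail) simp
  then show ?thesis unfolding is_nbhd_def using b graph_iso_trans[OF cp_local graph_iso_sym[OF b(2)]] by blast
qed

text \<open>Both graphs are the octahedron: they have the 4-cycle as a neighbourhood, so
  \<open>local_iso\<close> identifies them. This covers the parameter of
  \<open>nbhd_johnson2\<close> at which the halved cube is not a model.\<close>

lemma johnson42: "graph_iso (johnson_V 4 2) (johnson_E 4 2) {..<2 * 3} (cp_E 3)"
proof -
  define f where "f = (\<lambda>(i, j). if i = j then i else 2 + i :: nat)"
  have g22: "grid_V 2 2 = {(0, 0), (0, 1), (1, 0), (1, 1)}" by (auto simp: grid_V_def)
  have b: "bij_betw f (grid_V 2 2) {..<2 * 2}"
  proof -
    have "{..<2 * 2} = {0, 1, 2, 3 :: nat}" by auto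
    then show ?thesis unfolding g22 by (auto simp: bij_betw_def f_def)
  qed
  have "graph_iso (grid_V 2 2) (grid_E 2 2) {..<2 * 2} (cp_E 2)"
  proof (rule graph_isoI[OF b])
    fix u v assume "u \<in> grid_V 2 2" "v \<in> grid_V 2 2"
    then show "grid_E 2 2 u v \<longleftrightarrow> cp_E 2 (f u) (f v)" unfolding grid_E_def unfolding g22 by (auto simp: cp_E_def f_def)
  qed
  from graph_iso_trans[OF graph_iso_sym[OF johnson_local(2)[of 2 2]] graph_iso_trans[OF this cp_local[of 2]]]
  have "graph_iso {A \<in> johnson_V 4 2. johnson_E 4 2 {..<2} A} (johnson_E 4 2) {i \<in> {..<2 * 3}. cp_E 3 0 i} (cp_E 3)"
    by (simp add: eval_nat_numeral)
  then obtain h where h: "bij_betw h {A \<in> johnson_V 4 2. johnson_E 4 2 {..<2} A} {i \<in> {..<2 * 3}. cp_E 3 0 i}"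
    "\<forall>u\<in>{A \<in> johnson_V 4 2. johnson_E 4 2 {..<2} A}. \<forall>v\<in>{A \<in> johnson_V 4 2. johnson_E 4 2 {..<2} A}. johnson_E 4 2 u v \<longleftrightarrow> cp_E 3 (h u) (h v)"
    unfolding graph_iso_def by blast
  interpret J: rgraph "johnson_V 4 2" "johnson_E 4 2" by (rule johnson_rgraph)
  interpret C: rgraph "{..<2 * 3}" "cp_E 3" by (rule cp_rgraph) simp
  interpret local_iso "johnson_V 4 2" "johnson_E 4 2" "{..<2 * 3}" "cp_E 3" "{..<2}" 0 h
  proof unfold_locales
    show "{..<2} \<in> johnson_V 4 2" using johnson_local(1)[of 2 2] by simp
    show "bij_betw h {A \<in> johnson_V 4 2. johnson_E 4 2 {..<2} A} {i \<in> {..<2 * 3}. cp_E 3 0 i}" by (rule h(1))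
    show "johnson_E 4 2 u v \<longleftrightarrow> cp_E 3 (h u) (h v)" if "johnson_E 4 2 {..<2} u" "johnson_E 4 2 {..<2} v" for u v
      using h(2) that J.E_in by blast
  qed simp
  show ?thesis by (rule iso)
qed

lemma johnson_complement:
  assumes "k \<le> n" shows "graph_iso (johnson_V n k) (johnson_E n k) (johnson_V n (n - k)) (johnson_E n (n - k))"
proof (rule graph_isoI)
  have mem: "{..<n} - A \<in> johnson_V n (n - k)" if "A \<in> johnson_V n k" for A k
    using that johnson_fin[OF that] by (auto simp: johnson_V_def card_Diff_subset)
  show "bij_betw (\<lambda>A. {..<n} - A) (johnson_V n k) (johnson_V n (n - k))"
    by (rule bij_betw_byWitness[of _ "\<lambda>A. {..<n} - A"])
      (use mem mem[of _ "n - k"] assms in \<open>auto simp: johnson_V_def double_diff\<close>)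
  fix A B assume A: "A \<in> johnson_V n k" and B: "B \<in> johnson_V n k"
  have "({..<n} - A) - ({..<n} - B) = B - A" using A B by (auto simp: johnson_V_def)
  then show "johnson_E n k A B \<longleftrightarrow> johnson_E n (n - k) ({..<n} - A) ({..<n} - B)"
    using johnson_E_card[OF A B] johnson_E_card[OF mem[OF A] mem[OF B]] johnson_card_diff(2)[OF A B] by simp
qed

lemma nbhd_johnson2: assumes "n \<ge> 4" shows "is_nbhd (johnson_V n 2) (johnson_E n 2)"
proof (cases "n = 4")
  case True
  then show ?thesis using nbhd_iso[OF johnson42 nbhd_cp[of 3]] by simp
next
  case False
  then have "model (halved_V n) (halved_E n)" using assms by (intro model.halved) simp
  then show ?thesis unfolding is_nbhd_def using halved_local by blast
qed

lemma johnson_clique: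
  assumes k: "k \<le> 1 \<or> n - k \<le> 1" and u: "u \<in> johnson_V n k" and v: "v \<in> johnson_V n k"
  shows "johnson_E n k u v \<longleftrightarrow> u \<noteq> v"
proof -
  note fin = johnson_fin[OF u] johnson_fin[OF v]
  have sub: "u \<subseteq> {..<n}" "card u = k" "v \<subseteq> {..<n}" "card v = k" using u v by (auto simp: johnson_V_def)
  have "card (u - v) \<le> card u" using fin by (intro card_mono) auto
  moreover have "card (u - v) \<le> card ({..<n} - v)" using sub by (intro card_mono) auto
  moreover have "card ({..<n} - v) = n - k" using sub fin by (simp add: card_Diff_subset)
  ultimately have "card (u - v) \<le> 1" using k sub by linarith
  moreover have "card (u - v) = 0 \<longleftrightarrow> u = v"
  proof
    assume "card (u - v) = 0"
    then have "u \<subseteq> v" using fin by simp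
    then show "u = v" using card_subset_eq[OF fin(2)] sub by simp
  qed simp
  ultimately show ?thesis using johnson_E_card[OF u v] by linarith
qed

text \<open>The models that are not neighbourhoods are excluded by two vertices at distance three:
  \<open>k\<close>-sets with all but three elements in common, the empty set and a 6-set, or
  antipodes of the Gosset graph.\<close>

lemma nbhd_model:
  assumes m: "model W F" and diam: "\<And>x y. x \<in> W \<Longrightarrow> y \<in> W \<Longrightarrow> gdist W F x y \<le> 2"
  shows "is_nbhd W F"
  using m
proof cases
  case (johnson k n)
  note W = johnson(1,2) and k = johnson(3,4)
  have fin: "finite W" using johnson_simple unfolding W by (simp add: simple_graph_def)
  have O: "{..<k} \<in> johnson_V n k" using k by (auto simp: johnson_V_def)
  consider "k = 1" | "n - k = 1" | "k = 2" "n \<ge> 4" | "n - k = 2" "n \<ge> 4" | "k \<ge> 3" "n - k \<ge> 3" using k by linarith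
  then show ?thesis
  proof cases
    case 5
    let ?B = "{3..<k + 3}"
    have "?B \<in> johnson_V n k" using 5 by (auto simp: johnson_V_def)
    moreover have "{..<k} - ?B = {..<3}" using 5 by auto
    ultimately show ?thesis using diam[unfolded W, OF O, of ?B] johnson_gdist[OF O, of ?B] by simp
  next
    case 3
    then show ?thesis using nbhd_johnson2 W by simp
  next
    case 4
    then show ?thesis using nbhd_iso[OF johnson_complement[of k n]] nbhd_johnson2[of n] k W by simp
  next
    case 1
    then have "F u v \<longleftrightarrow> u \<noteq> v" if "u \<in> W" "v \<in> W" for u v using johnson_clique that W by simp
    then show ?thesis using nbhd_complete[OF fin] O W by blast
  next
    case 2
    then have "F u v \<longleftrightarrow> u \<noteq> v" if "u \<in> W" "v \<in> W" for u v using johnson_clique that W by simp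
    then show ?thesis using nbhd_complete[OF fin] O W by blast
  qed
next
  case (cocktail k)
  then show ?thesis using nbhd_iso[OF ck_iso nbhd_cp[of k]] by simp
next
  case (halved n)
  note W = halved(1,2) and n = halved(3)
  show ?thesis
  proof (cases "n = 5")
    case True
    obtain b where b: "b \<in> s0_V" "graph_iso {u \<in> s0_V. s0_E b u} s0_E {u \<in> sV. sE gu u} sE"
      using local_transport_ex[OF s0_iso gu_sV] by blast
    have "graph_iso W F {u \<in> s0_V. s0_E b u} s0_E"
      unfolding W True by (rule graph_iso_trans[OF sE_local graph_iso_sym[OF b(2)]])
    then show ?thesis unfolding is_nbhd_def using b(1) model.schlaefli by blast
  next
    case False
    then have "{} \<in> halved_V n" "{..<6} \<in> halved_V n" using n by (auto simp: halved_V_def)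
    then show ?thesis using diam[of "{}" "{..<6}"] halved_gdist[of "{}" n "{..<6}"] by (simp add: W)
  qed
next
  case schlaefli
  have "graph_iso s0_V s0_E {u \<in> gosset_V. gosset_E {0, 1} u} gosset_E"
    unfolding s0_V_def[symmetric] by (intro graph_isoI[of id]) (auto simp: s0_E_def)
  then show ?thesis unfolding is_nbhd_def schlaefli using base_in model.gosset by blast
next
  case gosset
  have cg: "cgraph gV gE" using gE_rgraph by (rule rgraph.axioms(1))
  have G: "(False, {0, 1}) \<in> gV" "(True, {0, 1}) \<in> gV" by (auto simp: gV_def johnson_V_def)
  have "gV = gpair ` gosset_V" using gpair_bij by (simp add: bij_betw_def)
  then obtain A B where AB: "A \<in> gosset_V" "gpair A = (False, {0, 1})" "B \<in> gosset_V" "gpair B = (True, {0, 1})" using G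
    by (metis imageE)
  have "gdist gosset_V gosset_E A B = gdist gV gE (gpair A) (gpair B)"
    by (rule iso_gdist(2)[OF gosset_simple cg gpair_bij gpair_E AB(1,3)])
  also have "\<dots> = gdel (gpair A) (gpair B)" using AB G gE_gdist by simp
  also have "\<dots> = 3" using AB by (simp add: gdel_def)
  finally show ?thesis using diam[of A B] AB gosset by simp
qed

subsection \<open>The classification\<close>

lemma rgraph_listI: "(\<And>H. H \<in> set gs \<Longrightarrow> rgraph (fst H) (snd H)) \<Longrightarrow> rgraph_list gs"
  by (rule rgraph_list.intro) simp

text \<open>Distances add, so two tuples that differ in all the other coordinates spend at least one
  unit on each of them.\<close>

lemma prod_diam:
  assumes r: "\<And>i. i < length gs \<Longrightarrow> rgraph (fst (gs ! i)) (snd (gs ! i))"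
    and two: "\<And>i. i < length gs \<Longrightarrow> \<exists>x\<in>fst (gs ! i). \<exists>y\<in>fst (gs ! i). x \<noteq> y"
    and diam: "\<And>xs ys. xs \<in> prod_V gs \<Longrightarrow> ys \<in> prod_V gs \<Longrightarrow> gdist (prod_V gs) (prod_E gs) xs ys \<le> 2"
    and i: "i < length gs" and x: "x \<in> fst (gs ! i)" and y: "y \<in> fst (gs ! i)"
  shows "gdist (fst (gs ! i)) (snd (gs ! i)) x y + (length gs - 1) \<le> 2"
proof -
  interpret rgraph_list gs by (rule rgraph_list.intro) (rule r)
  have "\<forall>j. \<exists>p q. j < length gs \<longrightarrow> p \<in> fst (gs ! j) \<and> q \<in> fst (gs ! j) \<and> p \<noteq> q" using two by blast
  then obtain p where "\<forall>j. \<exists>q. j < length gs \<longrightarrow> p j \<in> fst (gs ! j) \<and> q \<in> fst (gs ! j) \<and> p j \<noteq> q"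
    by (rule choice[THEN exE])
  then obtain q where a: "\<And>j. j < length gs \<Longrightarrow> p j \<in> fst (gs ! j) \<and> q j \<in> fst (gs ! j) \<and> p j \<noteq> q j"
    by (rule choice[THEN exE]) blast
  let ?g = "\<lambda>j. gdist (fst (gs ! j)) (snd (gs ! j))"
  define xs where "xs = (map (\<lambda>j. p j) [0..<length gs])[i := x]"
  define ys where "ys = (map (\<lambda>j. q j) [0..<length gs])[i := y]"
  have nth: "xs ! j = (if j = i then x else p j)" "ys ! j = (if j = i then y else q j)" if "j < length gs" for j
    using that by (simp_all add: xs_def ys_def nth_list_update)
  have mem: "xs \<in> prod_V gs" "ys \<in> prod_V gs"
    using nth a x y by (auto simp: prod_V_def) (auto simp: xs_def ys_def)
  have "(\<Sum>j\<in>{..<length gs} - {i}. 1) \<le> (\<Sum>j\<in>{..<length gs} - {i}. ?g j (xs ! j) (ys ! j))"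
  proof (intro sum_mono)
    fix j assume j: "j \<in> {..<length gs} - {i}"
    interpret F: rgraph "fst (gs ! j)" "snd (gs ! j)" using r j by simp
    show "1 \<le> ?g j (xs ! j) (ys ! j)"
      using F.d_eq0[of "p j" "q j"] a[of j] j nth[of j] by (simp add: gd_def Suc_le_eq)
  qed
  moreover have "prod_dist gs xs ys = ?g i x y + (\<Sum>j\<in>{..<length gs} - {i}. ?g j (xs ! j) (ys ! j))"
    unfolding prod_dist_def using i nth[OF i] by (subst sum.remove[of _ i]) auto
  moreover have "prod_dist gs xs ys \<le> 2" using diam[OF mem] prod_gdist[OF mem] by simp
  moreover have "(\<Sum>j\<in>{..<length gs} - {i}. 1) = length gs - 1" using i by simp
  ultimately show ?thesis by linarith
qed

text \<open>At most two nontrivial factors fit into diameter two. No factor means a single vertex,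
  one factor is \<open>nbhd_model\<close>, and of two factors each has diameter one, which makes the
  product a rook's graph.\<close>

lemma nbhd_prod:
  assumes m: "\<And>H. H \<in> set gs \<Longrightarrow> model (fst H) (snd H)"
    and diam: "\<And>xs ys. xs \<in> prod_V gs \<Longrightarrow> ys \<in> prod_V gs \<Longrightarrow> gdist (prod_V gs) (prod_E gs) xs ys \<le> 2"
  shows "is_nbhd (prod_V gs) (prod_E gs)"
proof -
  have mi: "model (fst (gs ! i)) (snd (gs ! i))" if "i < length gs" for i using m that by simp
  have dm: "gdist (fst (gs ! i)) (snd (gs ! i)) x y + (length gs - 1) \<le> 2"
    if "i < length gs" "x \<in> fst (gs ! i)" "y \<in> fst (gs ! i)" for i x y
    using prod_diam[of gs, OF model_rgraph[OF mi] model_two[OF mi] diam that] by blast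
  have "length gs \<le> 2"
  proof (rule ccontr)
    assume l: "\<not> length gs \<le> 2"
    then have "0 < length gs" by linarith
    then obtain x y where xy: "x \<in> fst (gs ! 0)" "y \<in> fst (gs ! 0)" "x \<noteq> y" using model_two[OF mi] by blast
    interpret rgraph "fst (gs ! 0)" "snd (gs ! 0)" by (rule model_rgraph[OF mi[OF \<open>0 < length gs\<close>]])
    have "gdist (fst (gs ! 0)) (snd (gs ! 0)) x y \<noteq> 0" using d_eq0[OF xy(1,2)] xy(3) by (simp add: gd_def)
    then show False using dm[OF \<open>0 < length gs\<close> xy(1,2)] l by linarith
  qed
  then consider "gs = []" | A where "gs = [A]" | A B where "gs = [A, B]"
    by (cases gs rule: remdups_adj.cases) auto
  then show ?thesis
  proof cases
    case 1
    have "prod_V gs = {[]}" "\<not> prod_E gs [] []" by (auto simp: 1 prod_V_def prod_E_def)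
    then show ?thesis by (intro nbhd_complete) auto
  next
    case (2 A)
    have mA: "model (fst A) (snd A)" using m 2 by simp
    have "is_nbhd (fst A) (snd A)" using dm[of 0] 2 by (intro nbhd_model[OF mA]) auto
    moreover have "graph_iso (prod_V gs) (prod_E gs) (fst A) (snd A)"
      using prod_single[of "fst A" "snd A"] model_rgraph[OF mA] 2 by (simp add: rgraph_def cgraph_def)
    ultimately show ?thesis using nbhd_iso by blast
  next
    case (3 A B)
    have AB: "model (fst A) (snd A)" "model (fst B) (snd B)" using m 3 by simp_all
    interpret A: rgraph "fst A" "snd A" by (rule model_rgraph[OF AB(1)])
    interpret B: rgraph "fst B" "snd B" by (rule model_rgraph[OF AB(2)])
    have cA: "snd A u v \<longleftrightarrow> u \<noteq> v" if "u \<in> fst A" "v \<in> fst A" for u v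
    proof -
      have "gdist (fst A) (snd A) u v \<le> 1" using dm[of 0 u v] 3 that by simp
      then have "A.d u v = 0 \<or> A.d u v = 1" unfolding gd_def by linarith
      then show ?thesis using A.d_eq0[OF that] A.d_eq1[OF that] A.E_irrefl by auto
    qed
    have cB: "snd B u v \<longleftrightarrow> u \<noteq> v" if "u \<in> fst B" "v \<in> fst B" for u v
    proof -
      have "gdist (fst B) (snd B) u v \<le> 1" using dm[of 1 u v] 3 that by simp
      then have "B.d u v = 0 \<or> B.d u v = 1" unfolding gd_def by linarith
      then show ?thesis using B.d_eq0[OF that] B.d_eq1[OF that] B.E_irrefl by auto
    qed
    let ?f = "\<lambda>xs. (xs ! 0, xs ! 1)"
    have P: "prod_V gs = (\<lambda>(a, b). [a, b]) ` (fst A \<times> fst B)"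
    proof (intro equalityI subsetI)
      fix xs assume xs: "xs \<in> prod_V gs"
      then have "length xs = 2" using prod_V_length 3 by fastforce
      then obtain a b where "xs = [a, b]" by (metis One_nat_def Suc_1 length_0_conv length_Suc_conv)
      moreover have "xs ! 0 \<in> fst A" "xs ! 1 \<in> fst B" using prod_V_nth[OF xs, of 0] prod_V_nth[OF xs, of 1] 3 by simp_all
      ultimately show "xs \<in> (\<lambda>(a, b). [a, b]) ` (fst A \<times> fst B)" by auto
    next
      fix xs assume "xs \<in> (\<lambda>(a, b). [a, b]) ` (fst A \<times> fst B)"
      then show "xs \<in> prod_V gs" by (auto simp: 3 prod_V_def less_Suc_eq)
    qed
    have bij: "bij_betw ?f (prod_V gs) (fst A \<times> fst B)"
      by (rule bij_betw_byWitness[of _ "\<lambda>(a, b). [a, b]"]) (auto simp: P)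
    have ne: "fst A \<noteq> {}" "fst B \<noteq> {}" using model_two AB by blast+
    show ?thesis
    proof (rule nbhd_two_cliques[OF A.finV B.finV ne bij])
      fix u v assume uv: "u \<in> prod_V gs" "v \<in> prod_V gs"
      then obtain a b a' b' where e: "u = [a, b]" "v = [a', b']" "a \<in> fst A" "b \<in> fst B" "a' \<in> fst A" "b' \<in> fst B"
        unfolding P by auto
      have ex: "(\<exists>i<length gs. P i) \<longleftrightarrow> P 0 \<or> P 1" "(\<forall>i<length gs. P i) \<longleftrightarrow> P 0 \<and> P 1" for P
        by (auto simp: 3 less_Suc_eq)
      have "prod_E gs u v \<longleftrightarrow> (snd A a a' \<and> b = b') \<or> (snd B b b' \<and> a = a')"
        unfolding prod_E_def ex using uv by (simp add: 3 e(1,2))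
      then show "prod_E gs u v \<longleftrightarrow> (fst (?f u) = fst (?f v)) \<noteq> (snd (?f u) = snd (?f v))"
        using cA[OF e(3,5)] cB[OF e(4,6)] by (auto simp: e(1,2))
    qed
  qed
qed

text \<open>Each component of the neighbourhood of \<open>b\<close> is the neighbourhood of a point
  in some model. In the product of these models the neighbourhood of the tuple of chosen points is
  the disjoint union of the components, so \<open>local_iso\<close> applies.\<close>

lemma (in rgraph) neighbourhood_product:
  assumes b: "b \<in> V" and L: "\<And>u. E b u \<Longrightarrow> is_nbhd (comp b u) (sub (comp b u))"
  shows "\<exists>gs. (\<forall>H\<in>set gs. model (fst H) (snd H)) \<and> graph_iso V E (prod_V gs) (prod_E gs)"
proof -
  let ?Cs = "comp b ` nb b"
  obtain Cl where Cl: "set Cl = ?Cs" "distinct Cl" using finite_distinct_list[of ?Cs] finV by auto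
  \<comment> \<open>Graph, base point and isomorphism are bundled so that one choice per component
    fixes all of them consistently.\<close>
  define Q where "Q C t \<longleftrightarrow> (case t of (W, F, w, h) \<Rightarrow> model W F \<and> w \<in> W \<and> bij_betw h C {u \<in> W. F w u}
    \<and> (\<forall>u\<in>C. \<forall>v\<in>C. E u v \<longleftrightarrow> F (h u) (h v)))" for C t
  have "\<exists>t. Q C t" if "C \<in> ?Cs" for C
  proof -
    have "is_nbhd C (sub C)" using L that by blast
    then obtain W F w h where "model W F" "w \<in> W" "bij_betw h C {u \<in> W. F w u}"
      "\<forall>u\<in>C. \<forall>v\<in>C. sub C u v \<longleftrightarrow> F (h u) (h v)" unfolding is_nbhd_def graph_iso_def by blast
    then have "Q C (W, F, w, h)" unfolding Q_def prod.case by blast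
    then show ?thesis by blast
  qed
  then obtain T where T: "\<And>C. C \<in> ?Cs \<Longrightarrow> Q C (T C)" by metis
  define W where "W C = fst (T C)" for C
  define F where "F C = fst (snd (T C))" for C
  define w where "w C = fst (snd (snd (T C)))" for C
  define h where "h C = snd (snd (snd (T C)))" for C
  have "T C = (W C, F C, w C, h C)" for C by (simp add: W_def F_def w_def h_def)
  then have Q: "Q C (W C, F C, w C, h C)" if "C \<in> ?Cs" for C using T[OF that] by simp
  have M: "\<And>C. C \<in> ?Cs \<Longrightarrow> model (W C) (F C)" "\<And>C. C \<in> ?Cs \<Longrightarrow> w C \<in> W C"
    "\<And>C. C \<in> ?Cs \<Longrightarrow> bij_betw (h C) C {u \<in> W C. F C (w C) u}"
    "\<And>C u v. C \<in> ?Cs \<Longrightarrow> u \<in> C \<Longrightarrow> v \<in> C \<Longrightarrow> E u v \<longleftrightarrow> F C (h C u) (h C v)"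
    using Q[unfolded Q_def prod.case] by blast+
  define gs where "gs = map (\<lambda>C. (W C, F C)) Cl"
  define os where "os = map w Cl"
  have len: "length gs = length Cl" "length os = length Cl" by (simp_all add: gs_def os_def)
  have C: "Cl ! i \<in> ?Cs" if "i < length Cl" for i using that Cl(1) by (metis nth_mem)
  have gsi: "fst (gs ! i) = W (Cl ! i)" "snd (gs ! i) = F (Cl ! i)" "os ! i = w (Cl ! i)" if "i < length Cl" for i
    using that by (simp_all add: gs_def os_def)
  interpret P: rgraph_list gs
    by (rule rgraph_list.intro) (use model_rgraph[OF M(1)[OF C]] gsi len in simp)
  interpret R: rgraph "prod_V gs" "prod_E gs" by (rule P.prod_rgraph)
  have os: "os \<in> prod_V gs" unfolding prod_V_def using M(2)[OF C] gsi len by simp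
  define idx where "idx u = (SOME i. i < length Cl \<and> Cl ! i = comp b u)" for u
  have idx: "idx u < length Cl" "Cl ! idx u = comp b u" if u: "E b u" for u
  proof -
    have "comp b u \<in> set Cl" using u E_in Cl(1) by blast
    then have "\<exists>i. i < length Cl \<and> Cl ! i = comp b u" by (simp add: in_set_conv_nth)
    then show "idx u < length Cl" "Cl ! idx u = comp b u" unfolding idx_def by (metis (mono_tags, lifting) someI_ex)+
  qed
  have idx_eq: "idx u = i" if "E b u" "i < length Cl" "Cl ! i = comp b u" for u i
    using idx[OF that(1)] that Cl(2) nth_eq_iff_index_eq by metis
  \<comment> \<open>A neighbour of \<open>b\<close> moves only the coordinate of its own component
    away from the base tuple.\<close>
  define g where "g u = os[idx u := h (comp b u) u]" for u
  have Cu: "comp b u \<in> ?Cs" if "E b u" for u using that E_in by blast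
  have hu: "F (comp b u) (w (comp b u)) (h (comp b u) u)" if "E b u" for u
    using bij_betwE[OF M(3)[OF Cu[OF that]]] comp_self by blast
  have nbg: "prod_E gs os (g u)" if u: "E b u" for u
    unfolding g_def using P.prod_E_update[OF os, of "idx u"] idx[OF u] gsi len hu[OF u] by simp
  have gn: "g u ! idx u = h (comp b u) u" "g u ! j = os ! j" if "E b u" "j \<noteq> idx u" for u j
    using idx[OF that(1)] len that(2) by (simp_all add: g_def)
  have gn1: "g u ! idx u = h (comp b u) u" if "E b u" for u using idx[OF that] len by (simp add: g_def)
  have hne: "h (comp b u) u \<noteq> os ! idx u" if u: "E b u" for u
  proof -
    have "simple_graph (W (comp b u)) (F (comp b u))"
      using model_rgraph[OF M(1)[OF Cu[OF u]]] by (simp add: rgraph_def cgraph_def)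
    then show ?thesis using hu[OF u] gsi(3)[OF idx(1)[OF u]] idx(2)[OF u] unfolding simple_graph_def by metis
  qed
  have same: "comp b u = comp b v" if "E b u" "E b v" "idx u = idx v" for u v
    using idx[OF that(1)] idx[OF that(2)] that(3) by simp
  interpret I: local_iso V E "prod_V gs" "prod_E gs" b os g
  proof unfold_locales
    show "b \<in> V" by (rule b)
    show "os \<in> prod_V gs" by (rule os)
    show "bij_betw g (nb b) {u \<in> prod_V gs. prod_E gs os u}"
      unfolding bij_betw_def
    proof
      show "inj_on g (nb b)"
      proof (rule inj_onI)
        fix u v assume u: "u \<in> nb b" and v: "v \<in> nb b" and e: "g u = g v"
        have "idx u = idx v"
        proof (rule ccontr)
          assume "idx u \<noteq> idx v"
          then have "h (comp b u) u = os ! idx u" using gn1[of u] gn(2)[of v "idx u"] u v e by simp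
          then show False using hne u by blast
        qed
        then have c: "comp b u = comp b v" using same u v by blast
        have "h (comp b u) u = h (comp b u) v" using gn1[of u] gn1[of v] u v e c \<open>idx u = idx v\<close> by simp
        moreover have "u \<in> comp b u" "v \<in> comp b u" using comp_self c by auto
        ultimately show "u = v" using M(3)[OF Cu] u unfolding bij_betw_def inj_on_def by blast
      qed
      show "g ` nb b = {u \<in> prod_V gs. prod_E gs os u}"
      proof (intro equalityI subsetI)
        fix zs assume "zs \<in> {u \<in> prod_V gs. prod_E gs os u}"
        then obtain i v where i: "i < length Cl" "snd (gs ! i) (os ! i) v" "zs = os[i := v]"
          using P.prod_E_iff len by auto
        have Fi: "F (Cl ! i) (w (Cl ! i)) v" using i gsi by simp
        have "v \<in> W (Cl ! i)"
          using Fi model_rgraph[OF M(1)[OF C[OF i(1)]]] by (auto simp: rgraph_def cgraph_def simple_graph_def)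
        then have "v \<in> h (Cl ! i) ` (Cl ! i)" using Fi bij_betw_imp_surj_on[OF M(3)[OF C[OF i(1)]]] by blast
        then obtain u where u: "u \<in> Cl ! i" "v = h (Cl ! i) u" by blast
        obtain u0 where u0: "E b u0" "Cl ! i = comp b u0" using C[OF i(1)] by blast
        have Eu: "E b u" using comp_nb u u0 by simp
        have cu: "comp b u = Cl ! i" using comp_eq u u0 by simp
        then have "idx u = i" using idx_eq Eu i(1) by simp
        then have "zs = g u" using i(3) u cu by (simp add: g_def)
        then show "zs \<in> g ` nb b" using Eu E_in by blast
      qed (use nbg in \<open>auto simp: prod_E_def\<close>)
    qed
    show "E u v \<longleftrightarrow> prod_E gs (g u) (g v)" if u: "E b u" and v: "E b v" for u v
    proof (cases "idx u = idx v")
      case True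
      then have c: "comp b u = comp b v" using same u v by blast
      have gu: "g u \<in> prod_V gs" using nbg[OF u] by (simp add: prod_E_def)
      have "g v = (g u)[idx u := h (comp b u) v]" using True c by (simp add: g_def)
      then have "prod_E gs (g u) (g v) \<longleftrightarrow> F (comp b u) (h (comp b u) u) (h (comp b u) v)"
        using P.prod_E_update[OF gu, of "idx u"] idx[OF u] gsi len gn1[OF u] by simp
      also have "\<dots> \<longleftrightarrow> E u v" using M(4)[OF Cu[OF u], of u v] comp_self c by blast
      finally show ?thesis by simp
    next
      case False
      have "\<not> E u v"
      proof
        assume "E u v"
        then have "v \<in> comp b u" using comp_step[OF comp_self u v] by blast
        then have "comp b v = comp b u" by (rule comp_eq)
        then show False using False idx_eq[OF v idx(1)[OF u]] idx(2)[OF u] by simp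
      qed
      \<comment> \<open>The two tuples differ in two coordinates, since each has left the base tuple
        where the other has not.\<close>
      moreover have "\<not> prod_E gs (g u) (g v)"
      proof
        assume "prod_E gs (g u) (g v)"
        then obtain k where k: "\<forall>j<length Cl. j \<noteq> k \<longrightarrow> g u ! j = g v ! j" unfolding prod_E_def len(1) by blast
        have "g u ! idx u \<noteq> g v ! idx u" using gn1[OF u] gn(2)[OF v False] hne[OF u] by simp
        moreover have "g u ! idx v \<noteq> g v ! idx v" using gn1[OF v] gn(2)[OF u] False hne[OF v] by metis
        ultimately show False using k idx(1)[OF u] idx(1)[OF v] False by metis
      qed
      ultimately show ?thesis by simp
    qed
  qed
  have "model (fst H) (snd H)" if "H \<in> set gs" for H using that M(1) Cl(1) by (auto simp: gs_def)
  then show ?thesis using I.iso by blast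
qed

theorem rgraph_classification:
  assumes "rgraph V E" "V \<noteq> {}"
  shows "\<exists>gs. (\<forall>H\<in>set gs. model (fst H) (snd H)) \<and> graph_iso V E (prod_V gs) (prod_E gs)"
  using assms
proof (induction "card V" arbitrary: V E rule: less_induct)
  case less
  interpret rgraph V E by (rule less.prems)
  obtain b where b: "b \<in> V" using less.prems by blast
  show ?case
  proof (rule neighbourhood_product[OF b])
    fix u assume u: "E b u"
    let ?C = "comp b u"
    \<comment> \<open>Omitting \<open>b\<close> makes the component smaller, as the induction
      requires.\<close>
    have "?C \<subseteq> V - {b}" using comp_nb[OF u] E_in E_irrefl by blast
    then have "card ?C < card V" using b finV by (metis card_Diff1_less card_mono finite_Diff le_less_trans)
    moreover note comp_rgraph[OF u]
    moreover have "?C \<noteq> {}" using comp_self by blast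
    ultimately obtain gs where gs: "\<And>H. H \<in> set gs \<Longrightarrow> model (fst H) (snd H)" "graph_iso ?C (sub ?C) (prod_V gs) (prod_E gs)"
      using less.hyps[of ?C "sub ?C"] by blast
    \<comment> \<open>This bound restricts the product found by induction to the shapes treated in
      \<open>nbhd_prod\<close>.\<close>
    have d2: "gdist ?C (sub ?C) x y \<le> 2" if "x \<in> ?C" "y \<in> ?C" for x y
    proof -
      have "d x y \<le> 2" using d_nb[of b x y] comp_nb[OF u] that by auto
      then show ?thesis using comp_rgraph(2)[OF u that] by (simp add: gd_def)
    qed
    interpret R: rgraph_list gs by (rule rgraph_listI) (rule model_rgraph[OF gs(1)])
    interpret C: rgraph ?C "sub ?C" by (rule comp_rgraph(1)[OF u])
    obtain k where k: "bij_betw k (prod_V gs) ?C" "\<forall>xs\<in>prod_V gs. \<forall>ys\<in>prod_V gs. prod_E gs xs ys \<longleftrightarrow> sub ?C (k xs) (k ys)"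
      using graph_iso_sym[OF gs(2)] unfolding graph_iso_def by blast
    have "is_nbhd (prod_V gs) (prod_E gs)"
    proof (rule nbhd_prod[OF gs(1)])
      fix xs ys assume xy: "xs \<in> prod_V gs" "ys \<in> prod_V gs"
      have "gdist (prod_V gs) (prod_E gs) xs ys = gdist ?C (sub ?C) (k xs) (k ys)"
        by (rule iso_gdist(2)[OF R.prod_simple C.cgraph_axioms k(1) _ xy]) (use k(2) in blast)
      then show "gdist (prod_V gs) (prod_E gs) xs ys \<le> 2" using d2 bij_betwE[OF k(1)] xy by simp
    qed
    then show "is_nbhd ?C (sub ?C)" using nbhd_iso[OF gs(2)] by blast
  qed
qed

subsection \<open>The listed graphs are reflective of constant curvature\<close>

lemma no_edges_constant: "(\<And>x y. \<not> E x y) \<Longrightarrow> constant_curvature V E c"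
  by (simp add: constant_curvature_def)

text \<open>For proper parameters the neighbourhood is a rook's graph, hence connected; for the
  others there are no edges.\<close>

lemma johnson_constant: "\<exists>c. constant_curvature (johnson_V n k) (johnson_E n k) c"
proof (cases "1 \<le> k \<and> k < n")
  case True
  then have n: "k + (n - k) = n" by simp
  show ?thesis
    using constant_if_local[OF johnson_rgraph johnson_local(1) graph_iso_sym[OF johnson_local(2)] grid_cgraph, of k "n - k"]
    unfolding n .
next
  case False
  have "\<not> johnson_E n k A B" for A B
  proof
    assume E: "johnson_E n k A B"
    then obtain a b where ab: "a \<in> A" "b \<notin> A" "b < n" by (rule johnson_E_swap)
    have A: "A \<in> johnson_V n k" using E by (simp add: johnson_E_def)
    then have s: "A \<subseteq> {..<n}" "card A = k" by (auto simp: johnson_V_def)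
    have "card A \<noteq> 0" using ab(1) johnson_fin[OF A] by auto
    moreover have "card A < card {..<n}" using s ab by (intro psubset_card_mono) auto
    ultimately show False using False s by simp
  qed
  then show ?thesis using no_edges_constant by blast
qed

lemma cp_constant: assumes "k \<ge> 2" shows "\<exists>c. constant_curvature {..<2 * k} (cp_E k) c"
proof (cases "k = 2")
  case True
  then show ?thesis using cp_constant_two by blast
next
  case False
  then obtain m where m: "k = Suc m" "m \<ge> 2" using assms by (cases k) auto
  have cg: "cgraph {..<2 * m} (cp_E m)" using cp_rgraph[OF m(2)] by (rule rgraph.axioms(1))
  have "0 \<in> {..<2 * k}" using assms by simp
  then show ?thesis
    using constant_if_local[OF cp_rgraph[OF assms] _ _ cg, of 0] graph_iso_sym[OF cp_local[of m]] unfolding m(1) by blast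
qed

text \<open>Connectedness and nonemptiness exclude \<open>CP(0)\<close> and \<open>CP(1)\<close>.
  The Schlaefli case is argued for every graph with the parameters, by its collinearity geometry;
  the others are transported from the concrete graphs.\<close>

lemma family_rgraph:
  assumes f: "in_family W F" and con: "connected_graph W F" and ne: "W \<noteq> {}"
  shows "rgraph W F" "\<exists>c. constant_curvature W F c"
proof -
  have sg: "simple_graph W F" using f by (simp add: in_family_def)
  have cg: "cgraph W F" using sg con by unfold_locales
  have both: "rgraph W F \<and> (\<exists>c. constant_curvature W F c)"
    if "graph_iso W F X H" "rgraph X H" "\<exists>c. constant_curvature X H c" for X :: "'c set" and H
    using iso_rgraph[OF that(1) sg that(2)] iso_constant[OF that(1) _ that(2)] that(3) by blast
  consider k where "graph_iso W F (cocktail_V k) cocktail_E" | n k where "graph_iso W F (johnson_V n k) (johnson_E n k)"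
    | n where "graph_iso W F (halved_V n) (halved_E n)" | "is_schlafli W F" | "graph_iso W F gosset_V gosset_E"
    using f unfolding in_family_def by blast
  then have "rgraph W F \<and> (\<exists>c. constant_curvature W F c)"
  proof cases
    case (1 k)
    have iso: "graph_iso W F {..<2 * k} (cp_E k)" using graph_iso_trans[OF 1 cocktail_iso] .
    have "k \<noteq> 0"
    proof
      assume "k = 0"
      then have "card W = 0" using graph_iso_card[OF iso] by simp
      then show False using ne sg by (simp add: simple_graph_def)
    qed
    moreover have "k \<noteq> 1"
    proof
      assume k: "k = 1"
      interpret C: cgraph "{..<2 * k}" "cp_E k" by (rule iso_cgraph[OF graph_iso_sym[OF iso] cp_simple cg])
      obtain x y where xy: "cp_E k x y" using C.ex_edge k by auto
      then have "x < 2" "y < 2" using k by (simp_all add: cp_E_def)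
      then have "x div 2 = 0" "y div 2 = 0" by simp_all
      then show False using xy by (simp add: cp_E_def)
    qed
    ultimately have "k \<ge> 2" by linarith
    then show ?thesis using both[OF iso cp_rgraph cp_constant] by blast
  next
    case (2 n k)
    then show ?thesis using both[OF 2 johnson_rgraph johnson_constant] by blast
  next
    case (3 n)
    have "cgraph (johnson_V n 2) (johnson_E n 2)" using johnson_rgraph[of n 2] by (rule rgraph.axioms(1))
    then show ?thesis
      using both[OF 3 halved_rgraph constant_if_local[OF halved_rgraph halved_local(1) graph_iso_sym[OF halved_local(2)]]] by blast
  next
    case 4
    then interpret schlafli W F by unfold_locales (simp add: is_schlafli_def)
    show ?thesis using rgraph curvature_twelve by blast
  next
    case 5
    have s: "graph_iso {A \<in> gosset_V. gosset_E {0, 1} A} gosset_E s0_V s0_E"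
      unfolding s0_V_def[symmetric] by (intro graph_isoI[of id]) (auto simp: s0_E_def)
    have "cgraph s0_V s0_E" using s0_rgraph by (rule rgraph.axioms(1))
    then show ?thesis using both[OF 5 gosset_rgraph constant_if_local[OF gosset_rgraph base_in s]] by blast
  qed
  then show "rgraph W F" "\<exists>c. constant_curvature W F c" by auto
qed

theorem theorem4p2:
  fixes V :: "'a set" and E :: "'a \<Rightarrow> 'a \<Rightarrow> bool"
  assumes "simple_graph V E" and "connected_graph V E" and "card V \<ge> 2"
  shows "(bonnet_myers_sharp V E \<longleftrightarrow> reflective V E \<and> (\<exists>c. constant_curvature V E c))
       \<and> ((reflective V E \<and> (\<exists>c. constant_curvature V E c)) \<longleftrightarrow>
          ((\<exists>W F. in_family W F \<and> graph_iso V E W F) \<or>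
           (\<exists>gs c. length gs \<ge> 2 \<and>
              (\<forall>H\<in>set gs. in_family (fst H) (snd H) \<and> constant_curvature (fst H) (snd H) c) \<and>
              graph_iso V E (prod_V gs) (prod_E gs))))"
    (is "?sharp = ?refl \<and> (?refl \<longleftrightarrow> ?single \<or> ?product)")
proof -
  interpret cgraph V E using assms by unfold_locales
  have neV: "V \<noteq> {}" using assms(3) by auto
  have "?single \<or> ?product" if r: ?refl
  proof -
    have rg: "rgraph V E" using reflective_imp_rgraph r by blast
    obtain c where c: "constant_curvature V E c" using r by blast
    obtain gs where gs: "\<And>H. H \<in> set gs \<Longrightarrow> model (fst H) (snd H)" "graph_iso V E (prod_V gs) (prod_E gs)"
      using rgraph_classification[OF rg neV] by blast
    interpret P: rgraph_list gs by (rule rgraph_listI) (rule model_rgraph[OF gs(1)])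
    have card: "card V = card (prod_V gs)" using graph_iso_card[OF gs(2)] .
    then have ne: "prod_V gs \<noteq> {}" using assms(3) by auto
    have "constant_curvature (prod_V gs) (prod_E gs) c" using iso_constant[OF gs(2) rg P.prod_rgraph] c by blast
    then have ci: "\<forall>i<length gs. constant_curvature (fst (gs ! i)) (snd (gs ! i)) c" using P.prod_constant[OF ne] by blast
    \<comment> \<open>The number of factors decides between the two alternatives; an empty product
      has one vertex and is excluded by \<open>card V \<ge> 2\<close>.\<close>
    consider "gs = []" | H where "gs = [H]" | "length gs \<ge> 2" by (cases gs; cases "tl gs") auto
    then show ?thesis
    proof cases
      case 1
      then have "prod_V gs = {[]}" by (auto simp: prod_V_def)
      then show ?thesis using card assms(3) by simp
    next
      case (2 H)
      have m: "model (fst H) (snd H)" using gs(1) 2 by simp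
      have "graph_iso (prod_V gs) (prod_E gs) (fst H) (snd H)"
        using prod_single[of "fst H" "snd H"] model_rgraph[OF m] 2 by (simp add: rgraph_def cgraph_def)
      then show ?thesis using graph_iso_trans[OF gs(2)] model_family[OF m] by blast
    next
      case 3
      have "\<forall>H\<in>set gs. in_family (fst H) (snd H) \<and> constant_curvature (fst H) (snd H) c"
        using model_family gs(1) ci by (metis in_set_conv_nth)
      then show ?thesis using 3 gs(2) by blast
    qed
  qed
  moreover have ?refl if single: ?single
  proof -
    obtain W F where W: "in_family W F" "graph_iso V E W F" using single by blast
    have sg: "simple_graph W F" using W(1) by (simp add: in_family_def)
    have "connected_graph W F"
      using iso_cgraph[OF graph_iso_sym[OF W(2)] sg cgraph_axioms] by (rule cgraph.conn)
    moreover have "W \<noteq> {}" using graph_iso_card[OF W(2)] assms(3) by auto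
    ultimately have F: "rgraph W F" "\<exists>c. constant_curvature W F c" using family_rgraph[OF W(1)] by blast+
    have "rgraph V E" by (rule iso_rgraph[OF W(2) assms(1) F(1)])
    then show ?thesis using rgraph.reflective iso_constant[OF W(2) _ F(1)] F(2) by blast
  qed
  moreover have ?refl if product: ?product
  proof -
    obtain gs c where gs: "\<And>H. H \<in> set gs \<Longrightarrow> in_family (fst H) (snd H) \<and> constant_curvature (fst H) (snd H) c"
      "graph_iso V E (prod_V gs) (prod_E gs)" using product by blast
    interpret G: graph_list gs using gs(1) by unfold_locales (simp add: in_family_def)
    have ne: "prod_V gs \<noteq> {}" using graph_iso_card[OF gs(2)] assms(3) by auto
    \<comment> \<open>Connectedness of the product is inherited from \<open>V\<close> and then
      passed to the factors, as \<open>family_rgraph\<close> requires it of each.\<close>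
    have con: "connected_graph (prod_V gs) (prod_E gs)"
      using iso_cgraph[OF graph_iso_sym[OF gs(2)] G.prod_simple cgraph_axioms] by (rule cgraph.conn)
    have "rgraph (fst (gs ! i)) (snd (gs ! i))" if i: "i < length gs" for i
    proof (rule family_rgraph(1))
      show "in_family (fst (gs ! i)) (snd (gs ! i))" using gs(1) i by simp
      show "connected_graph (fst (gs ! i)) (snd (gs ! i))" using G.connected_factor[OF con ne i] by (rule cgraph.conn)
      show "fst (gs ! i) \<noteq> {}" using ne prod_V_nth[OF _ i] by blast
    qed
    then interpret P: rgraph_list gs by (rule rgraph_list.intro)
    have c: "constant_curvature (prod_V gs) (prod_E gs) c" using P.prod_constant[OF ne] gs(1) by simp
    have "rgraph V E" by (rule iso_rgraph[OF gs(2) assms(1) P.prod_rgraph])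
    then show ?thesis using rgraph.reflective iso_constant[OF gs(2) _ P.prod_rgraph] c by blast
  qed
  ultimately have "?refl \<longleftrightarrow> ?single \<or> ?product" by blast
  then show ?thesis using sharp_iff[OF assms(3)] by blast
qed

end
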